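(* Let $n\geq3$. Applying the Long-Moody construction $\mathbf{LM}_{1}$ to the representation $Bur^{*}_{n+1,t}$ gives the short exact sequence of $\mathbf{wB}_{n}$-representations: $$0\longrightarrow Bur_{n,qt}\longrightarrow q^{-1}\mathbf{LM}_{1}\left(qBur^{*}_{n+1,t}\right)\longrightarrow Bur_{n,t}\underset{\mathbb{Z}[t^{\pm1},q^{\pm1}]}{\otimes}Bur_{n,q}^{*}\longrightarrow 0 .$$
   Context: The welded braid group $\mathbf{wB}_{n}$ is the group with generators $\sigma_{i},\tau_{i}$, $1\leq i\leq n-1$, and relations: (1) $\sigma_{i}\sigma_{k}=\sigma_{k}\sigma_{i}$, $\tau_{i}\tau_{k}=\tau_{k}\tau_{i}$ and $\sigma_{i}\tau_{k}=\tau_{k}\sigma_{i}$ if $|i-k|\geq 2$; (2) $\sigma_{i}\sigma_{i+1}\sigma_{i}=\sigma_{i+1}\sigma_{i}\sigma_{i+1}$ and $\tau_{i}\tau_{i+1}\tau_{i}=\tau_{i+1}\tau_{i}\tau_{i+1}$ for $1\leq i\leq n-2$; (3) $\tau_{i}^{2}=1$ for $1\leq i\leq n-1$; (4) $\tau_{i}\sigma_{i+1}\sigma_{i}=\sigma_{i+1}\sigma_{i}\tau_{i+1}$ and $\sigma_{i}\tau_{i+1}\tau_{i}=\tau_{i+1}\tau_{i}\sigma_{i+1}$ for $1\leq i\leq n-2$. Products are read from right to left (as composition of maps). The homomorphism $id_1*-:\mathbf{wB}_n\to\mathbf{wB}_{n+1}$ sends $\sigma_i\mapsto\sigma_{i+1}$,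 $\tau_i\mapsto\tau_{i+1}$. $\mathbf{F}_n=\langle x_1,\ldots,x_n\rangle$ is the free group. The Artin homomorphism $a_n:\mathbf{wB}_n\to\mathrm{Aut}(\mathbf{F}_n)$ sends $\sigma_i$ to the automorphism $x_i\mapsto x_{i+1}$, $x_{i+1}\mapsto x_{i+1}^{-1}x_ix_{i+1}$, $x_j\mapsto x_j$ for $j\notin\{i,i+1\}$, and $\tau_i$ to the automorphism exchanging $x_i$ and $x_{i+1}$ and fixing the other $x_j$. The morphism $\xi_{n,1}:\mathbf{F}_n\to\mathbf{wB}_{n+1}$ is defined by $x_i\mapsto(\tau_{i-1}\cdots\tau_2\tau_1)^{-1}(\sigma_i\tau_i)(\tau_{i-1}\cdots\tau_2\tau_1)$. It satisfies $(id_1*\lambda)\,\xi_{n,1}(x)=\xi_{n,1}(a_n(\lambda)(x))\,(id_1*\lambda)$ for all $\lambda\in\mathbf{wB}_n$, $x\in\mathbf{F}_n$. Let $\mathcal{I}_{\mathbf{F}_n}$ be the augmentation ideal of $\mathbb{Z}[\mathbf{F}_n]$, with the action of $\mathbf{wB}_n$ induced by $a_n$. For a representation $\rho:\mathbf{wB}_{n+1}\to\mathrm{Aut}(V)$, regard $V$ as an $\mathbf{F}_n$-module via $\rho\circ\xi_{n,1}$. The Long-Moody construction $\mathbf{LM}_1(\rho)$ is the representation of $\mathbf{wB}_n$ on $\mathcal{I}_{\mathbf{F}_n}\otimes_{\mathbb{Z}[\mathbf{F}_n]}V$ given by $$\mathbf{LM}_1(\rho)(\lambda)(i\otimes v)=a_n(\lambda)(i)\otimes\rho(id_1*\lambda)(v).$$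 For an invertible element $r$ of a ring $R$ and a representation $\rho$ of $\mathbf{wB}_m$ over $R$, $r$ also denotes the one-dimensional representation $\sigma_i\mapsto r$, $\tau_i\mapsto1$, and $r\rho$ denotes $r\otimes_R\rho$. Here one works over $R=\mathbb{Z}[t^{\pm1},q^{\pm1}]$. For a unit $u\in R$ and $m\geq2$, the Burau representation $Bur_{m,u}:\mathbf{wB}_m\to GL_m(R)$ is $\sigma_{i}\mapsto Id_{i-1}\oplus\begin{pmatrix}0 & u\\ 1 & 1-u\end{pmatrix}\oplus Id_{m-i-1}$, $\tau_{i}\mapsto Id_{i-1}\oplus\begin{pmatrix}0 & 1\\ 1 & 0\end{pmatrix}\oplus Id_{m-i-1}$. The dual Burau representation $Bur^*_{m,u}:\mathbf{wB}_m\to GL_m(R)$ sends each generator to the transpose of the inverse of its matrix under $Bur_{m,u}$.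
   Formalization: No R-linear sequence with these outer terms exists (determinants of σ_1 differ). Formalized with equivariant maps semilinear over t↦t⁻¹ (first map) and t↔q (second); equivalently R-linear with outer terms Bur_{n,qt⁻¹} and Bur_{n,q}⊗Bur*_{n,t}. *)

theory Defs
  imports
    "HOL-Algebra.Bij"
    "HOL-Algebra.AbelCoset"
    "HOL-Algebra.QuotRing"
    "HOL-Algebra.Generated_Groups"
    "HOL-Algebra.Free_Abelian_Groups"
    "HOL-Library.Poly_Mapping"
    "HOL-Library.Product_Plus"
    "Jordan_Normal_Form.Matrix"
    "Jordan_Normal_Form.VS_Connect"
begin

section \<open>Groups given by generators and relations\<close>

text \<open>A letter \<open>(x, True)\<close> is the generator \<open>x\<close>, a letter \<open>(x, False)\<close> its formal inverse.\<close>

type_synonym 'g word = "('g \<times> bool) list"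

inductive word_eq :: "'g set \<Rightarrow> ('g word \<times> 'g word) set \<Rightarrow> 'g word \<Rightarrow> 'g word \<Rightarrow> bool"
  for X :: "'g set" and Rel :: "('g word \<times> 'g word) set" where
  refl: "u \<in> lists (X \<times> UNIV) \<Longrightarrow> word_eq X Rel u u"
| sym: "word_eq X Rel u v \<Longrightarrow> word_eq X Rel v u"
| trans: "word_eq X Rel u v \<Longrightarrow> word_eq X Rel v w \<Longrightarrow> word_eq X Rel u w"
| cong: "word_eq X Rel u u' \<Longrightarrow> word_eq X Rel v v' \<Longrightarrow> word_eq X Rel (u @ v) (u' @ v')"
| cancel: "x \<in> X \<Longrightarrow> word_eq X Rel [(x, b), (x, \<not> b)] []"
| rel: "(u, v) \<in> Rel \<Longrightarrow> u \<in> lists (X \<times> UNIV) \<Longrightarrow> v \<in> lists (X \<times> UNIV) \<Longrightarrow> word_eq X Rel u v"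

definition word_class :: "'g set \<Rightarrow> ('g word \<times> 'g word) set \<Rightarrow> 'g word \<Rightarrow> 'g word set" where
  "word_class X Rel w = {v. word_eq X Rel w v}"

definition presented_group :: "'g set \<Rightarrow> ('g word \<times> 'g word) set \<Rightarrow> 'g word set monoid" where
  "presented_group X Rel =
     \<lparr>carrier = word_class X Rel ` lists (X \<times> UNIV),
      mult = (\<lambda>U V. \<Union>u\<in>U. \<Union>v\<in>V. word_class X Rel (u @ v)),
      one = word_class X Rel []\<rparr>"

definition eval_word :: "('h, 'b) monoid_scheme \<Rightarrow> ('g \<Rightarrow> 'h) \<Rightarrow> 'g word \<Rightarrow> 'h" where
  "eval_word H f w =
     foldr (\<lambda>(x, b) y. (if b then f x else inv\<^bsub>H\<^esub> (f x)) \<otimes>\<^bsub>H\<^esub> y) w \<one>\<^bsub>H\<^esub>"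

text \<open>The homomorphism to \<open>H\<close> with values \<open>f\<close> on the generators. The value does not depend on the
  chosen representative exactly when \<open>f\<close> respects the relations.\<close>

definition presented_hom ::
    "'g set \<Rightarrow> ('g word \<times> 'g word) set \<Rightarrow> ('h, 'b) monoid_scheme \<Rightarrow> ('g \<Rightarrow> 'h) \<Rightarrow> 'g word set \<Rightarrow> 'h" where
  "presented_hom X Rel H f =
     (\<lambda>W\<in>carrier (presented_group X Rel). eval_word H f (SOME w. w \<in> W))"


section \<open>Free groups and welded braid groups\<close>

definition free_group :: "nat \<Rightarrow> nat word set monoid" where
  "free_group n = presented_group {1..n} {}"

definition free_gen :: "nat \<Rightarrow> nat \<Rightarrow> nat word set" where
  "free_gen n i = word_class {1..n} {} [(i, True)]"

definition free_hom :: "nat \<Rightarrow> ('h, 'b) monoid_scheme \<Rightarrow> (nat \<Rightarrow> 'h) \<Rightarrow> nat word set \<Rightarrow> 'h" where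
  "free_hom n = presented_hom {1..n} {}"

datatype wgen = Sig nat | Tau nat

definition wB_gens :: "nat \<Rightarrow> wgen set" where
  "wB_gens n = Sig ` {1..<n} \<union> Tau ` {1..<n}"

abbreviation pos_word :: "'g list \<Rightarrow> 'g word" where
  "pos_word gs \<equiv> map (\<lambda>g. (g, True)) gs"

definition wB_rels :: "nat \<Rightarrow> (wgen word \<times> wgen word) set" where
  "wB_rels n =
     (\<Union>i\<in>{1..<n}. \<Union>k\<in>{k\<in>{1..<n}. \<bar>int i - int k\<bar> \<ge> 2}.
        {(pos_word [Sig i, Sig k], pos_word [Sig k, Sig i]),
         (pos_word [Tau i, Tau k], pos_word [Tau k, Tau i]),
         (pos_word [Sig i, Tau k], pos_word [Tau k, Sig i])}) \<union>
     (\<Union>i\<in>{i. 1 \<le> i \<and> i + 2 \<le> n}.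
        {(pos_word [Sig i, Sig (i+1), Sig i], pos_word [Sig (i+1), Sig i, Sig (i+1)]),
         (pos_word [Tau i, Tau (i+1), Tau i], pos_word [Tau (i+1), Tau i, Tau (i+1)])}) \<union>
     (\<Union>i\<in>{1..<n}. {(pos_word [Tau i, Tau i], [])}) \<union>
     (\<Union>i\<in>{i. 1 \<le> i \<and> i + 2 \<le> n}.
        {(pos_word [Tau i, Sig (i+1), Sig i], pos_word [Sig (i+1), Sig i, Tau (i+1)]),
         (pos_word [Sig i, Tau (i+1), Tau i], pos_word [Tau (i+1), Tau i, Sig (i+1)])})"

definition wB :: "nat \<Rightarrow> wgen word set monoid" where
  "wB n = presented_group (wB_gens n) (wB_rels n)"

definition wB_class :: "nat \<Rightarrow> wgen list \<Rightarrow> wgen word set" where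
  "wB_class n gs = word_class (wB_gens n) (wB_rels n) (pos_word gs)"

definition wB_hom :: "nat \<Rightarrow> ('h, 'b) monoid_scheme \<Rightarrow> (wgen \<Rightarrow> 'h) \<Rightarrow> wgen word set \<Rightarrow> 'h" where
  "wB_hom n = presented_hom (wB_gens n) (wB_rels n)"

text \<open>The homomorphism \<open>id\<^sub>1 * -\<close> from \<open>wB n\<close> to \<open>wB (n+1)\<close>.\<close>

definition wB_shift :: "nat \<Rightarrow> wgen word set \<Rightarrow> wgen word set" where
  "wB_shift n = wB_hom n (wB (n+1))
     (\<lambda>g. case g of Sig i \<Rightarrow> wB_class (n+1) [Sig (i+1)] | Tau i \<Rightarrow> wB_class (n+1) [Tau (i+1)])"

text \<open>Products in \<open>AutoGroup\<close> are composites \<open>g \<circ> f\<close>, so products are read from right to left.\<close>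

definition artin :: "nat \<Rightarrow> wgen word set \<Rightarrow> nat word set \<Rightarrow> nat word set" where
  "artin n = wB_hom n (AutoGroup (free_group n))
     (\<lambda>g. case g of
        Sig i \<Rightarrow> free_hom n (free_group n)
          (\<lambda>j. if j = i then free_gen n (i+1)
               else if j = i+1 then
                 inv\<^bsub>free_group n\<^esub> (free_gen n (i+1)) \<otimes>\<^bsub>free_group n\<^esub> free_gen n i
                   \<otimes>\<^bsub>free_group n\<^esub> free_gen n (i+1)
               else free_gen n j)
      | Tau i \<Rightarrow> free_hom n (free_group n)
          (\<lambda>j. if j = i then free_gen n (i+1)
               else if j = i+1 then free_gen n i
               else free_gen n j))"

definition xi :: "nat \<Rightarrow> nat word set \<Rightarrow> wgen word set" where
  "xi n = free_hom n (wB (n+1))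
     (\<lambda>i. let T = wB_class (n+1) (map Tau (rev [1..<i])) in
        inv\<^bsub>wB (n+1)\<^esub> T \<otimes>\<^bsub>wB (n+1)\<^esub> wB_class (n+1) [Sig i, Tau i] \<otimes>\<^bsub>wB (n+1)\<^esub> T)"


section \<open>Integral group rings\<close>

definition group_ring :: "('g, 'b) monoid_scheme \<Rightarrow> ('g \<Rightarrow>\<^sub>0 int) ring" where
  "group_ring G =
     \<lparr>carrier = carrier (free_Abelian_group (carrier G)),
      mult = (\<lambda>a b. frag_extend (\<lambda>g. frag_extend (\<lambda>h. frag_of (g \<otimes>\<^bsub>G\<^esub> h)) b) a),
      one = frag_of \<one>\<^bsub>G\<^esub>,
      ring.zero = 0,
      ring.add = (+)\<rparr>"

definition augmentation :: "('g \<Rightarrow>\<^sub>0 int) \<Rightarrow> int" where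
  "augmentation a = (\<Sum>g\<in>Poly_Mapping.keys a. Poly_Mapping.lookup a g)"

definition augmentation_ideal :: "('g, 'b) monoid_scheme \<Rightarrow> ('g \<Rightarrow>\<^sub>0 int) set" where
  "augmentation_ideal G = {a \<in> carrier (group_ring G). augmentation a = 0}"

text \<open>The \<open>\<int>[G]\<close>-module structure on an abelian group \<open>V\<close> on which \<open>G\<close> acts by \<open>\<phi>\<close>.\<close>

definition group_ring_act ::
    "('v, 'm) ring_scheme \<Rightarrow> ('g \<Rightarrow> 'v \<Rightarrow> 'v) \<Rightarrow> ('g \<Rightarrow>\<^sub>0 int) \<Rightarrow> 'v \<Rightarrow> 'v" where
  "group_ring_act V \<phi> a v =
     (\<Oplus>\<^bsub>V\<^esub>g\<in>Poly_Mapping.keys a. [Poly_Mapping.lookup a g] \<cdot>\<^bsub>V\<^esub> (\<phi> g v))"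


section \<open>Tensor products\<close>

text \<open>The tensor product over a possibly noncommutative ring with carrier \<open>A\<close>, acting on \<open>M\<close> from
  the right by \<open>ra\<close> and on \<open>N\<close> from the left by \<open>la\<close>, is the free abelian group on \<open>M \<times> N\<close>
  modulo the subgroup generated by the balanced biadditivity relations.\<close>

definition tensor_free ::
    "('m, 'x) ring_scheme \<Rightarrow> ('n, 'y) ring_scheme \<Rightarrow> (('m \<times> 'n) \<Rightarrow>\<^sub>0 int) monoid" where
  "tensor_free M N = free_Abelian_group (carrier M \<times> carrier N)"

definition tensor_rels ::
    "'a set \<Rightarrow> ('m, 'x) ring_scheme \<Rightarrow> ('m \<Rightarrow> 'a \<Rightarrow> 'm) \<Rightarrow>
     ('n, 'y) ring_scheme \<Rightarrow> ('a \<Rightarrow> 'n \<Rightarrow> 'n) \<Rightarrow> (('m \<times> 'n) \<Rightarrow>\<^sub>0 int) set" where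
  "tensor_rels A M ra N la =
     {frag_of (x \<oplus>\<^bsub>M\<^esub> x', y) - frag_of (x, y) - frag_of (x', y) | x x' y.
        x \<in> carrier M \<and> x' \<in> carrier M \<and> y \<in> carrier N} \<union>
     {frag_of (x, y \<oplus>\<^bsub>N\<^esub> y') - frag_of (x, y) - frag_of (x, y') | x y y'.
        x \<in> carrier M \<and> y \<in> carrier N \<and> y' \<in> carrier N} \<union>
     {frag_of (ra x a, y) - frag_of (x, la a y) | x a y.
        x \<in> carrier M \<and> a \<in> A \<and> y \<in> carrier N}"

definition tensor_null ::
    "'a set \<Rightarrow> ('m, 'x) ring_scheme \<Rightarrow> ('m \<Rightarrow> 'a \<Rightarrow> 'm) \<Rightarrow>
     ('n, 'y) ring_scheme \<Rightarrow> ('a \<Rightarrow> 'n \<Rightarrow> 'n) \<Rightarrow> (('m \<times> 'n) \<Rightarrow>\<^sub>0 int) set" where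
  "tensor_null A M ra N la = generate (tensor_free M N) (tensor_rels A M ra N la)"

definition tensor_group ::
    "'a set \<Rightarrow> ('m, 'x) ring_scheme \<Rightarrow> ('m \<Rightarrow> 'a \<Rightarrow> 'm) \<Rightarrow>
     ('n, 'y) ring_scheme \<Rightarrow> ('a \<Rightarrow> 'n \<Rightarrow> 'n) \<Rightarrow> (('m \<times> 'n) \<Rightarrow>\<^sub>0 int) set monoid" where
  "tensor_group A M ra N la = tensor_free M N Mod tensor_null A M ra N la"

text \<open>The endomorphism \<open>h \<otimes> k\<close>; the union is over representatives \<open>c\<close> of the coset \<open>C\<close>, and is a
  single coset whenever \<open>h \<otimes> k\<close> is well defined.\<close>

definition tensor_map ::
    "'a set \<Rightarrow> ('m, 'x) ring_scheme \<Rightarrow> ('m \<Rightarrow> 'a \<Rightarrow> 'm) \<Rightarrow>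
     ('n, 'y) ring_scheme \<Rightarrow> ('a \<Rightarrow> 'n \<Rightarrow> 'n) \<Rightarrow> ('m \<Rightarrow> 'm) \<Rightarrow> ('n \<Rightarrow> 'n) \<Rightarrow>
     (('m \<times> 'n) \<Rightarrow>\<^sub>0 int) set \<Rightarrow> (('m \<times> 'n) \<Rightarrow>\<^sub>0 int) set" where
  "tensor_map A M ra N la h k =
     (\<lambda>C\<in>carrier (tensor_group A M ra N la).
        \<Union>c\<in>C. tensor_null A M ra N la #>\<^bsub>tensor_free M N\<^esub>
                 frag_extend (\<lambda>(x, y). frag_of (h x, k y)) c)"

text \<open>Scalars act through the right-hand factor. The fields \<open>mult\<close> and \<open>one\<close> of the record have no
  meaning for a module.\<close>

definition tensor_module ::
    "'a set \<Rightarrow> ('m, 'x) ring_scheme \<Rightarrow> ('m \<Rightarrow> 'a \<Rightarrow> 'm) \<Rightarrow>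
     ('r, 'n) module \<Rightarrow> ('a \<Rightarrow> 'n \<Rightarrow> 'n) \<Rightarrow> ('r, (('m \<times> 'n) \<Rightarrow>\<^sub>0 int) set) module" where
  "tensor_module A M ra N la =
     \<lparr>carrier = carrier (tensor_group A M ra N la),
      mult = undefined,
      one = undefined,
      ring.zero = \<one>\<^bsub>tensor_group A M ra N la\<^esub>,
      ring.add = monoid.mult (tensor_group A M ra N la),
      smult = (\<lambda>r. tensor_map A M ra N la (\<lambda>x. x) (\<lambda>y. r \<odot>\<^bsub>N\<^esub> y))\<rparr>"


section \<open>Representations over a commutative ring\<close>

text \<open>The coefficient ring is a type, seen as a ring with full carrier through \<open>class_ring\<close>.\<close>

record ('g, 'r, 'v) rep =
  space :: "('r, 'v) module"
  act :: "'g \<Rightarrow> 'v \<Rightarrow> 'v"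

definition module_Aut :: "('r :: comm_ring_1, 'v) module \<Rightarrow> ('v \<Rightarrow> 'v) monoid" where
  "module_Aut V = (BijGroup (carrier V))
     \<lparr>carrier := {f \<in> Bij (carrier V). f \<in> hom (add_monoid V) (add_monoid V) \<and>
                    (\<forall>r. \<forall>v\<in>carrier V. f (r \<odot>\<^bsub>V\<^esub> v) = r \<odot>\<^bsub>V\<^esub> f v)}\<rparr>"

definition representation ::
    "('g, 'b) monoid_scheme \<Rightarrow> ('g, 'r :: comm_ring_1, 'v) rep \<Rightarrow> bool" where
  "representation G \<rho> \<longleftrightarrow>
     module (class_ring :: 'r ring) (space \<rho>) \<and> group_hom G (module_Aut (space \<rho>)) (act \<rho>)"

text \<open>Equivariant maps, semilinear over \<open>\<alpha>\<close>. For \<open>\<alpha> = id\<close> these are the homomorphisms of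
  representations over the coefficient ring.\<close>

definition rep_hom ::
    "('g, 'b) monoid_scheme \<Rightarrow> ('r :: comm_ring_1 \<Rightarrow> 'r) \<Rightarrow>
     ('g, 'r, 'v) rep \<Rightarrow> ('g, 'r, 'w) rep \<Rightarrow> ('v \<Rightarrow> 'w) set" where
  "rep_hom G \<alpha> \<rho> \<rho>' =
     {f \<in> hom (add_monoid (space \<rho>)) (add_monoid (space \<rho>')).
        (\<forall>r. \<forall>v\<in>carrier (space \<rho>). f (r \<odot>\<^bsub>space \<rho>\<^esub> v) = \<alpha> r \<odot>\<^bsub>space \<rho>'\<^esub> f v) \<and>
        (\<forall>g\<in>carrier G. \<forall>v\<in>carrier (space \<rho>). f (act \<rho> g v) = act \<rho>' g (f v))}"

definition short_exact_sequence ::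
    "('g, 'b) monoid_scheme \<Rightarrow> ('r :: comm_ring_1 \<Rightarrow> 'r) \<Rightarrow> ('r \<Rightarrow> 'r) \<Rightarrow>
     ('g, 'r, 'u) rep \<Rightarrow> ('g, 'r, 'v) rep \<Rightarrow> ('g, 'r, 'w) rep \<Rightarrow> bool" where
  "short_exact_sequence G \<alpha> \<beta> \<rho>1 \<rho>2 \<rho>3 \<longleftrightarrow>
     representation G \<rho>1 \<and> representation G \<rho>2 \<and> representation G \<rho>3 \<and>
     \<alpha> \<in> ring_iso class_ring class_ring \<and> \<beta> \<in> ring_iso class_ring class_ring \<and>
     (\<exists>f g. f \<in> rep_hom G \<alpha> \<rho>1 \<rho>2 \<and> g \<in> rep_hom G \<beta> \<rho>2 \<rho>3 \<and>
        inj_on f (carrier (space \<rho>1)) \<and>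
        f ` carrier (space \<rho>1) = a_kernel (space \<rho>2) (space \<rho>3) g \<and>
        g ` carrier (space \<rho>2) = carrier (space \<rho>3))"

definition tensor_rep ::
    "('g, 'b) monoid_scheme \<Rightarrow> ('g, 'r :: comm_ring_1, 'v) rep \<Rightarrow> ('g, 'r, 'w) rep \<Rightarrow>
     ('g, 'r, (('v \<times> 'w) \<Rightarrow>\<^sub>0 int) set) rep" where
  "tensor_rep G \<rho> \<rho>' =
     (let V = space \<rho>; W = space \<rho>'; ra = (\<lambda>v r. r \<odot>\<^bsub>V\<^esub> v); la = smult W in
      \<lparr>space = tensor_module (UNIV :: 'r set) V ra W la,
       act = (\<lambda>g\<in>carrier G. tensor_map UNIV V ra W la (act \<rho> g) (act \<rho>' g))\<rparr>)"

definition matrix_rep ::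
    "nat \<Rightarrow> ('g \<Rightarrow> 'r :: comm_ring_1 mat) \<Rightarrow> ('g, 'r, 'r vec) rep" where
  "matrix_rep m \<mu> =
     \<lparr>space = module_vec TYPE('r) m, act = (\<lambda>g. \<lambda>v\<in>carrier_vec m. \<mu> g *\<^sub>v v)\<rparr>"

definition regular_module :: "('r :: comm_ring_1, 'r) module" where
  "regular_module =
     \<lparr>carrier = UNIV, mult = (*), one = 1, ring.zero = 0, ring.add = (+), smult = (*)\<rparr>"

definition one_dim_rep :: "nat \<Rightarrow> 'r :: comm_ring_1 \<Rightarrow> (wgen word set, 'r, 'r) rep" where
  "one_dim_rep m r =
     \<lparr>space = regular_module,
      act = (\<lambda>w x. wB_hom m (units_of class_ring) (\<lambda>g. case g of Sig i \<Rightarrow> r | Tau i \<Rightarrow> 1) w * x)\<rparr>"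

definition scale_rep ::
    "nat \<Rightarrow> 'r :: comm_ring_1 \<Rightarrow> (wgen word set, 'r, 'v) rep \<Rightarrow>
     (wgen word set, 'r, (('r \<times> 'v) \<Rightarrow>\<^sub>0 int) set) rep" where
  "scale_rep m r \<rho> = tensor_rep (wB m) (one_dim_rep m r) \<rho>"


section \<open>The Long-Moody construction\<close>

definition LM1 ::
    "nat \<Rightarrow> (wgen word set, 'r :: comm_ring_1, 'v) rep \<Rightarrow>
     (wgen word set, 'r, (((nat word set \<Rightarrow>\<^sub>0 int) \<times> 'v) \<Rightarrow>\<^sub>0 int) set) rep" where
  "LM1 n \<rho> =
     (let ZF = group_ring (free_group n);
          I = ZF\<lparr>carrier := augmentation_ideal (free_group n)\<rparr>;
          V = space \<rho>;
          la = group_ring_act V (\<lambda>x. act \<rho> (xi n x))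
      in
      \<lparr>space = tensor_module (carrier ZF) I (monoid.mult ZF) V la,
       act = (\<lambda>w\<in>carrier (wB n).
         tensor_map (carrier ZF) I (monoid.mult ZF) V la
           (frag_extend (\<lambda>x. frag_of (artin n w x))) (act \<rho> (wB_shift n w)))\<rparr>)"


section \<open>Burau representations\<close>

definition GL :: "nat \<Rightarrow> 'r :: comm_ring_1 mat monoid" where
  "GL m = units_of (ring_mat TYPE('r) m ())"

definition burau_matrix :: "nat \<Rightarrow> 'r :: comm_ring_1 \<Rightarrow> wgen \<Rightarrow> 'r mat" where
  "burau_matrix m u g =
     (case g of
        Sig i \<Rightarrow> diag_block_mat
          [1\<^sub>m (i - 1), mat_of_rows_list 2 [[0, u], [1, 1 - u]], 1\<^sub>m (m - i - 1)]
      | Tau i \<Rightarrow> diag_block_mat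
          [1\<^sub>m (i - 1), mat_of_rows_list 2 [[0, 1], [1, 0]], 1\<^sub>m (m - i - 1)])"

definition Bur :: "nat \<Rightarrow> 'r :: comm_ring_1 \<Rightarrow> (wgen word set, 'r, 'r vec) rep" where
  "Bur m u = matrix_rep m (wB_hom m (GL m) (burau_matrix m u))"

definition Bur_dual :: "nat \<Rightarrow> 'r :: comm_ring_1 \<Rightarrow> (wgen word set, 'r, 'r vec) rep" where
  "Bur_dual m u = matrix_rep m
     (wB_hom m (GL m) (\<lambda>g. transpose_mat (inv\<^bsub>GL m\<^esub> (burau_matrix m u g))))"


section \<open>Laurent polynomials in two variables\<close>

text \<open>\<open>\<int>[t\<^sup>\<plusminus>\<^sup>1, q\<^sup>\<plusminus>\<^sup>1]\<close> is the group ring of \<open>\<int>\<^sup>2\<close> with the convolution product; the basis element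
  \<open>(i, j)\<close> is \<open>t\<^sup>i q\<^sup>j\<close>.\<close>

type_synonym laurent = "(int \<times> int) \<Rightarrow>\<^sub>0 int"

definition t_var :: laurent where "t_var = frag_of (1, 0)"
definition q_var :: laurent where "q_var = frag_of (0, 1)"
definition q_inv :: laurent where "q_inv = inv\<^bsub>class_ring\<^esub> q_var"

text \<open>The ring automorphisms \<open>t \<mapsto> t\<^sup>-\<^sup>1, q \<mapsto> q\<close> and \<open>t \<mapsto> q, q \<mapsto> t\<close>. They are needed because
  no short exact sequence with outer terms \<open>Bur n (q t)\<close> and \<open>Bur n t \<otimes> Bur_dual n q\<close> has linear
  maps: up to sign, the generator \<open>Sig i\<close> has determinant \<open>q\<^sup>n\<^sup>+\<^sup>1 t\<^sup>-\<^sup>n\<^sup>-\<^sup>1\<close> on the middle term and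
  \<open>q\<^sup>1\<^sup>-\<^sup>n t\<^sup>n\<^sup>+\<^sup>1\<close> on the sum of the outer ones. Twisting the scalars of the outer terms by these
  automorphisms turns them into \<open>Bur n (q t\<^sup>-\<^sup>1)\<close> and \<open>Bur n q \<otimes> Bur_dual n t\<close>.\<close>

definition invert_t :: "laurent \<Rightarrow> laurent" where
  "invert_t = frag_extend (\<lambda>(i, j). frag_of (- i, j))"

definition swap_t_q :: "laurent \<Rightarrow> laurent" where
  "swap_t_q = frag_extend (\<lambda>(i, j). frag_of (j, i))"

end

theory Submission
  imports Defs
begin

text \<open>All representations involved are free of finite rank, so they are compared in coordinates. The
  augmentation ideal of \<open>\<int>[F\<^sub>n]\<close> is a free right module on the elements \<open>x\<^sub>j - 1\<close>, whence
  \<open>LM\<^sub>1(V)\<close> is a sum of \<open>n\<close> copies of \<open>V\<close>, and the group acts on it through the Fox derivatives of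
  the Artin automorphisms. Let \<open>V = q Bur\<^sup>*\<^sub>n\<^sub>+\<^sub>1\<^sub>,\<^sub>t\<close> with basis \<open>e\<^sub>0, \<dots>, e\<^sub>n\<close>. The free generator \<open>x\<^sub>i\<close> acts by
  \<open>e\<^sub>0 \<mapsto> q t\<^sup>-\<^sup>1 e\<^sub>0\<close>, \<open>e\<^sub>i \<mapsto> q ((1 - t\<^sup>-\<^sup>1) e\<^sub>0 + e\<^sub>i)\<close> and by \<open>q\<close> on the other \<open>e\<^sub>j\<close>. Hence
  the line of \<open>e\<^sub>0\<close> is stable and gives the subrepresentation spanned by the \<open>(x\<^sub>j - 1) \<otimes> e\<^sub>0\<close>, a Burau
  representation with parameter \<open>q t\<^sup>-\<^sup>1\<close>; on the quotient every \<open>x\<^sub>i\<close> acts by the scalar \<open>q\<close>, so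
  that the Fox derivatives become those of the Burau representation with parameter \<open>q\<close>.\<close>

section \<open>Presented groups\<close>

text \<open>All objects are quotients: classes of words, cosets in free abelian groups. To know a
  tensor product is to know its relation subgroup exactly; this comes from a bilinear map together
  with a section of it modulo the relations. Modules then become sets of functions on an index set,
  and actions explicit operators \<open>K\<close> on them. That \<open>LM1\<close> gives an action
  rests on the commutation of \<open>xi\<close> with the Artin action. It is not derived inside the
  welded braid group; its image in the representation at hand is checked instead, which suffices and
  amounts to identities between functions. The factor \<open>q\<close> that each
  \<open>Sig i\<close> carries on \<open>V\<close> is cancelled by the outer \<open>q_inv\<close>.
  What is left has parameter \<open>q t^-1\<close> on the sub and the pair \<open>q\<close>,
  \<open>t\<close> on the quotient, where the prescribed terms have \<open>q t\<close> and the pair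
  \<open>t\<close>, \<open>q\<close>; so the maps are semilinear, over an automorphism inverting
  \<open>t\<close> and one exchanging \<open>t\<close> and \<open>q\<close>. Of these only the
  values on \<open>q\<close> and \<open>t\<close> enter the computation, which is why it is done
  over any commutative ring with such automorphisms.\<close>

lemma word_eq_in_lists:
  assumes "word_eq X Rel u v"
  shows "u \<in> lists (X \<times> UNIV)" "v \<in> lists (X \<times> UNIV)"
  using assms by (induction) auto

lemma word_class_eq_iff:
  assumes "u \<in> lists (X \<times> UNIV)" "v \<in> lists (X \<times> UNIV)"
  shows "word_class X Rel u = word_class X Rel v \<longleftrightarrow> word_eq X Rel u v"
proof
  assume "word_class X Rel u = word_class X Rel v"
  moreover have "v \<in> word_class X Rel v"
    using assms by (simp add: word_class_def word_eq.refl)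
  ultimately show "word_eq X Rel u v" by (simp add: word_class_def set_eq_iff)
next
  assume "word_eq X Rel u v"
  then show "word_class X Rel u = word_class X Rel v"
    unfolding word_class_def by (blast intro: word_eq.sym word_eq.trans)
qed

lemma word_class_eqI: "word_eq X Rel u v \<Longrightarrow> word_class X Rel u = word_class X Rel v"
  by (simp add: word_class_eq_iff [OF word_eq_in_lists])

definition word_inverse :: "'g word \<Rightarrow> 'g word" where
  "word_inverse w = rev (map (\<lambda>(x, b). (x, \<not> b)) w)"

lemma word_inverse_in_lists:
  "w \<in> lists (X \<times> UNIV) \<Longrightarrow> word_inverse w \<in> lists (X \<times> UNIV)"
  by (auto simp: word_inverse_def in_lists_conv_set)

lemma word_eq_inverse_left:
  "w \<in> lists (X \<times> UNIV) \<Longrightarrow> word_eq X Rel (word_inverse w @ w) []"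
proof (induction w)
  case Nil
  then show ?case by (simp add: word_inverse_def word_eq.refl)
next
  case (Cons a w)
  obtain x b where a: "a = (x, b)" by (cases a)
  have x: "x \<in> X" and w: "w \<in> lists (X \<times> UNIV)" using Cons.prems a by auto
  have "word_eq X Rel [(x, \<not> b), (x, b)] []"
    using word_eq.cancel[OF x, of Rel "\<not> b"] by simp
  then have "word_eq X Rel (word_inverse w @ ([(x, \<not> b), (x, b)] @ w)) (word_inverse w @ ([] @ w))"
    by (intro word_eq.cong word_eq.refl word_inverse_in_lists w)
  also have "word_inverse w @ ([(x, \<not> b), (x, b)] @ w) = word_inverse (a # w) @ (a # w)"
    by (simp add: word_inverse_def a)
  finally show ?case using Cons.IH[OF w] by (auto intro: word_eq.trans)
qed

text \<open>The product is a union of classes over all pairs of representatives. By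
  \<open>word_eq.cong\<close> these classes coincide, so the union is a single class.\<close>

lemma presented_group_mult:
  assumes "u \<in> lists (X \<times> UNIV)" "v \<in> lists (X \<times> UNIV)"
  shows "word_class X Rel u \<otimes>\<^bsub>presented_group X Rel\<^esub> word_class X Rel v = word_class X Rel (u @ v)"
proof -
  have "word_class X Rel (u' @ v') = word_class X Rel (u @ v)"
    if "u' \<in> word_class X Rel u" "v' \<in> word_class X Rel v" for u' v'
  proof -
    have "word_eq X Rel (u' @ v') (u @ v)"
      using that by (auto simp: word_class_def intro: word_eq.cong word_eq.sym)
    then show ?thesis by (rule word_class_eqI)
  qed
  note eq = this
  have "u \<in> word_class X Rel u" "v \<in> word_class X Rel v"
    using assms by (simp_all add: word_class_def word_eq.refl)
  then have "(\<Union>u'\<in>word_class X Rel u. \<Union>v'\<in>word_class X Rel v. word_class X Rel (u' @ v')) =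
      word_class X Rel (u @ v)"
    by (intro SUP_eq_const eq) auto
  then show ?thesis by (simp add: presented_group_def)
qed

lemma word_class_carrier:
  "w \<in> lists (X \<times> UNIV) \<Longrightarrow> word_class X Rel w \<in> carrier (presented_group X Rel)"
  by (simp add: presented_group_def)

lemma presented_group_carrierE:
  assumes "W \<in> carrier (presented_group X Rel)"
  obtains w where "w \<in> lists (X \<times> UNIV)" "W = word_class X Rel w"
  using assms by (auto simp: presented_group_def)

lemma presented_group_one: "\<one>\<^bsub>presented_group X Rel\<^esub> = word_class X Rel []"
  by (simp add: presented_group_def)

lemma group_presented_group: "group (presented_group X Rel)"
proof (rule groupI)
  fix x y z
  assume xyz: "x \<in> carrier (presented_group X Rel)" "y \<in> carrier (presented_group X Rel)"
    "z \<in> carrier (presented_group X Rel)"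
  then show "x \<otimes>\<^bsub>presented_group X Rel\<^esub> y \<otimes>\<^bsub>presented_group X Rel\<^esub> z =
      x \<otimes>\<^bsub>presented_group X Rel\<^esub> (y \<otimes>\<^bsub>presented_group X Rel\<^esub> z)"
    by (elim presented_group_carrierE) (simp add: presented_group_mult)
next
  fix x assume "x \<in> carrier (presented_group X Rel)"
  then obtain w where w: "w \<in> lists (X \<times> UNIV)" "x = word_class X Rel w"
    by (elim presented_group_carrierE)
  have "word_class X Rel (word_inverse w) \<otimes>\<^bsub>presented_group X Rel\<^esub> x = \<one>\<^bsub>presented_group X Rel\<^esub>"
    using w by (simp add: presented_group_mult presented_group_one word_inverse_in_lists
        word_class_eq_iff word_eq_inverse_left)
  then show "\<exists>y\<in>carrier (presented_group X Rel).
      y \<otimes>\<^bsub>presented_group X Rel\<^esub> x = \<one>\<^bsub>presented_group X Rel\<^esub>"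
    using w word_class_carrier word_inverse_in_lists by blast
next
  fix x y assume "x \<in> carrier (presented_group X Rel)" "y \<in> carrier (presented_group X Rel)"
  then show "x \<otimes>\<^bsub>presented_group X Rel\<^esub> y \<in> carrier (presented_group X Rel)"
    by (elim presented_group_carrierE) (simp add: presented_group_mult word_class_carrier)
next
  fix x assume "x \<in> carrier (presented_group X Rel)"
  then show "\<one>\<^bsub>presented_group X Rel\<^esub> \<otimes>\<^bsub>presented_group X Rel\<^esub> x = x"
    by (elim presented_group_carrierE) (simp add: presented_group_mult presented_group_one)
qed (simp add: presented_group_one word_class_carrier)

lemma presented_group_inv_gen:
  assumes "x \<in> X"
  shows "inv\<^bsub>presented_group X Rel\<^esub> word_class X Rel [(x, True)] = word_class X Rel [(x, False)]"
proof (rule group.inv_equality[OF group_presented_group])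
  show "word_class X Rel [(x, False)] \<otimes>\<^bsub>presented_group X Rel\<^esub> word_class X Rel [(x, True)]
      = \<one>\<^bsub>presented_group X Rel\<^esub>"
    using assms word_eq.cancel[OF assms, of Rel False]
    by (simp add: presented_group_mult presented_group_one word_class_eq_iff)
qed (use assms in \<open>auto intro!: word_class_carrier\<close>)

text \<open>Words are built letter by letter from the left, and a letter marked \<open>False\<close>
  is the inverse of a generator by \<open>presented_group_inv_gen\<close>.\<close>

lemma presented_group_induct [consumes 1, case_names one gen inv_gen]:
  assumes W: "W \<in> carrier (presented_group X Rel)"
    and one: "P \<one>\<^bsub>presented_group X Rel\<^esub>"
    and gen: "\<And>x W. x \<in> X \<Longrightarrow> W \<in> carrier (presented_group X Rel) \<Longrightarrow> P W \<Longrightarrow>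
      P (word_class X Rel [(x, True)] \<otimes>\<^bsub>presented_group X Rel\<^esub> W)"
    and inv_gen: "\<And>x W. x \<in> X \<Longrightarrow> W \<in> carrier (presented_group X Rel) \<Longrightarrow> P W \<Longrightarrow>
      P (inv\<^bsub>presented_group X Rel\<^esub> word_class X Rel [(x, True)] \<otimes>\<^bsub>presented_group X Rel\<^esub> W)"
  shows "P W"
proof -
  obtain w where w: "w \<in> lists (X \<times> UNIV)" "W = word_class X Rel w"
    using W by (elim presented_group_carrierE)
  have "P (word_class X Rel w)" using w(1)
  proof (induction w)
    case Nil
    then show ?case using one by (simp add: presented_group_one)
  next
    case (Cons a w)
    obtain x b where a: "a = (x, b)" by (cases a)
    have x: "x \<in> X" and w: "w \<in> lists (X \<times> UNIV)" using Cons a by auto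
    have eq: "word_class X Rel (a # w) =
        word_class X Rel [(x, b)] \<otimes>\<^bsub>presented_group X Rel\<^esub> word_class X Rel w"
      using x w by (simp add: presented_group_mult a)
    show ?case
      using gen[OF x word_class_carrier[OF w] Cons.IH]
        inv_gen[OF x word_class_carrier[OF w] Cons.IH]
      by (cases b) (simp_all add: eq presented_group_inv_gen[OF x])
  qed
  then show ?thesis by (simp add: w)
qed

section \<open>Evaluation of words and homomorphisms out of a presented group\<close>

context group
begin

lemma eval_word_closed:
  assumes "\<And>x. x \<in> X \<Longrightarrow> f x \<in> carrier G" "w \<in> lists (X \<times> UNIV)"
  shows "eval_word G f w \<in> carrier G"
  using assms(2) by (induction w) (auto simp: eval_word_def assms(1))

lemma eval_word_append:
  assumes "\<And>x. x \<in> X \<Longrightarrow> f x \<in> carrier G" "u \<in> lists (X \<times> UNIV)" "v \<in> lists (X \<times> UNIV)"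
  shows "eval_word G f (u @ v) = eval_word G f u \<otimes> eval_word G f v"
  using assms(2)
proof (induction u)
  case Nil
  then show ?case using eval_word_closed[of X f v] assms by (simp add: eval_word_def)
next
  case (Cons a u)
  obtain x b where a: "a = (x, b)" by (cases a)
  have "x \<in> X" "u \<in> lists (X \<times> UNIV)" using Cons a by auto
  moreover note eval_word_closed[of X f, OF assms(1)]
  ultimately show ?case
    using Cons.IH assms by (auto simp: a eval_word_def m_assoc)
qed

lemma eval_word_word_eq:
  assumes f: "\<And>x. x \<in> X \<Longrightarrow> f x \<in> carrier G"
    and rel: "\<And>u v. (u, v) \<in> Rel \<Longrightarrow> eval_word G f u = eval_word G f v"
    and "word_eq X Rel u v"
  shows "eval_word G f u = eval_word G f v"
  using assms(3)
proof (induction)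
  case (cong u u' v v')
  note l = cong.hyps[THEN word_eq_in_lists(1)] cong.hyps[THEN word_eq_in_lists(2)]
  from cong.IH show ?case by (simp only: eval_word_append[of X f, OF f] l)
next
  case (cancel x b)
  then show ?case using f by (cases b) (auto simp: eval_word_def)
qed (use rel in auto)

text \<open>The representative picked by \<open>SOME\<close> is equivalent to \<open>w\<close>, and
  \<open>eval_word\<close> is constant on equivalent words, so the choice is harmless.\<close>

lemma presented_hom_word_class:
  assumes f: "\<And>x. x \<in> X \<Longrightarrow> f x \<in> carrier G"
    and rel: "\<And>u v. (u, v) \<in> Rel \<Longrightarrow> eval_word G f u = eval_word G f v"
    and w: "w \<in> lists (X \<times> UNIV)"
  shows "presented_hom X Rel G f (word_class X Rel w) = eval_word G f w"
proof -
  have "w \<in> word_class X Rel w" using w by (simp add: word_class_def word_eq.refl)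
  then have "(SOME v. v \<in> word_class X Rel w) \<in> word_class X Rel w" by (rule someI)
  then have "word_eq X Rel w (SOME v. v \<in> word_class X Rel w)" by (simp add: word_class_def)
  from eval_word_word_eq[OF f rel this] show ?thesis
    using w by (simp add: presented_hom_def word_class_carrier)
qed

lemma presented_hom_hom:
  assumes f: "\<And>x. x \<in> X \<Longrightarrow> f x \<in> carrier G"
    and rel: "\<And>u v. (u, v) \<in> Rel \<Longrightarrow> eval_word G f u = eval_word G f v"
  shows "presented_hom X Rel G f \<in> hom (presented_group X Rel) G"
proof (rule homI)
  fix U assume "U \<in> carrier (presented_group X Rel)"
  then show "presented_hom X Rel G f U \<in> carrier G"
    by (elim presented_group_carrierE)
      (simp add: presented_hom_word_class[OF f rel] eval_word_closed[of X f, OF f])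
next
  fix U V assume "U \<in> carrier (presented_group X Rel)" "V \<in> carrier (presented_group X Rel)"
  then obtain u v where uv: "u \<in> lists (X \<times> UNIV)" "v \<in> lists (X \<times> UNIV)"
    "U = word_class X Rel u" "V = word_class X Rel v"
    by (metis presented_group_carrierE)
  then have "presented_hom X Rel G f (word_class X Rel (u @ v)) = eval_word G f u \<otimes> eval_word G f v"
    by (subst presented_hom_word_class[OF f rel]) (simp_all add: eval_word_append[of X f, OF f])
  then show "presented_hom X Rel G f (U \<otimes>\<^bsub>presented_group X Rel\<^esub> V) =
      presented_hom X Rel G f U \<otimes> presented_hom X Rel G f V"
    using uv by (simp add: presented_group_mult presented_hom_word_class[OF f rel])
qed

lemma presented_hom_gen:
  assumes f: "\<And>x. x \<in> X \<Longrightarrow> f x \<in> carrier G"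
    and rel: "\<And>u v. (u, v) \<in> Rel \<Longrightarrow> eval_word G f u = eval_word G f v"
    and x: "x \<in> X"
  shows "presented_hom X Rel G f (word_class X Rel [(x, True)]) = f x"
  using x f[OF x] by (simp add: presented_hom_word_class[OF f rel] eval_word_def)

end

lemma presented_hom_unique:
  assumes G: "group G" "h \<in> hom (presented_group X Rel) G" "h' \<in> hom (presented_group X Rel) G"
    and gen: "\<And>x. x \<in> X \<Longrightarrow> h (word_class X Rel [(x, True)]) = h' (word_class X Rel [(x, True)])"
    and W: "W \<in> carrier (presented_group X Rel)"
  shows "h W = h' W"
proof -
  interpret h: group_hom "presented_group X Rel" G h
    using G group_presented_group by (simp add: group_hom_def group_hom_axioms_def)
  interpret h': group_hom "presented_group X Rel" G h'
    using G group_presented_group by (simp add: group_hom_def group_hom_axioms_def)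
  have c: "word_class X Rel [(x, True)] \<in> carrier (presented_group X Rel)" if "x \<in> X" for x
    using that by (intro word_class_carrier) auto
  show ?thesis using W
    by (induction rule: presented_group_induct) (simp_all add: gen c)
qed


section \<open>Linear extension of functions on generators\<close>

text \<open>The additive extension of \<open>f\<close> from the free abelian group on
  \<open>'a\<close>. Unlike \<open>frag_extend\<close>, whose values lie in a free abelian group, it
  takes values in the coefficient ring.\<close>

definition lin_ext :: "('a \<Rightarrow> 'r::comm_ring_1) \<Rightarrow> ('a \<Rightarrow>\<^sub>0 int) \<Rightarrow> 'r" where
  "lin_ext f c = (\<Sum>k\<in>Poly_Mapping.keys c. of_int (Poly_Mapping.lookup c k) * f k)"

lemma lin_ext_superset:
  assumes "finite S" "Poly_Mapping.keys c \<subseteq> S"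
  shows "lin_ext f c = (\<Sum>k\<in>S. of_int (Poly_Mapping.lookup c k) * f k)"
  unfolding lin_ext_def
  by (rule sum.mono_neutral_left) (use assms in \<open>auto simp: in_keys_iff\<close>)

lemma lin_ext_0 [simp]: "lin_ext f 0 = 0"
  by (simp add: lin_ext_def)

lemma lin_ext_frag_of [simp]: "lin_ext f (frag_of x) = f x"
  by (simp add: lin_ext_def)

lemma lin_ext_add: "lin_ext f (a + b) = lin_ext f a + lin_ext f b"
proof -
  let ?S = "Poly_Mapping.keys a \<union> Poly_Mapping.keys b"
  have "Poly_Mapping.keys (a + b) \<subseteq> ?S" by (rule keys_add)
  then show ?thesis
    by (simp add: lin_ext_superset[of ?S] lookup_add distrib_right sum.distrib)
qed

lemma lin_ext_diff: "lin_ext f (a - b) = lin_ext f a - lin_ext f b"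
  using lin_ext_add[of f "a - b" b] by simp

lemma lin_ext_sum: "lin_ext f (sum g I) = (\<Sum>i\<in>I. lin_ext f (g i))"
  by (induction I rule: infinite_finite_induct) (simp_all add: lin_ext_add)

lemma lin_ext_cong:
  "(\<And>k. k \<in> Poly_Mapping.keys c \<Longrightarrow> f k = g k) \<Longrightarrow> lin_ext f c = lin_ext g c"
  by (simp add: lin_ext_def)

lemma lin_ext_plus: "lin_ext (\<lambda>k. f k + g k) c = lin_ext f c + lin_ext g c"
  by (simp add: lin_ext_def distrib_left sum.distrib)

lemma lin_ext_scale: "lin_ext (\<lambda>k. r * f k) c = r * lin_ext f c"
  by (simp add: lin_ext_def sum_distrib_left mult.left_commute)

lemma lin_ext_frag_extend: "lin_ext f (frag_extend g c) = lin_ext (\<lambda>k. lin_ext f (g k)) c"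
proof -
  have "Poly_Mapping.keys c \<subseteq> UNIV" by simp
  then show ?thesis
    by (induction c rule: frag_induction) (simp_all add: frag_extend_diff lin_ext_diff)
qed


section \<open>Coordinates on modules and representations\<close>

text \<open>For finite \<open>J\<close> this is the free module on \<open>J\<close>. The value 0 off
  \<open>J\<close>, instead of \<open>undefined\<close>, keeps pointwise sums and multiples in the
  set without any restriction operator.\<close>

definition fun_on :: "'i set \<Rightarrow> ('i \<Rightarrow> 'r::zero) set" where
  "fun_on J = {p. \<forall>i. i \<notin> J \<longrightarrow> p i = 0}"

lemma fun_on_zero [simp]: "(\<lambda>_. 0) \<in> fun_on J"
  by (simp add: fun_on_def)

lemma fun_on_add [simp]:
  fixes p q :: "'i \<Rightarrow> 'r::comm_ring_1"
  shows "p \<in> fun_on J \<Longrightarrow> q \<in> fun_on J \<Longrightarrow> (\<lambda>i. p i + q i) \<in> fun_on J"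
  by (simp add: fun_on_def)

lemma fun_on_diff [simp]:
  fixes p q :: "'i \<Rightarrow> 'r::comm_ring_1"
  shows "p \<in> fun_on J \<Longrightarrow> q \<in> fun_on J \<Longrightarrow> (\<lambda>i. p i - q i) \<in> fun_on J"
  by (simp add: fun_on_def)

lemma fun_on_uminus [simp]:
  fixes p :: "'i \<Rightarrow> 'r::comm_ring_1"
  shows "p \<in> fun_on J \<Longrightarrow> (\<lambda>i. - p i) \<in> fun_on J"
  by (simp add: fun_on_def)

lemma fun_on_scale [simp]:
  fixes p :: "'i \<Rightarrow> 'r::comm_ring_1"
  shows "p \<in> fun_on J \<Longrightarrow> (\<lambda>i. r * p i) \<in> fun_on J"
  by (simp add: fun_on_def)

text \<open>An identification of \<open>V\<close> with the functions on \<open>J\<close>. The module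
  laws are consequences: they are pulled back along the injective \<open>\<phi>\<close>, which suits
  tensor modules, where only the operations are known explicitly.\<close>

locale coordinates =
  fixes V :: "('r::comm_ring_1, 'v) module" and J :: "'i set" and \<phi> :: "'v \<Rightarrow> 'i \<Rightarrow> 'r"
  assumes bij: "bij_betw \<phi> (carrier V) (fun_on J)"
    and zero_closed: "\<zero>\<^bsub>V\<^esub> \<in> carrier V" and coord_zero: "\<phi> \<zero>\<^bsub>V\<^esub> = (\<lambda>_. 0)"
    and add_closed: "\<And>x y. x \<in> carrier V \<Longrightarrow> y \<in> carrier V \<Longrightarrow> x \<oplus>\<^bsub>V\<^esub> y \<in> carrier V"
    and coord_add: "\<And>x y. x \<in> carrier V \<Longrightarrow> y \<in> carrier V \<Longrightarrow>
      \<phi> (x \<oplus>\<^bsub>V\<^esub> y) = (\<lambda>i. \<phi> x i + \<phi> y i)"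
    and smult_closed: "\<And>r x. x \<in> carrier V \<Longrightarrow> r \<odot>\<^bsub>V\<^esub> x \<in> carrier V"
    and coord_smult: "\<And>r x. x \<in> carrier V \<Longrightarrow> \<phi> (r \<odot>\<^bsub>V\<^esub> x) = (\<lambda>i. r * \<phi> x i)"
begin

definition point :: "('i \<Rightarrow> 'r) \<Rightarrow> 'v" where
  "point p = inv_into (carrier V) \<phi> p"

lemma coord_closed: "x \<in> carrier V \<Longrightarrow> \<phi> x \<in> fun_on J"
  using bij by (auto simp: bij_betw_def)

lemma point_closed: "p \<in> fun_on J \<Longrightarrow> point p \<in> carrier V"
  using bij unfolding point_def by (metis bij_betw_def inv_into_into)

lemma coord_point: "p \<in> fun_on J \<Longrightarrow> \<phi> (point p) = p"
  using bij unfolding point_def by (metis bij_betw_inv_into_right)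

lemma coord_eqD: "\<phi> x = \<phi> y \<Longrightarrow> x \<in> carrier V \<Longrightarrow> y \<in> carrier V \<Longrightarrow> x = y"
  using bij by (auto simp: bij_betw_def inj_on_def)

lemma point_coord: "x \<in> carrier V \<Longrightarrow> point (\<phi> x) = x"
  by (intro coord_eqD) (simp_all add: coord_closed point_closed coord_point)

lemma point_add:
  "p \<in> fun_on J \<Longrightarrow> q \<in> fun_on J \<Longrightarrow> point (\<lambda>i. p i + q i) = point p \<oplus>\<^bsub>V\<^esub> point q"
  by (intro coord_eqD) (simp_all add: point_closed coord_point add_closed coord_add)

lemma abelian_group: "abelian_group V"
proof (rule abelian_groupI)
  fix x assume x: "x \<in> carrier V"
  show "\<exists>y\<in>carrier V. y \<oplus>\<^bsub>V\<^esub> x = \<zero>\<^bsub>V\<^esub>"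
  proof (rule bexI)
    show "point (\<lambda>i. - \<phi> x i) \<oplus>\<^bsub>V\<^esub> x = \<zero>\<^bsub>V\<^esub>"
      using x by (intro coord_eqD)
        (simp_all add: coord_add point_closed coord_point coord_closed coord_zero zero_closed add_closed)
  qed (simp add: point_closed coord_closed x)
qed (auto intro!: coord_eqD ext simp: coord_add coord_zero add_closed zero_closed algebra_simps)

lemma module_coordinates: "Module.module class_ring V"
proof (rule moduleI)
  have "\<exists>y. y + x = 0" for x :: 'r by (rule exI[of _ "- x"]) simp
  then show "cring (class_ring :: 'r ring)"
    by (intro cringI abelian_groupI comm_monoidI) (simp_all add: algebra_simps)
qed (auto intro!: abelian_group coord_eqD ext
    simp: smult_closed coord_smult coord_add add_closed algebra_simps)

lemma coord_minus: 
  assumes "x \<in> carrier V" shows "\<phi> (\<ominus>\<^bsub>V\<^esub> x) = (\<lambda>i. - \<phi> x i)"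
proof -
  interpret abelian_group V by (rule abelian_group)
  have "\<phi> (\<ominus>\<^bsub>V\<^esub> x \<oplus>\<^bsub>V\<^esub> x) = (\<lambda>_. 0)" using assms by (simp add: l_neg coord_zero)
  then have "\<phi> (\<ominus>\<^bsub>V\<^esub> x) i + \<phi> x i = 0" for i
    using assms by (simp add: coord_add fun_eq_iff)
  then show ?thesis by (simp add: fun_eq_iff eq_neg_iff_add_eq_0)
qed

text \<open>Needed because \<open>group_ring_act\<close> is a sum of integer multiples. Induction
  settles the nonnegative multiples; the others are inverses of positive ones.\<close>

lemma coord_add_pow:
  assumes x: "x \<in> carrier V" shows "\<phi> ([(k::int)] \<cdot>\<^bsub>V\<^esub> x) = (\<lambda>i. of_int k * \<phi> x i)"
proof -
  interpret abelian_group V by (rule abelian_group)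
  have nat: "\<phi> ([int n] \<cdot>\<^bsub>V\<^esub> x) = (\<lambda>i. of_nat n * \<phi> x i)" for n
  proof (induction n)
    case 0
    then show ?case using x by (simp add: coord_zero add_pow_def)
  next
    case (Suc n)
    have "[int (Suc n)] \<cdot>\<^bsub>V\<^esub> x = [int n] \<cdot>\<^bsub>V\<^esub> x \<oplus>\<^bsub>V\<^esub> x"
      using x by (simp add: add.int_pow_mult add.int_pow_closed add.m_comm)
    then show ?case
      using x Suc by (simp add: coord_add add.int_pow_closed algebra_simps)
  qed
  show ?thesis
  proof (cases k)
    case (nonneg n)
    then show ?thesis by (simp add: nat)
  next
    case (neg n)
    have "[(- int (Suc n))] \<cdot>\<^bsub>V\<^esub> x = \<ominus>\<^bsub>V\<^esub> ([int (Suc n)] \<cdot>\<^bsub>V\<^esub> x)"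
      using add.int_pow_neg[OF x, of "int (Suc n)"] by (simp add: a_inv_def)
    then show ?thesis
      unfolding neg using x by (simp only: coord_minus add.int_pow_closed nat) (simp add: algebra_simps)
  qed
qed

lemma coord_finsum:
  assumes "finite I" "f \<in> I \<rightarrow> carrier V"
  shows "\<phi> (\<Oplus>\<^bsub>V\<^esub>i\<in>I. f i) = (\<lambda>j. \<Sum>i\<in>I. \<phi> (f i) j)"
proof -
  interpret abelian_group V by (rule abelian_group)
  show ?thesis using assms
    by (induction) (simp_all add: coord_zero coord_add Pi_def)
qed

end

text \<open>\<open>K\<close> is the action read in coordinates, and it is constrained on
  \<open>fun_on J\<close> only. Extensionality of \<open>act\<close> is a separate condition:
  membership in \<open>Bij\<close> demands it, and coordinates do not see values off the
  carrier.\<close>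

locale rep_coordinates = coordinates "space \<rho>" J \<phi> + group G
  for G (structure) and \<rho> :: "('g, 'r::comm_ring_1, 'v) rep" and J :: "'i set" and \<phi> +
  fixes K :: "'g \<Rightarrow> ('i \<Rightarrow> 'r) \<Rightarrow> 'i \<Rightarrow> 'r"
  assumes act_extensional: "\<And>g. g \<in> carrier G \<Longrightarrow> act \<rho> g \<in> extensional (carrier (space \<rho>))"
    and act_closed: "\<And>g x. g \<in> carrier G \<Longrightarrow> x \<in> carrier (space \<rho>) \<Longrightarrow>
      act \<rho> g x \<in> carrier (space \<rho>)"
    and coord_act: "\<And>g x. g \<in> carrier G \<Longrightarrow> x \<in> carrier (space \<rho>) \<Longrightarrow> \<phi> (act \<rho> g x) = K g (\<phi> x)"
    and K_closed: "\<And>g p. g \<in> carrier G \<Longrightarrow> p \<in> fun_on J \<Longrightarrow> K g p \<in> fun_on J"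
    and K_add: "\<And>g p q. g \<in> carrier G \<Longrightarrow> p \<in> fun_on J \<Longrightarrow> q \<in> fun_on J \<Longrightarrow>
      K g (\<lambda>i. p i + q i) = (\<lambda>i. K g p i + K g q i)"
    and K_smult: "\<And>g p r. g \<in> carrier G \<Longrightarrow> p \<in> fun_on J \<Longrightarrow>
      K g (\<lambda>i. r * p i) = (\<lambda>i. r * K g p i)"
    and K_one: "\<And>p. p \<in> fun_on J \<Longrightarrow> K \<one> p = p"
    and K_mult: "\<And>g h p. g \<in> carrier G \<Longrightarrow> h \<in> carrier G \<Longrightarrow> p \<in> fun_on J \<Longrightarrow>
      K (g \<otimes> h) p = K g (K h p)"
begin

lemma act_one: "x \<in> carrier (space \<rho>) \<Longrightarrow> act \<rho> \<one> x = x"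
  by (intro coord_eqD) (simp_all add: coord_act K_one coord_closed act_closed)

lemma act_mult:
  "g \<in> carrier G \<Longrightarrow> h \<in> carrier G \<Longrightarrow> x \<in> carrier (space \<rho>) \<Longrightarrow>
   act \<rho> (g \<otimes> h) x = act \<rho> g (act \<rho> h x)"
  by (intro coord_eqD) (simp_all add: coord_act K_mult coord_closed act_closed)

lemma act_add:
  "g \<in> carrier G \<Longrightarrow> x \<in> carrier (space \<rho>) \<Longrightarrow> y \<in> carrier (space \<rho>) \<Longrightarrow>
   act \<rho> g (x \<oplus>\<^bsub>space \<rho>\<^esub> y) = act \<rho> g x \<oplus>\<^bsub>space \<rho>\<^esub> act \<rho> g y"
  by (intro coord_eqD) (simp_all add: coord_act K_add coord_add coord_closed act_closed add_closed)

lemma act_smult: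
  "g \<in> carrier G \<Longrightarrow> x \<in> carrier (space \<rho>) \<Longrightarrow>
   act \<rho> g (r \<odot>\<^bsub>space \<rho>\<^esub> x) = r \<odot>\<^bsub>space \<rho>\<^esub> act \<rho> g x"
  by (intro coord_eqD)
    (simp_all add: coord_act K_smult coord_smult coord_closed act_closed smult_closed)

lemma act_bij: 
  assumes g: "g \<in> carrier G"
  shows "act \<rho> g \<in> Bij (carrier (space \<rho>))"
proof -
  have "bij_betw (act \<rho> g) (carrier (space \<rho>)) (carrier (space \<rho>))"
    by (rule bij_betw_byWitness[where f' = "act \<rho> (inv g)"])
      (use g in \<open>auto simp: act_closed act_one simp flip: act_mult\<close>)
  then show ?thesis using act_extensional[OF g] by (simp add: Bij_def)
qed

text \<open>The linear bijections form a subgroup of \<open>BijGroup\<close>. The inverse of one is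
  again linear because the two sides of each linearity equation have the same image under an
  injective map.\<close>

lemma group_module_Aut: "group (module_Aut (space \<rho>))"
proof -
  let ?V = "space \<rho>" and ?B = "BijGroup (carrier (space \<rho>))"
  interpret V: abelian_group ?V by (rule abelian_group)
  have inj: "x = y" if "f \<in> Bij (carrier ?V)" "f x = f y" "x \<in> carrier ?V" "y \<in> carrier ?V" for f x y
    using that by (auto simp: Bij_def bij_betw_def inj_on_def)
  define H where "H = {f \<in> Bij (carrier ?V). f \<in> hom (add_monoid ?V) (add_monoid ?V) \<and>
      (\<forall>r. \<forall>v\<in>carrier ?V. f (r \<odot>\<^bsub>?V\<^esub> v) = r \<odot>\<^bsub>?V\<^esub> f v)}"
  have "subgroup H ?B"
  proof (rule group.subgroupI[OF group_BijGroup])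
    show "H \<subseteq> carrier ?B" by (auto simp: H_def BijGroup_def)
    have "(\<lambda>x\<in>carrier ?V. x) \<in> H"
      by (auto simp: H_def id_Bij hom_def smult_closed)
    then show "H \<noteq> {}" by blast
  next
    fix f assume f: "f \<in> H"
    then have fB: "f \<in> Bij (carrier ?V)" and
      fadd: "\<And>x y. x \<in> carrier ?V \<Longrightarrow> y \<in> carrier ?V \<Longrightarrow> f (x \<oplus>\<^bsub>?V\<^esub> y) = f x \<oplus>\<^bsub>?V\<^esub> f y" and
      fsm: "\<And>r x. x \<in> carrier ?V \<Longrightarrow> f (r \<odot>\<^bsub>?V\<^esub> x) = r \<odot>\<^bsub>?V\<^esub> f x"
      by (auto simp: H_def hom_def)
    let ?g = "inv_into (carrier ?V) f"
    have gc: "?g x \<in> carrier ?V" if "x \<in> carrier ?V" for x using Bij_inv_into_mem[OF fB that] .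
    have fg: "f (?g x) = x" if "x \<in> carrier ?V" for x
      using fB that by (auto simp: Bij_def intro: bij_betw_inv_into_right)
    have "?g (x \<oplus>\<^bsub>?V\<^esub> y) = ?g x \<oplus>\<^bsub>?V\<^esub> ?g y" if "x \<in> carrier ?V" "y \<in> carrier ?V" for x y
      by (rule inj[OF fB]) (use that in \<open>simp_all add: fadd gc fg add_closed\<close>)
    moreover have "?g (r \<odot>\<^bsub>?V\<^esub> x) = r \<odot>\<^bsub>?V\<^esub> ?g x" if "x \<in> carrier ?V" for r x
      by (rule inj[OF fB]) (use that in \<open>simp_all add: fsm gc fg smult_closed\<close>)
    ultimately have "restrict ?g (carrier ?V) \<in> H"
      using restrict_inv_into_Bij[OF fB] gc by (simp add: H_def hom_def smult_closed)
    then show "inv\<^bsub>?B\<^esub> f \<in> H" by (simp add: inv_BijGroup fB)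
  next
    fix f g assume "f \<in> H" "g \<in> H"
    then show "f \<otimes>\<^bsub>?B\<^esub> g \<in> H"
      by (auto simp: H_def BijGroup_def compose_Bij compose_eq hom_def smult_closed Pi_def)
  qed
  then show ?thesis
    unfolding module_Aut_def H_def[symmetric]
    by (rule subgroup.subgroup_is_group) (rule group_BijGroup)
qed

lemma representation: "representation G \<rho>"
proof -
  have "act \<rho> \<in> hom G (module_Aut (space \<rho>))"
  proof (rule homI)
    fix g assume g: "g \<in> carrier G"
    then show "act \<rho> g \<in> carrier (module_Aut (space \<rho>))"
      by (auto simp: module_Aut_def act_bij act_smult hom_def act_closed act_add)
  next
    fix g h assume gh: "g \<in> carrier G" "h \<in> carrier G"
    have "act \<rho> (g \<otimes> h) = compose (carrier (space \<rho>)) (act \<rho> g) (act \<rho> h)"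
      by (rule extensionalityI[of _ "carrier (space \<rho>)"])
        (simp_all add: gh act_extensional act_mult compose_eq)
    then show "act \<rho> (g \<otimes> h) = act \<rho> g \<otimes>\<^bsub>module_Aut (space \<rho>)\<^esub> act \<rho> h"
      by (simp add: module_Aut_def BijGroup_def act_bij gh)
  qed
  then show ?thesis
    unfolding representation_def
    by (intro conjI module_coordinates group_hom.intro group_hom_axioms.intro
        group_module_Aut group_axioms)
qed

end


section \<open>Coordinates on tensor products\<close>

text \<open>Closure conditions place the relations in the free abelian group, so that what they
  generate is a subgroup. Linearity enters later, through the coordinate map.\<close>

locale tensor_setting =
  fixes A :: "'a set" and M :: "('m, 'x) ring_scheme" and ra :: "'m \<Rightarrow> 'a \<Rightarrow> 'm"
    and N :: "('r::comm_ring_1, 'n) module" and la :: "'a \<Rightarrow> 'n \<Rightarrow> 'n"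
  assumes left_add_closed: "\<And>x x'. x \<in> carrier M \<Longrightarrow> x' \<in> carrier M \<Longrightarrow> x \<oplus>\<^bsub>M\<^esub> x' \<in> carrier M"
    and right_add_closed: "\<And>y y'. y \<in> carrier N \<Longrightarrow> y' \<in> carrier N \<Longrightarrow> y \<oplus>\<^bsub>N\<^esub> y' \<in> carrier N"
    and ra_closed: "\<And>x a. x \<in> carrier M \<Longrightarrow> a \<in> A \<Longrightarrow> ra x a \<in> carrier M"
    and la_closed: "\<And>y a. y \<in> carrier N \<Longrightarrow> a \<in> A \<Longrightarrow> la a y \<in> carrier N"
    and right_smult_closed: "\<And>r y. y \<in> carrier N \<Longrightarrow> r \<odot>\<^bsub>N\<^esub> y \<in> carrier N"
begin

abbreviation "\<N> \<equiv> tensor_null A M ra N la"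
abbreviation "\<F> \<equiv> tensor_free M N"
abbreviation "\<T> \<equiv> tensor_module A M ra N la"

lemma carrier_free: "c \<in> carrier \<F> \<longleftrightarrow> Poly_Mapping.keys c \<subseteq> carrier M \<times> carrier N"
  by (simp add: tensor_free_def)

lemma free_induct [consumes 1, case_names zero one diff]:
  assumes "c \<in> carrier \<F>" "P 0"
    and "\<And>x y. x \<in> carrier M \<Longrightarrow> y \<in> carrier N \<Longrightarrow> P (frag_of (x, y))"
    and "\<And>c d. c \<in> carrier \<F> \<Longrightarrow> d \<in> carrier \<F> \<Longrightarrow> P c \<Longrightarrow> P d \<Longrightarrow> P (c - d)"
  shows "P c"
proof -
  have "Poly_Mapping.keys c \<subseteq> carrier M \<times> carrier N" using assms(1) by (simp add: carrier_free)
  then have "c \<in> carrier \<F> \<and> P c"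
  proof (induction c rule: frag_induction)
    case (diff c d)
    then show ?case
      using keys_diff[of c d] by (auto simp: carrier_free assms)
  qed (auto simp: assms carrier_free)
  then show ?thesis ..
qed

lemma group_free: "group \<F>"
  by (simp add: tensor_free_def)

lemma comm_group_free: "comm_group \<F>"
  by (simp add: tensor_free_def abelian_free_Abelian_group)

lemma free_mult [simp]: "x \<otimes>\<^bsub>\<F>\<^esub> y = x + y"
  by (simp add: tensor_free_def)

lemma diff_carrier: "c \<in> carrier \<F> \<Longrightarrow> d \<in> carrier \<F> \<Longrightarrow> c - d \<in> carrier \<F>"
  using keys_diff[of c d] by (auto simp: carrier_free)

lemma add_carrier: "c \<in> carrier \<F> \<Longrightarrow> d \<in> carrier \<F> \<Longrightarrow> c + d \<in> carrier \<F>"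
  using keys_add[of c d] by (auto simp: carrier_free)

lemma rels_subset: "tensor_rels A M ra N la \<subseteq> carrier \<F>"
proof -
  have "frag_of p \<in> carrier \<F>" if "p \<in> carrier M \<times> carrier N" for p
    using that by (simp add: carrier_free)
  then show ?thesis
    unfolding tensor_rels_def
    by (auto intro!: diff_carrier simp: left_add_closed right_add_closed ra_closed la_closed)
qed

lemma subgroup_null: "subgroup \<N> \<F>"
  unfolding tensor_null_def by (rule group.generate_is_subgroup[OF group_free rels_subset])

lemma null_carrier: "c \<in> \<N> \<Longrightarrow> c \<in> carrier \<F>"
  using subgroup.subset[OF subgroup_null] by blast

lemma null_add: "c \<in> \<N> \<Longrightarrow> d \<in> \<N> \<Longrightarrow> c + d \<in> \<N>"
  using subgroup.m_closed[OF subgroup_null, of c d] by simp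

lemma null_minus: "c \<in> \<N> \<Longrightarrow> - c \<in> \<N>"
  using subgroup.m_inv_closed[OF subgroup_null, of c] null_carrier[of c]
  by (simp add: tensor_free_def)

lemma null_diff: "c \<in> \<N> \<Longrightarrow> d \<in> \<N> \<Longrightarrow> c - d \<in> \<N>"
  using null_add[of c "- d"] null_minus by simp

lemma null_zero: "0 \<in> \<N>"
  using subgroup.one_closed[OF subgroup_null] by (simp add: tensor_free_def)

lemma null_sum: "(\<And>i. i \<in> I \<Longrightarrow> f i \<in> \<N>) \<Longrightarrow> sum f I \<in> \<N>"
  by (induction I rule: infinite_finite_induct) (simp_all add: null_zero null_add)

lemma rel_add_left:
  assumes "x \<in> carrier M" "x' \<in> carrier M" "y \<in> carrier N"
  shows "frag_of (x \<oplus>\<^bsub>M\<^esub> x', y) - frag_of (x, y) - frag_of (x', y) \<in> \<N>"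
  unfolding tensor_null_def by (rule generate.incl) (use assms in \<open>auto simp: tensor_rels_def\<close>)

lemma rel_add_right:
  assumes "x \<in> carrier M" "y \<in> carrier N" "y' \<in> carrier N"
  shows "frag_of (x, y \<oplus>\<^bsub>N\<^esub> y') - frag_of (x, y) - frag_of (x, y') \<in> \<N>"
  unfolding tensor_null_def by (rule generate.incl) (use assms in \<open>auto simp: tensor_rels_def\<close>)

lemma rel_balanced:
  assumes "x \<in> carrier M" "a \<in> A" "y \<in> carrier N"
  shows "frag_of (ra x a, y) - frag_of (x, la a y) \<in> \<N>"
  unfolding tensor_null_def by (rule generate.incl) (use assms in \<open>auto simp: tensor_rels_def\<close>)

end

text \<open>The bilinear map \<open>b\<close> induces a map from the tensor product to functions on \<open>J\<close>, and \<open>s\<close>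
  chooses for every function a representative of its preimage.\<close>

locale tensor_coordinates = tensor_setting A M ra N la
  for A :: "'a set" and M :: "('m, 'x) ring_scheme" and ra
    and N :: "('r::comm_ring_1, 'n) module" and la +
  fixes J :: "'i set" and b :: "'m \<Rightarrow> 'n \<Rightarrow> 'i \<Rightarrow> 'r" and s :: "('i \<Rightarrow> 'r) \<Rightarrow> ('m \<times> 'n) \<Rightarrow>\<^sub>0 int"
  assumes b_closed: "\<And>x y. x \<in> carrier M \<Longrightarrow> y \<in> carrier N \<Longrightarrow> b x y \<in> fun_on J"
    and b_add_left: "\<And>x x' y. x \<in> carrier M \<Longrightarrow> x' \<in> carrier M \<Longrightarrow> y \<in> carrier N \<Longrightarrow>
      b (x \<oplus>\<^bsub>M\<^esub> x') y = (\<lambda>i. b x y i + b x' y i)"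
    and b_add_right: "\<And>x y y'. x \<in> carrier M \<Longrightarrow> y \<in> carrier N \<Longrightarrow> y' \<in> carrier N \<Longrightarrow>
      b x (y \<oplus>\<^bsub>N\<^esub> y') = (\<lambda>i. b x y i + b x y' i)"
    and b_balanced: "\<And>x a y. x \<in> carrier M \<Longrightarrow> a \<in> A \<Longrightarrow> y \<in> carrier N \<Longrightarrow> b (ra x a) y = b x (la a y)"
    and b_smult: "\<And>r x y. x \<in> carrier M \<Longrightarrow> y \<in> carrier N \<Longrightarrow>
      b x (r \<odot>\<^bsub>N\<^esub> y) = (\<lambda>i. r * b x y i)"
    and s_closed: "\<And>p. p \<in> fun_on J \<Longrightarrow> Poly_Mapping.keys (s p) \<subseteq> carrier M \<times> carrier N"
    and s_add: "\<And>p q. p \<in> fun_on J \<Longrightarrow> q \<in> fun_on J \<Longrightarrow>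
      s (\<lambda>i. p i + q i) - s p - s q \<in> tensor_null A M ra N la"
    and s_b: "\<And>x y. x \<in> carrier M \<Longrightarrow> y \<in> carrier N \<Longrightarrow>
      s (b x y) - frag_of (x, y) \<in> tensor_null A M ra N la"
    and b_s: "\<And>p. p \<in> fun_on J \<Longrightarrow> (\<lambda>i. lin_ext (\<lambda>(x, y). b x y i) (s p)) = p"
begin

definition lift :: "(('m \<times> 'n) \<Rightarrow>\<^sub>0 int) \<Rightarrow> 'i \<Rightarrow> 'r" where
  "lift c = (\<lambda>i. lin_ext (\<lambda>(x, y). b x y i) c)"

lemma lift_add: "lift (c + d) = (\<lambda>i. lift c i + lift d i)"
  by (simp add: lift_def lin_ext_add)

lemma lift_diff: "lift (c - d) = (\<lambda>i. lift c i - lift d i)"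
  by (simp add: lift_def lin_ext_diff)

lemma lift_0 [simp]: "lift 0 = (\<lambda>i. 0)"
  by (simp add: lift_def)

lemma lift_frag_of [simp]: "lift (frag_of (x, y)) = b x y"
  by (simp add: lift_def)

lemma lift_closed:
  assumes "c \<in> carrier \<F>" shows "lift c \<in> fun_on J"
  using assms by (induction rule: free_induct) (simp_all add: b_closed lift_diff)

lemma lift_s: "p \<in> fun_on J \<Longrightarrow> lift (s p) = p"
  unfolding lift_def by (rule b_s)

lemma s_carrier: "p \<in> fun_on J \<Longrightarrow> s p \<in> carrier \<F>"
  by (simp add: carrier_free s_closed)

text \<open>Biadditivity and balancedness of \<open>b\<close> send the three families of relations
  to zero; \<open>generate\<close> adds only the unit, sums and negatives.\<close>

lemma lift_null: assumes "c \<in> \<N>" shows "lift c = (\<lambda>_. 0)"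
  using assms unfolding tensor_null_def
proof (induction rule: generate.induct)
  case one
  then show ?case by (simp add: tensor_free_def)
next
  case (incl h)
  then show ?case unfolding tensor_rels_def
    by (auto simp: lift_diff b_add_left b_add_right b_balanced)
next
  case (inv h)
  then have "h \<in> carrier \<F>" using rels_subset by blast
  then have "inv\<^bsub>\<F>\<^esub> h = 0 - h" by (simp add: tensor_free_def)
  moreover have "lift h = (\<lambda>_. 0)" using inv unfolding tensor_rels_def
    by (auto simp: lift_diff b_add_left b_add_right b_balanced)
  ultimately show ?case by (simp add: lift_diff del: diff_0)
qed (simp add: lift_add)

lemma s_zero: "s (\<lambda>_. 0) \<in> \<N>"
  using null_minus[OF s_add[of "\<lambda>_. 0" "\<lambda>_. 0"]] by simp

text \<open>Modulo \<open>\<N>\<close> the assignment \<open>c \<mapsto> s (lift c) - c\<close> is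
  additive, and on generators it vanishes by \<open>s_b\<close>.\<close>

lemma s_lift: 
  assumes "c \<in> carrier \<F>" shows "s (lift c) - c \<in> \<N>"
  using assms
proof (induction rule: free_induct)
  case zero
  then show ?case using s_zero by simp
next
  case (one x y)
  then show ?case by (simp add: s_b)
next
  case (diff c d)
  \<comment> \<open>\<open>s_add\<close> speaks of sums, so \<open>lift c\<close> is taken as the
    sum of \<open>lift (c - d)\<close> and \<open>lift d\<close>.\<close>
  have "s (lift c) - s (lift (c - d)) - s (lift d) \<in> \<N>"
    using s_add[of "lift (c - d)" "lift d"] diff
    by (simp add: lift_closed diff_carrier) (simp add: lift_diff)
  from null_diff[OF null_diff[OF diff.IH] this] show ?case by (simp add: algebra_simps)
qed

text \<open>The decisive description of the relation subgroup as a kernel: if \<open>lift c\<close>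
  is zero, then \<open>c\<close> differs by a null element from \<open>s\<close> of the zero
  function, which is null itself.\<close>

lemma null_iff: "c \<in> \<N> \<longleftrightarrow> c \<in> carrier \<F> \<and> lift c = (\<lambda>_. 0)"
proof
  assume "c \<in> carrier \<F> \<and> lift c = (\<lambda>_. 0)"
  then have "s (\<lambda>_. 0) - c \<in> \<N>" using s_lift[of c] by simp
  from null_diff[OF s_zero this] show "c \<in> \<N>" by simp
qed (simp add: null_carrier lift_null)

lemma coset_eq:
  assumes "c \<in> carrier \<F>" 
  shows "\<N> #>\<^bsub>\<F>\<^esub> c = {d \<in> carrier \<F>. lift d = lift c}"
proof (intro equalityI subsetI)
  fix d assume "d \<in> \<N> #>\<^bsub>\<F>\<^esub> c"
  then show "d \<in> {d \<in> carrier \<F>. lift d = lift c}"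
    using assms by (auto simp: r_coset_def null_iff lift_add add_carrier)
next
  fix d assume d: "d \<in> {d \<in> carrier \<F>. lift d = lift c}"
  then have "d - c \<in> \<N>" using assms by (simp add: null_iff diff_carrier lift_diff)
  then show "d \<in> \<N> #>\<^bsub>\<F>\<^esub> c" by (force simp: r_coset_def)
qed

definition coord :: "(('m \<times> 'n) \<Rightarrow>\<^sub>0 int) set \<Rightarrow> 'i \<Rightarrow> 'r" where
  "coord C = lift (SOME c. c \<in> C)"

lemma coord_coset: 
  assumes "c \<in> carrier \<F>" shows "coord (\<N> #>\<^bsub>\<F>\<^esub> c) = lift c"
proof -
  have "c \<in> \<N> #>\<^bsub>\<F>\<^esub> c" using assms by (simp add: coset_eq)
  then have "(SOME d. d \<in> \<N> #>\<^bsub>\<F>\<^esub> c) \<in> \<N> #>\<^bsub>\<F>\<^esub> c" by (rule someI)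
  then show ?thesis unfolding coord_def using assms by (simp add: coset_eq)
qed

lemma carrier_tensor: "carrier \<T> = (\<lambda>c. \<N> #>\<^bsub>\<F>\<^esub> c) ` carrier \<F>"
  by (simp add: tensor_module_def tensor_group_def carrier_FactGroup)

text \<open>Additivity is supplied by \<open>K\<close>: the induced map on the free group turns
  \<open>lift\<close> into \<open>K\<close> of \<open>lift\<close>, hence sends fibres of
  \<open>lift\<close> into fibres, and so all cosets in the union defining \<open>tensor_map\<close>
  coincide.\<close>

lemma tensor_map_coset:
  assumes h: "\<And>x. x \<in> carrier M \<Longrightarrow> h x \<in> carrier M"
    and k: "\<And>y. y \<in> carrier N \<Longrightarrow> k y \<in> carrier N"
    and K_closed: "\<And>p. p \<in> fun_on J \<Longrightarrow> K p \<in> fun_on J"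
    and K_add: "\<And>p q. p \<in> fun_on J \<Longrightarrow> q \<in> fun_on J \<Longrightarrow>
      K (\<lambda>i. p i + q i) = (\<lambda>i. K p i + K q i)"
    and K_b: "\<And>x y. x \<in> carrier M \<Longrightarrow> y \<in> carrier N \<Longrightarrow> b (h x) (k y) = K (b x y)"
    and C: "C \<in> carrier \<T>"
  shows "tensor_map A M ra N la h k C \<in> carrier \<T>"
    and "coord (tensor_map A M ra N la h k C) = K (coord C)"
proof -
  define T where "T = frag_extend (\<lambda>(x, y). frag_of (h x, k y))"
  have K0: "K (\<lambda>_. 0) = (\<lambda>_. 0)"
    using K_add[of "\<lambda>_. 0" "\<lambda>_. 0"] by (simp add: fun_eq_iff)
  have K_diff: "K (\<lambda>i. p i - q i) = (\<lambda>i. K p i - K q i)" if "p \<in> fun_on J" "q \<in> fun_on J" for p q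
  proof -
    have "K p = (\<lambda>i. K (\<lambda>i. p i - q i) i + K q i)"
      using K_add[of "\<lambda>i. p i - q i" q] that by simp
    from fun_cong[OF this] show ?thesis by (simp add: fun_eq_iff)
  qed
  have T: "T c \<in> carrier \<F> \<and> lift (T c) = K (lift c)" if "c \<in> carrier \<F>" for c
    using that
  proof (induction rule: free_induct)
    case (one x y)
    then show ?case by (simp add: T_def h k K_b carrier_free)
  next
    case (diff c d)
    then show ?case
      by (simp add: T_def frag_extend_diff diff_carrier lift_diff K_diff lift_closed)
  qed (simp add: T_def K0 carrier_free)
  obtain c where c: "c \<in> carrier \<F>" "C = \<N> #>\<^bsub>\<F>\<^esub> c"
    using C by (auto simp: carrier_tensor)
  have eq: "\<N> #>\<^bsub>\<F>\<^esub> T d = \<N> #>\<^bsub>\<F>\<^esub> T c" if "d \<in> C" for d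
    using that c T by (simp add: coset_eq)
  have "c \<in> C" using c by (simp add: coset_eq)
  have "tensor_map A M ra N la h k C = (\<Union>d\<in>C. \<N> #>\<^bsub>\<F>\<^esub> T d)"
    using C by (simp add: tensor_map_def T_def tensor_module_def)
  also have "\<dots> = \<N> #>\<^bsub>\<F>\<^esub> T c"
    using eq \<open>c \<in> C\<close> by blast
  finally have *: "tensor_map A M ra N la h k C = \<N> #>\<^bsub>\<F>\<^esub> T c" .
  show "tensor_map A M ra N la h k C \<in> carrier \<T>"
    using T[OF c(1)] by (simp add: * carrier_tensor)
  show "coord (tensor_map A M ra N la h k C) = K (coord C)"
    using T[OF c(1)] by (simp add: * coord_coset coord_coset[OF c(1), folded c(2)])
qed

lemma coordinates: "coordinates \<T> J coord"
proof
  show "bij_betw coord (carrier \<T>) (fun_on J)"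
    unfolding bij_betw_def
  proof (intro conjI inj_onI)
    fix C D assume "C \<in> carrier \<T>" "D \<in> carrier \<T>" "coord C = coord D"
    then show "C = D"
      by (auto simp: carrier_tensor coord_coset) (simp_all add: coset_eq)
    next
      show "coord ` carrier \<T> = fun_on J"
      proof (intro equalityI subsetI)
        fix p :: "'i \<Rightarrow> 'r" assume p: "p \<in> fun_on J"
        then have "p = coord (\<N> #>\<^bsub>\<F>\<^esub> s p)" by (simp add: coord_coset s_carrier lift_s)
        with p show "p \<in> coord ` carrier \<T>" by (auto simp: carrier_tensor s_carrier)
      next
        fix p assume "p \<in> coord ` carrier \<T>"
        then show "p \<in> fun_on J" by (auto simp: carrier_tensor coord_coset lift_closed)
      qed
  qed
next
  have z: "0 \<in> carrier \<F>" by (simp add: carrier_free)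
  have "\<zero>\<^bsub>\<T>\<^esub> = \<N>" by (simp add: tensor_module_def tensor_group_def FactGroup_def)
  also have "\<N> = \<N> #>\<^bsub>\<F>\<^esub> 0" using z by (auto simp: coset_eq null_iff)
  finally have eq: "\<zero>\<^bsub>\<T>\<^esub> = \<N> #>\<^bsub>\<F>\<^esub> 0" .
  show "\<zero>\<^bsub>\<T>\<^esub> \<in> carrier \<T>" using z by (simp add: eq carrier_tensor)
  show "coord \<zero>\<^bsub>\<T>\<^esub> = (\<lambda>_. 0)" by (simp add: eq coord_coset z)
next
  fix C D assume "C \<in> carrier \<T>" "D \<in> carrier \<T>"
  then obtain c d where c: "c \<in> carrier \<F>" "C = \<N> #>\<^bsub>\<F>\<^esub> c" and d: "d \<in> carrier \<F>" "D = \<N> #>\<^bsub>\<F>\<^esub> d"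
    by (auto simp: carrier_tensor)
  have "C \<oplus>\<^bsub>\<T>\<^esub> D = C <#>\<^bsub>\<F>\<^esub> D"
    by (simp add: tensor_module_def tensor_group_def FactGroup_def)
  also have "\<dots> = \<N> #>\<^bsub>\<F>\<^esub> (c + d)"
    using normal.rcos_sum[OF comm_group.subgroup_imp_normal[OF comm_group_free subgroup_null] c(1) d(1)]
    by (simp add: c d)
  finally have eq: "C \<oplus>\<^bsub>\<T>\<^esub> D = \<N> #>\<^bsub>\<F>\<^esub> (c + d)" .
  show "C \<oplus>\<^bsub>\<T>\<^esub> D \<in> carrier \<T>" unfolding eq by (simp add: carrier_tensor add_carrier c(1) d(1))
  show "coord (C \<oplus>\<^bsub>\<T>\<^esub> D) = (\<lambda>i. coord C i + coord D i)"
    unfolding eq by (simp add: c d coord_coset add_carrier lift_add)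
next
  fix r C assume C: "C \<in> carrier \<T>"
  have sm: "r \<odot>\<^bsub>\<T>\<^esub> C = tensor_map A M ra N la (\<lambda>x. x) (\<lambda>y. r \<odot>\<^bsub>N\<^esub> y) C"
    by (simp add: tensor_module_def)
  note t = tensor_map_coset[of "\<lambda>x. x" "\<lambda>y. r \<odot>\<^bsub>N\<^esub> y" "\<lambda>p i. r * p i", OF _ _ _ _ _ C]
  show "r \<odot>\<^bsub>\<T>\<^esub> C \<in> carrier \<T>"
    unfolding sm by (rule t) (simp_all add: right_smult_closed b_smult algebra_simps)
  show "coord (r \<odot>\<^bsub>\<T>\<^esub> C) = (\<lambda>i. r * coord C i)"
    unfolding sm by (rule t) (simp_all add: right_smult_closed b_smult algebra_simps)
qed

text \<open>The elements \<open>b x y\<close> generate \<open>fun_on J\<close> additively, since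
  every \<open>p\<close> is \<open>lift (s p)\<close>. Laws for operators on coordinates can thus be
  tested on pure tensors.\<close>

lemma additive_unique:
  fixes K L :: "('i \<Rightarrow> 'r) \<Rightarrow> 'j \<Rightarrow> 'r"
  assumes K: "\<And>p q. p \<in> fun_on J \<Longrightarrow> q \<in> fun_on J \<Longrightarrow> K (\<lambda>i. p i + q i) = (\<lambda>i. K p i + K q i)"
    and L: "\<And>p q. p \<in> fun_on J \<Longrightarrow> q \<in> fun_on J \<Longrightarrow> L (\<lambda>i. p i + q i) = (\<lambda>i. L p i + L q i)"
    and eq: "\<And>x y. x \<in> carrier M \<Longrightarrow> y \<in> carrier N \<Longrightarrow> K (b x y) = L (b x y)"
    and p: "p \<in> fun_on J"
  shows "K p = L p"
proof -
  have Hzero: "H (\<lambda>_. 0) = (\<lambda>_. 0)" and sub: "\<And>p q. p \<in> fun_on J \<Longrightarrow> q \<in> fun_on J \<Longrightarrow>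
      H (\<lambda>i. p i - q i) = (\<lambda>i. H p i - H q i)"
    if H: "\<And>p q. p \<in> fun_on J \<Longrightarrow> q \<in> fun_on J \<Longrightarrow> H (\<lambda>i. p i + q i) = (\<lambda>i. H p i + H q i)"
    for H :: "('i \<Rightarrow> 'r) \<Rightarrow> 'j \<Rightarrow> 'r"
  proof -
    show "H (\<lambda>_. 0) = (\<lambda>_. 0)" using H[of "\<lambda>_. 0" "\<lambda>_. 0"] by (simp add: fun_eq_iff)
    fix p q :: "'i \<Rightarrow> 'r" assume pq: "p \<in> fun_on J" "q \<in> fun_on J"
    then have "H p = (\<lambda>i. H (\<lambda>i. p i - q i) i + H q i)"
      using H[of "\<lambda>i. p i - q i" q] by simp
    from fun_cong[OF this] show "H (\<lambda>i. p i - q i) = (\<lambda>i. H p i - H q i)" by (simp add: fun_eq_iff)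
  qed
  have KL0: "K (\<lambda>_. 0) = (\<lambda>_. 0)" "L (\<lambda>_. 0) = (\<lambda>_. 0)"
    by (rule Hzero, rule K, assumption, assumption) (rule Hzero, rule L, assumption, assumption)
  have KL: "K (\<lambda>i. p i - q i) = (\<lambda>i. K p i - K q i)" "L (\<lambda>i. p i - q i) = (\<lambda>i. L p i - L q i)"
    if "p \<in> fun_on J" "q \<in> fun_on J" for p q
    by (rule sub, rule K, assumption, assumption, rule that, rule that)
      (rule sub, rule L, assumption, assumption, rule that, rule that)
  have "K (lift c) = L (lift c)" if "c \<in> carrier \<F>" for c
    using that
  proof (induction rule: free_induct)
    case zero
    then show ?case by (simp add: KL0)
  next
    case (one x y)
    then show ?case by (simp add: eq)
  next
    case (diff c d)
    then show ?case
      by (simp add: lift_diff lift_closed KL)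
  qed
  from this[of "s p"] show ?thesis using p by (simp add: s_carrier lift_s)
qed

end

text \<open>Closure and additivity of \<open>K\<close> are requested; its compatibility with
  scalars, unit and products is inherited from \<open>h\<close> and \<open>k\<close> on pure tensors
  through \<open>additive_unique\<close>.\<close>

lemma (in group) tensor_rep_coordinates:
  fixes \<rho> :: "('a, 'r::comm_ring_1, (('m \<times> 'n) \<Rightarrow>\<^sub>0 int) set) rep"
  assumes "tensor_coordinates A M ra N la (J :: 'i set) b s"
    and space: "space \<rho> = tensor_module A M ra N la"
    and act: "act \<rho> = (\<lambda>g\<in>carrier G. tensor_map A M ra N la (h g) (k g))"
    and h: "\<And>g x. g \<in> carrier G \<Longrightarrow> x \<in> carrier M \<Longrightarrow> h g x \<in> carrier M"
      "\<And>x. x \<in> carrier M \<Longrightarrow> h \<one> x = x"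
      "\<And>g g' x. g \<in> carrier G \<Longrightarrow> g' \<in> carrier G \<Longrightarrow> x \<in> carrier M \<Longrightarrow> h (g \<otimes> g') x = h g (h g' x)"
    and k: "\<And>g x. g \<in> carrier G \<Longrightarrow> x \<in> carrier N \<Longrightarrow> k g x \<in> carrier N"
      "\<And>x. x \<in> carrier N \<Longrightarrow> k \<one> x = x"
      "\<And>g g' x. g \<in> carrier G \<Longrightarrow> g' \<in> carrier G \<Longrightarrow> x \<in> carrier N \<Longrightarrow> k (g \<otimes> g') x = k g (k g' x)"
      "\<And>g r x. g \<in> carrier G \<Longrightarrow> x \<in> carrier N \<Longrightarrow> k g (r \<odot>\<^bsub>N\<^esub> x) = r \<odot>\<^bsub>N\<^esub> k g x"
    and K_closed: "\<And>g p. g \<in> carrier G \<Longrightarrow> p \<in> fun_on J \<Longrightarrow> K g p \<in> fun_on J"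
    and K_add: "\<And>g p q. g \<in> carrier G \<Longrightarrow> p \<in> fun_on J \<Longrightarrow> q \<in> fun_on J \<Longrightarrow>
      K g (\<lambda>i. p i + q i) = (\<lambda>i. K g p i + K g q i)"
    and K_b: "\<And>g x y. g \<in> carrier G \<Longrightarrow> x \<in> carrier M \<Longrightarrow> y \<in> carrier N \<Longrightarrow>
      b (h g x) (k g y) = K g (b x y)"
  shows "rep_coordinates G \<rho> J (tensor_coordinates.coord b) K"
proof -
  interpret t: tensor_coordinates A M ra N la J b s by fact
  have tm: "tensor_map A M ra N la (h g) (k g) C \<in> carrier t.\<T>"
    "t.coord (tensor_map A M ra N la (h g) (k g) C) = K g (t.coord C)"
    if "g \<in> carrier G" "C \<in> carrier t.\<T>" for g C
    by (rule t.tensor_map_coset; use that in \<open>simp add: h k K_closed K_add K_b\<close>)+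
  interpret c: coordinates "space \<rho>" J t.coord
    unfolding space by (rule t.coordinates)
  show ?thesis
  proof
    fix g assume g: "g \<in> carrier G"
    show "act \<rho> g \<in> extensional (carrier (space \<rho>))"
      by (auto simp: act g space tensor_map_def tensor_module_def)
    fix C assume C: "C \<in> carrier (space \<rho>)"
    show "act \<rho> g C \<in> carrier (space \<rho>)"
      using tm(1)[of g C] g C by (simp add: act space)
    show "t.coord (act \<rho> g C) = K g (t.coord C)"
      using tm(2)[of g C] g C by (simp add: act space)
  next
    fix g and p :: "'i \<Rightarrow> 'r" assume g: "g \<in> carrier G" and p: "p \<in> fun_on J"
    show "K g (\<lambda>i. r * p i) = (\<lambda>i. r * K g p i)" for r
    proof (rule t.additive_unique[OF _ _ _ p, of "\<lambda>p. K g (\<lambda>i. r * p i)" "\<lambda>p i. r * K g p i"])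
      fix x y assume xy: "x \<in> carrier M" "y \<in> carrier N"
      then have "K g (\<lambda>i. r * b x y i) = K g (b x (r \<odot>\<^bsub>N\<^esub> y))" by (simp add: t.b_smult)
      also have "\<dots> = b (h g x) (r \<odot>\<^bsub>N\<^esub> k g y)"
        using xy g by (simp add: K_b[symmetric] t.right_smult_closed k)
      also have "\<dots> = (\<lambda>i. r * K g (b x y) i)"
        using xy g by (simp add: t.b_smult h k K_b)
      finally show "K g (\<lambda>i. r * b x y i) = (\<lambda>i. r * K g (b x y) i)" .
    next
      fix p q :: "'i \<Rightarrow> 'r" assume "p \<in> fun_on J" "q \<in> fun_on J"
      then show "K g (\<lambda>i. r * (p i + q i)) = (\<lambda>i. K g (\<lambda>i. r * p i) i + K g (\<lambda>i. r * q i) i)"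
        using K_add[OF g, of "\<lambda>i. r * p i" "\<lambda>i. r * q i"] by (simp add: distrib_left)
    qed (simp add: K_add g distrib_left)
  next
    fix p :: "'i \<Rightarrow> 'r" assume p: "p \<in> fun_on J"
    show "K \<one> p = p"
    proof (rule t.additive_unique[OF _ _ _ p, of "K \<one>" "\<lambda>p. p"])
      fix x y assume "x \<in> carrier M" "y \<in> carrier N"
      then show "K \<one> (b x y) = b x y" by (simp add: K_b[symmetric] h k)
    qed (simp_all add: K_add)
    fix g g' assume g: "g \<in> carrier G" "g' \<in> carrier G"
    show "K (g \<otimes> g') p = K g (K g' p)"
    proof (rule t.additive_unique[OF _ _ _ p, of "K (g \<otimes> g')" "\<lambda>p. K g (K g' p)"])
      fix x y assume "x \<in> carrier M" "y \<in> carrier N"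
      then show "K (g \<otimes> g') (b x y) = K g (K g' (b x y))"
        using g by (simp add: K_b[symmetric] h k)
    qed (simp_all add: K_add g K_closed)
  qed (simp_all add: K_closed K_add)
qed


section \<open>Homomorphisms from welded braid groups\<close>

lemma group_wB: "group (wB n)"
  by (simp add: wB_def group_presented_group)

lemma wB_class_carrier:
  assumes "set gs \<subseteq> wB_gens n" shows "wB_class n gs \<in> carrier (wB n)"
  unfolding wB_class_def wB_def by (rule word_class_carrier) (use assms in auto)

lemma wB_class_Nil: "wB_class n [] = \<one>\<^bsub>wB n\<^esub>"
  by (simp add: wB_class_def wB_def presented_group_one)

lemma wB_class_Cons:
  assumes "g \<in> wB_gens n" "set gs \<subseteq> wB_gens n"
  shows "wB_class n (g # gs) = wB_class n [g] \<otimes>\<^bsub>wB n\<^esub> wB_class n gs"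
  unfolding wB_class_def wB_def by (subst presented_group_mult) (use assms in auto)

lemma Sig_in_gens: "1 \<le> i \<Longrightarrow> i < n \<Longrightarrow> Sig i \<in> wB_gens n"
  and Tau_in_gens: "1 \<le> i \<Longrightarrow> i < n \<Longrightarrow> Tau i \<in> wB_gens n"
  by (auto simp: wB_gens_def)

lemma wB_class_rel:
  assumes "(pos_word us, pos_word vs) \<in> wB_rels n" "set us \<subseteq> wB_gens n" "set vs \<subseteq> wB_gens n"
  shows "wB_class n us = wB_class n vs"
  unfolding wB_class_def by (rule word_class_eqI, rule word_eq.rel) (use assms in auto)

lemma wB_induct [consumes 1, case_names one gen inv_gen]:
  assumes "W \<in> carrier (wB n)" "P \<one>\<^bsub>wB n\<^esub>"
    and "\<And>g W. g \<in> wB_gens n \<Longrightarrow> W \<in> carrier (wB n) \<Longrightarrow> P W \<Longrightarrow> P (wB_class n [g] \<otimes>\<^bsub>wB n\<^esub> W)"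
    and "\<And>g W. g \<in> wB_gens n \<Longrightarrow> W \<in> carrier (wB n) \<Longrightarrow> P W \<Longrightarrow>
      P (inv\<^bsub>wB n\<^esub> wB_class n [g] \<otimes>\<^bsub>wB n\<^esub> W)"
  shows "P W"
  using presented_group_induct[of W "wB_gens n" "wB_rels n" P] assms
  by (simp add: wB_def wB_class_def)

text \<open>The defining relations in a form convenient to verify. \<open>far\<close> treats
  \<open>i + 2 \<le> k\<close> with both mixed commutations in place of a condition on the absolute
  difference, and products of three are bracketed to the right, as \<open>eval_word\<close> produces
  them.\<close>

locale welded_relations = group H for H (structure) +
  fixes m :: nat and f :: "wgen \<Rightarrow> 'h"
  assumes Sig_closed: "\<And>i. 1 \<le> i \<Longrightarrow> i < m \<Longrightarrow> f (Sig i) \<in> carrier H"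
    and Tau_closed: "\<And>i. 1 \<le> i \<Longrightarrow> i < m \<Longrightarrow> f (Tau i) \<in> carrier H"
    and far: "\<And>i k. 1 \<le> i \<Longrightarrow> i + 2 \<le> k \<Longrightarrow> k < m \<Longrightarrow>
      f (Sig i) \<otimes> f (Sig k) = f (Sig k) \<otimes> f (Sig i) \<and>
      f (Tau i) \<otimes> f (Tau k) = f (Tau k) \<otimes> f (Tau i) \<and>
      f (Sig i) \<otimes> f (Tau k) = f (Tau k) \<otimes> f (Sig i) \<and>
      f (Sig k) \<otimes> f (Tau i) = f (Tau i) \<otimes> f (Sig k)"
    and near: "\<And>i. 1 \<le> i \<Longrightarrow> i + 2 \<le> m \<Longrightarrow>
      f (Sig i) \<otimes> (f (Sig (i+1)) \<otimes> f (Sig i)) = f (Sig (i+1)) \<otimes> (f (Sig i) \<otimes> f (Sig (i+1))) \<and>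
      f (Tau i) \<otimes> (f (Tau (i+1)) \<otimes> f (Tau i)) = f (Tau (i+1)) \<otimes> (f (Tau i) \<otimes> f (Tau (i+1))) \<and>
      f (Tau i) \<otimes> (f (Sig (i+1)) \<otimes> f (Sig i)) = f (Sig (i+1)) \<otimes> (f (Sig i) \<otimes> f (Tau (i+1))) \<and>
      f (Sig i) \<otimes> (f (Tau (i+1)) \<otimes> f (Tau i)) = f (Tau (i+1)) \<otimes> (f (Tau i) \<otimes> f (Sig (i+1)))"
    and involution: "\<And>i. 1 \<le> i \<Longrightarrow> i < m \<Longrightarrow> f (Tau i) \<otimes> f (Tau i) = \<one>"
begin

lemma gen_closed: "g \<in> wB_gens m \<Longrightarrow> f g \<in> carrier H"
  by (auto simp: wB_gens_def Sig_closed Tau_closed)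

lemma eval_rels:
  assumes "(u, v) \<in> wB_rels m" shows "eval_word H f u = eval_word H f v"
proof -
  note closed = Sig_closed Tau_closed
  have far': "f (Sig i) \<otimes> f (Sig k) = f (Sig k) \<otimes> f (Sig i) \<and>
      f (Tau i) \<otimes> f (Tau k) = f (Tau k) \<otimes> f (Tau i) \<and>
      f (Sig i) \<otimes> f (Tau k) = f (Tau k) \<otimes> f (Sig i)"
    if "1 \<le> i" "i < m" "1 \<le> k" "k < m" "\<bar>int i - int k\<bar> \<ge> 2" for i k
  proof (cases "i + 2 \<le> k")
    case True
    show ?thesis using far[OF that(1) True that(4)] by blast
  next
    case False
    then have "k + 2 \<le> i" using that(5) by linarith
    from far[OF that(3) this that(2)] show ?thesis by metis
  qed
  show ?thesis using assms unfolding wB_rels_def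
  proof (elim UnE UN_E)
    fix i k
    assume "i \<in> {1..<m}" "k \<in> {k \<in> {1..<m}. 2 \<le> \<bar>int i - int k\<bar>}"
      "(u, v) \<in> {(pos_word [Sig i, Sig k], pos_word [Sig k, Sig i]),
        (pos_word [Tau i, Tau k], pos_word [Tau k, Tau i]),
        (pos_word [Sig i, Tau k], pos_word [Tau k, Sig i])}"
    then have "1 \<le> i" "i < m" "1 \<le> k" "k < m" "\<bar>int i - int k\<bar> \<ge> 2"
      and uv: "(u, v) = (pos_word [Sig i, Sig k], pos_word [Sig k, Sig i]) \<or>
        (u, v) = (pos_word [Tau i, Tau k], pos_word [Tau k, Tau i]) \<or>
        (u, v) = (pos_word [Sig i, Tau k], pos_word [Tau k, Sig i])" by auto
    note far'[OF this(1-5)]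
    with uv show ?thesis using \<open>1 \<le> i\<close> \<open>i < m\<close> \<open>1 \<le> k\<close> \<open>k < m\<close>
      by (elim disjE; simp add: eval_word_def closed)
  next
    fix i
    assume "i \<in> {i. 1 \<le> i \<and> i + 2 \<le> m}"
      "(u, v) \<in> {(pos_word [Sig i, Sig (i+1), Sig i], pos_word [Sig (i+1), Sig i, Sig (i+1)]),
        (pos_word [Tau i, Tau (i+1), Tau i], pos_word [Tau (i+1), Tau i, Tau (i+1)])}"
    then show ?thesis using near[of i] by (auto simp: eval_word_def closed)
  next
    fix i
    assume "i \<in> {1..<m}" "(u, v) \<in> {(pos_word [Tau i, Tau i], [])}"
    then show ?thesis by (auto simp: eval_word_def closed involution)
  next
    fix i
    assume "i \<in> {i. 1 \<le> i \<and> i + 2 \<le> m}"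
      "(u, v) \<in> {(pos_word [Tau i, Sig (i+1), Sig i], pos_word [Sig (i+1), Sig i, Tau (i+1)]),
        (pos_word [Sig i, Tau (i+1), Tau i], pos_word [Tau (i+1), Tau i, Sig (i+1)])}"
    then show ?thesis using near[of i] by (auto simp: eval_word_def closed)
  qed
qed

lemma wB_hom: "wB_hom m H f \<in> hom (wB m) H"
  unfolding wB_hom_def wB_def by (rule presented_hom_hom) (auto intro: gen_closed eval_rels)

lemma wB_hom_gen: "g \<in> wB_gens m \<Longrightarrow> wB_hom m H f (wB_class m [g]) = f g"
  unfolding wB_hom_def wB_class_def list.map
  by (rule presented_hom_gen) (auto intro: gen_closed eval_rels)

end


section \<open>Coordinates on matrix representations\<close>

definition vec_coord :: "nat \<Rightarrow> 'r::zero vec \<Rightarrow> nat \<Rightarrow> 'r" where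
  "vec_coord m v = (\<lambda>i. if i < m then v $ i else 0)"

lemma coordinates_vec: "coordinates (module_vec TYPE('r::comm_ring_1) m) {..<m} (vec_coord m)"
proof
  show "bij_betw (vec_coord m) (carrier (module_vec TYPE('r) m)) (fun_on {..<m})"
    by (rule bij_betw_byWitness[where f' = "vec m"])
      (auto simp: module_vec_simps vec_coord_def fun_on_def)
qed (auto simp: module_vec_simps vec_coord_def fun_eq_iff)

lemma monoid_mat: "Group.monoid (ring_mat TYPE('r::comm_ring_1) m ())"
  by (rule ring.is_monoid, rule ring_mat)

lemma group_GL: "group (GL m :: 'r::comm_ring_1 mat monoid)"
  unfolding GL_def by (rule monoid.units_group[OF monoid_mat])

lemma GL_mult: "A \<otimes>\<^bsub>GL m\<^esub> B = A * B"
  and GL_one: "\<one>\<^bsub>GL m\<^esub> = 1\<^sub>m m"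
  by (simp_all add: GL_def units_of_def ring_mat_simps)

lemma GL_carrierI:
  "A \<in> carrier_mat m m \<Longrightarrow> B \<in> carrier_mat m m \<Longrightarrow> A * B = 1\<^sub>m m \<Longrightarrow> B * A = 1\<^sub>m m \<Longrightarrow>
   A \<in> carrier (GL m)"
  by (auto simp: GL_def units_of_def Units_def ring_mat_simps)

lemma GL_carrierD: "A \<in> carrier (GL m) \<Longrightarrow> A \<in> carrier_mat m m"
  by (auto simp: GL_def units_of_def Units_def ring_mat_simps)

definition mat_act :: "nat \<Rightarrow> 'r::comm_ring_1 mat \<Rightarrow> (nat \<Rightarrow> 'r) \<Rightarrow> nat \<Rightarrow> 'r" where
  "mat_act m A p = vec_coord m (A *\<^sub>v vec m p)"

lemma vec_vec_coord: "v \<in> carrier_vec m \<Longrightarrow> vec m (vec_coord m v) = v"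
  by (auto simp: vec_coord_def)

lemma vec_coord_vec: "p \<in> fun_on {..<m} \<Longrightarrow> vec_coord m (vec m p) = p"
  by (auto simp: vec_coord_def fun_on_def)

lemma mat_act_mult:
  assumes "A \<in> carrier_mat m m" "B \<in> carrier_mat m m"
  shows "mat_act m (A * B) p = mat_act m A (mat_act m B p)"
  unfolding mat_act_def
  using assms by (subst vec_vec_coord) (auto simp: assoc_mult_mat_vec[of A m m B m])

lemma mat_act_closed: "mat_act m A p \<in> fun_on {..<m}"
  by (simp add: mat_act_def vec_coord_def fun_on_def)

lemma mat_act_one: "p \<in> fun_on {..<m} \<Longrightarrow> mat_act m (1\<^sub>m m) p = p"
  by (simp add: mat_act_def vec_coord_vec)

text \<open>Evaluation on unit vectors recovers the entries. Matrix identities thereby become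
  pointwise identities between functions, where no dimensions have to be tracked.\<close>

lemma mat_eqI_act:
  assumes A: "A \<in> carrier_mat m m" and B: "B \<in> carrier_mat m m"
    and eq: "\<And>p. p \<in> fun_on {..<m} \<Longrightarrow> mat_act m A p = mat_act m B p"
  shows "A = B"
proof (rule eq_matI)
  fix i j assume ij: "i < dim_row B" "j < dim_col B"
  let ?p = "\<lambda>k. if k = j then 1 else 0"
  have p: "?p \<in> fun_on {..<m}" using ij B by (auto simp: fun_on_def)
  have u: "vec m ?p = unit_vec m j" using ij B by (auto simp: unit_vec_def)
  have "mat_act m C ?p i = C $$ (i, j)" if "C \<in> carrier_mat m m" for C :: "'a mat"
    using that ij B unfolding mat_act_def u by (simp add: vec_coord_def)
  from this[OF A] this[OF B] eq[OF p] show "A $$ (i, j) = B $$ (i, j)" by simp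
qed (use A B in auto)

lemma rep_coordinates_matrix_rep:
  fixes \<mu> :: "'g \<Rightarrow> 'r::comm_ring_1 mat"
  assumes "group G" and \<mu>: "\<mu> \<in> hom G (GL m)"
  shows "rep_coordinates G (matrix_rep m \<mu>) {..<m} (vec_coord m) (\<lambda>g. mat_act m (\<mu> g))"
proof -
  interpret group G by fact
  interpret \<mu>: group_hom G "GL m :: 'r mat monoid" \<mu>
    using \<mu> group_GL is_group by (simp add: group_hom_def group_hom_axioms_def)
  interpret coordinates "space (matrix_rep m \<mu>)" "{..<m}" "vec_coord m"
    by (simp add: matrix_rep_def coordinates_vec)
  have c: "\<mu> g \<in> carrier_mat m m" if "g \<in> carrier G" for g
    using that by (intro GL_carrierD) simp
  have V: "carrier (space (matrix_rep m \<mu>)) = carrier_vec m"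
    by (simp add: matrix_rep_def module_vec_simps)
  show ?thesis
  proof
    fix g and v :: "'r vec" assume g: "g \<in> carrier G" and "v \<in> carrier (space (matrix_rep m \<mu>))"
    then have v: "v \<in> carrier_vec m" by (simp add: V)
    show "act (matrix_rep m \<mu>) g v \<in> carrier (space (matrix_rep m \<mu>))"
      unfolding V using v c[OF g] by (simp add: matrix_rep_def)
    show "vec_coord m (act (matrix_rep m \<mu>) g v) = mat_act m (\<mu> g) (vec_coord m v)"
      using v by (simp add: matrix_rep_def mat_act_def vec_vec_coord)
  next
    fix g and p q :: "nat \<Rightarrow> 'r" assume g: "g \<in> carrier G" and "p \<in> fun_on {..<m}" "q \<in> fun_on {..<m}"
    have "vec m (\<lambda>i. p i + q i) = vec m p + vec m q" by auto
    then show "mat_act m (\<mu> g) (\<lambda>i. p i + q i) =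
        (\<lambda>i. mat_act m (\<mu> g) p i + mat_act m (\<mu> g) q i)"
      using c[OF g] by (auto simp: mat_act_def vec_coord_def fun_eq_iff mult_add_distrib_mat_vec[OF c[OF g]])
  next
    fix g and p :: "nat \<Rightarrow> 'r" and r assume g: "g \<in> carrier G"
    have "vec m (\<lambda>i. r * p i) = r \<cdot>\<^sub>v vec m p" by auto
    then show "mat_act m (\<mu> g) (\<lambda>i. r * p i) = (\<lambda>i. r * mat_act m (\<mu> g) p i)"
      using c[OF g]
      by (auto simp: mat_act_def vec_coord_def fun_eq_iff scalar_prod_def sum_distrib_left algebra_simps)
  next
    fix p :: "nat \<Rightarrow> 'r" assume "p \<in> fun_on {..<m}"
    then show "mat_act m (\<mu> \<one>\<^bsub>G\<^esub>) p = p" by (simp add: GL_one mat_act_one)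
  next
    fix g h and p :: "nat \<Rightarrow> 'r" assume "g \<in> carrier G" "h \<in> carrier G"
    then show "mat_act m (\<mu> (g \<otimes>\<^bsub>G\<^esub> h)) p = mat_act m (\<mu> g) (mat_act m (\<mu> h) p)"
      by (simp add: GL_mult mat_act_mult c)
  next
    fix g assume "g \<in> carrier G"
    show "act (matrix_rep m \<mu>) g \<in> extensional (carrier (space (matrix_rep m \<mu>)))"
      by (simp add: V) (simp add: matrix_rep_def)
  qed (simp add: mat_act_closed)
qed


section \<open>Burau matrices\<close>

text \<open>Positions count from 0 whereas generators count from 1: generator \<open>Suc j\<close>
  has its block at the positions \<open>j\<close> and \<open>Suc j\<close>.\<close>

definition block2 :: "nat \<Rightarrow> nat \<Rightarrow> 'r::comm_ring_1 \<Rightarrow> 'r \<Rightarrow> 'r \<Rightarrow> 'r \<Rightarrow> 'r mat" where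
  "block2 m j a b c d = mat m m (\<lambda>(r, k).
     if r = j \<and> k = j then a else if r = j \<and> k = Suc j then b
     else if r = Suc j \<and> k = j then c else if r = Suc j \<and> k = Suc j then d
     else if r = k then 1 else 0)"

definition block_act :: "nat \<Rightarrow> 'r::comm_ring_1 \<Rightarrow> 'r \<Rightarrow> 'r \<Rightarrow> 'r \<Rightarrow> (nat \<Rightarrow> 'r) \<Rightarrow> nat \<Rightarrow> 'r" where
  "block_act j a b c d p = (\<lambda>r. if r = j then a * p j + b * p (Suc j)
     else if r = Suc j then c * p j + d * p (Suc j) else p r)"

lemma block2_carrier [simp]: "block2 m j a b c d \<in> carrier_mat m m"
  by (simp add: block2_def)

lemma block2_index:
  "r < m \<Longrightarrow> k < m \<Longrightarrow> block2 m j a b c d $$ (r, k) =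
    (if r = j \<and> k = j then a else if r = j \<and> k = Suc j then b
     else if r = Suc j \<and> k = j then c else if r = Suc j \<and> k = Suc j then d
     else if r = k then 1 else 0)"
  and block2_dim: "dim_row (block2 m j a b c d) = m" "dim_col (block2 m j a b c d) = m"
  by (simp_all add: block2_def)

lemma mat_act_block2:
  assumes "Suc j < m" "p \<in> fun_on {..<m}"
  shows "mat_act m (block2 m j a b c d) p = block_act j a b c d p"
proof (rule ext)
  fix r
  show "mat_act m (block2 m j a b c d) p r = block_act j a b c d p r"
  proof (cases "r < m")
    case True
    have two: "(\<Sum>k = 0..<m. (if k = j then x else if k = Suc j then y else 0) * p k) =
        x * p j + y * p (Suc j)" for x y
    proof -
      have "(\<Sum>k = 0..<m. (if k = j then x else if k = Suc j then y else 0) * p k) =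
          (\<Sum>k = 0..<m. (if k = j then x * p k else 0) + (if k = Suc j then y * p k else 0))"
        by (rule sum.cong) auto
      also have "\<dots> = x * p j + y * p (Suc j)"
        using assms(1) by (simp add: sum.distrib sum.delta)
      finally show ?thesis .
    qed
    have one: "(\<Sum>k = 0..<m. (if r = k then 1 else 0) * p k) = p r"
      using True by (simp add: if_distribR flip: of_bool_def)
    have row: "mat_act m (block2 m j a b c d) p r = (\<Sum>k = 0..<m. block2 m j a b c d $$ (r, k) * p k)"
      using True by (simp add: mat_act_def vec_coord_def scalar_prod_def block2_dim)
    consider "r = j" | "r = Suc j" | "r \<noteq> j" "r \<noteq> Suc j" by blast
    then show ?thesis
    proof cases
      case 1
      then have "mat_act m (block2 m j a b c d) p r =
          (\<Sum>k = 0..<m. (if k = j then a else if k = Suc j then b else 0) * p k)"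
        unfolding row using True by (intro sum.cong) (auto simp: block2_index)
      then show ?thesis using 1 by (simp only: two) (simp add: block_act_def)
    next
      case 2
      then have "mat_act m (block2 m j a b c d) p r =
          (\<Sum>k = 0..<m. (if k = j then c else if k = Suc j then d else 0) * p k)"
        unfolding row using True by (intro sum.cong) (auto simp: block2_index)
      then show ?thesis using 2 by (simp only: two) (simp add: block_act_def)
    next
      case 3
      then have "mat_act m (block2 m j a b c d) p r = (\<Sum>k = 0..<m. (if r = k then 1 else 0) * p k)"
        unfolding row using True by (intro sum.cong) (auto simp: block2_index)
      then show ?thesis using 3 by (simp only: one) (simp add: block_act_def)
    qed
  next
    case False
    then show ?thesis using assms
      by (auto simp: mat_act_def vec_coord_def block_act_def fun_on_def)
  qed
qed

lemma block_act_closed: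
  "Suc j < m \<Longrightarrow> p \<in> fun_on {..<m} \<Longrightarrow> block_act j a b c d p \<in> fun_on {..<m}"
  by (auto simp: block_act_def fun_on_def)

lemma block2_mult:
  assumes "Suc j < m"
  shows "block2 m j a b c d * block2 m j a' b' c' d' =
    block2 m j (a * a' + b * c') (a * b' + b * d') (c * a' + d * c') (c * b' + d * d')"
proof (rule mat_eqI_act)
  fix p :: "nat \<Rightarrow> 'a" assume "p \<in> fun_on {..<m}"
  then show "mat_act m (block2 m j a b c d * block2 m j a' b' c' d') p = mat_act m
      (block2 m j (a * a' + b * c') (a * b' + b * d') (c * a' + d * c') (c * b' + d * d')) p"
    using assms by (simp add: mat_act_mult mat_act_block2 block_act_closed)
      (simp add: block_act_def fun_eq_iff algebra_simps)
qed (simp_all add: mult_carrier_mat[of _ m m _ m])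

lemma block2_one:
  assumes "Suc j < m" shows "block2 m j 1 0 0 1 = (1\<^sub>m m :: 'r::comm_ring_1 mat)"
proof (rule mat_eqI_act)
  fix p :: "nat \<Rightarrow> 'r" assume p: "p \<in> fun_on {..<m}"
  have "block_act j 1 0 0 1 p = p" by (rule ext) (simp add: block_act_def)
  then show "mat_act m (block2 m j 1 0 0 1) p = mat_act m (1\<^sub>m m) p"
    using p assms by (simp add: mat_act_block2 mat_act_one)
qed simp_all

lemma block2_transpose: "(block2 m j a b c d)\<^sup>T = block2 m j a c b d"
proof (rule eq_matI)
  fix r k assume "r < dim_row (block2 m j a c b d)" "k < dim_col (block2 m j a c b d)"
  then have rk: "r < m" "k < m" by (simp_all only: block2_dim)
  consider "r = j" | "r = Suc j" | "r \<noteq> j" "r \<noteq> Suc j" by blast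
  then show "(block2 m j a b c d)\<^sup>T $$ (r, k) = block2 m j a c b d $$ (r, k)"
    using rk by cases (simp_all add: block2_index block2_dim)
qed (simp_all add: block2_dim)

lemma block2_GL:
  assumes "Suc j < m"
    and "a * a' + b * c' = 1" "a * b' + b * d' = 0" "c * a' + d * c' = 0" "c * b' + d * d' = 1"
    and "a' * a + b' * c = 1" "a' * b + b' * d = 0" "c' * a + d' * c = 0" "c' * b + d' * d = 1"
  shows "block2 m j a b c d \<in> carrier (GL m)"
    and "inv\<^bsub>GL m\<^esub> block2 m j a b c d = block2 m j a' b' c' d'"
proof -
  have 1: "block2 m j a b c d * block2 m j a' b' c' d' = 1\<^sub>m m"
    and 2: "block2 m j a' b' c' d' * block2 m j a b c d = 1\<^sub>m m"
    using assms by (simp_all add: block2_mult block2_one)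
  show *: "block2 m j a b c d \<in> carrier (GL m)"
    by (rule GL_carrierI[OF _ _ 1 2]) simp_all
  show "inv\<^bsub>GL m\<^esub> block2 m j a b c d = block2 m j a' b' c' d'"
    by (rule group.inv_equality[OF group_GL])
      (use 2 * GL_carrierI[OF _ _ 2 1] in \<open>simp_all add: GL_mult GL_one\<close>)
qed

text \<open>Two nested uses of \<open>four_block_mat\<close>: the inner one joins the small block to
  the lower identity, the outer one adds the upper identity. Entries are compared after locating row
  and column relative to the block.\<close>

lemma diag_block_mat_three:
  assumes "Suc j < m"
  shows "diag_block_mat [1\<^sub>m j, mat_of_rows_list 2 [[a, b], [c, d]], 1\<^sub>m (m - Suc j - 1)] = block2 m j a b c d"
    (is "?L = _")
proof -
  obtain l where m: "m = j + (2 + l)" using assms less_iff_Suc_add[of "Suc j" m] by auto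
  define B where "B = mat_of_rows_list 2 [[a, b], [c, d]]"
  have dim: "dim_row B = 2" "dim_col B = 2" by (simp_all add: B_def mat_of_rows_list_def)
  have B: "B $$ (0, 0) = a" "B $$ (0, Suc 0) = b" "B $$ (Suc 0, 0) = c" "B $$ (Suc 0, Suc 0) = d"
    by (simp_all add: B_def mat_of_rows_list_def)
  define C where "C = four_block_mat B (0\<^sub>m 2 l) (0\<^sub>m l 2) (1\<^sub>m l)"
  have dimC: "dim_row C = 2 + l" "dim_col C = 2 + l" by (simp_all add: C_def dim)
  have C: "C $$ (r, k) = (if r < 2 then if k < 2 then B $$ (r, k) else 0
      else if k < 2 then 0 else if r = k then 1 else 0)" if "r < 2 + l" "k < 2 + l" for r k
    using that unfolding C_def by (subst index_mat_four_block) (auto simp: dim)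
  have "?L = four_block_mat (1\<^sub>m j) (0\<^sub>m j (2 + l)) (0\<^sub>m (2 + l) j) C"
    unfolding B_def[symmetric] C_def
    by (subst diag_block_mat.simps(2), subst diag_block_mat.simps(2), subst diag_block_mat_singleton)
      (simp add: Let_def m dim)
  also have "\<dots> = block2 m j a b c d"
  proof (rule eq_matI)
    fix r k assume "r < dim_row (block2 m j a b c d)" "k < dim_col (block2 m j a b c d)"
    then have rk: "r < m" "k < m" by (simp_all only: block2_dim)
    have split: "x < j \<or> x = j \<or> x = j + Suc 0 \<or> (\<exists>y. x = j + Suc (Suc y))" for x
      by presburger
    have "four_block_mat (1\<^sub>m j) (0\<^sub>m j (2 + l)) (0\<^sub>m (2 + l) j) C $$ (r, k) =
        (if r < j then if k < j then 1\<^sub>m j $$ (r, k) else 0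
         else if k < j then 0 else C $$ (r - j, k - j))"
      using rk by (subst index_mat_four_block) (simp_all add: m dimC)
    also have "\<dots> = block2 m j a b c d $$ (r, k)"
      unfolding block2_index[OF rk] using rk split[of r] split[of k]
      by (elim disjE exE) (simp_all add: m dimC C B)
    finally show "four_block_mat (1\<^sub>m j) (0\<^sub>m j (2 + l)) (0\<^sub>m (2 + l) j) C $$ (r, k) =
        block2 m j a b c d $$ (r, k)" .
  qed (simp_all add: block2_dim dimC m)
  finally show ?thesis .
qed
lemma burau_matrix_Sig: "Suc j < m \<Longrightarrow> burau_matrix m u (Sig (Suc j)) = block2 m j 0 u 1 (1 - u)"
  and burau_matrix_Tau: "Suc j < m \<Longrightarrow> burau_matrix m u (Tau (Suc j)) = block2 m j 0 1 1 0"
  using diag_block_mat_three[of j m 0 u 1 "1 - u"] diag_block_mat_three[of j m 0 1 1 0]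
  by (simp_all add: burau_matrix_def del: diag_block_mat.simps)

lemma block2_welded_relations:
  fixes m :: nat and a b c d :: "'r::comm_ring_1"
  assumes Sig: "\<And>j. Suc j < m \<Longrightarrow> f (Sig (Suc j)) = block2 m j a b c d"
    and Tau: "\<And>j. Suc j < m \<Longrightarrow> f (Tau (Suc j)) = block2 m j 0 1 1 0"
    and GL: "\<And>j. Suc j < m \<Longrightarrow> block2 m j a b c d \<in> carrier (GL m)"
    and abcd: "(a, b, c, d) = (0, b, 1, 1 - b) \<or> (a, b, c, d) = (1 - b, b, 1, 0)"
  shows "welded_relations (GL m) m f"
proof -
  interpret group "GL m :: 'r mat monoid" by (rule group_GL)
  have eqI: "A = B" if "A \<in> carrier_mat m m" "B \<in> carrier_mat m m"
    "\<And>p. p \<in> fun_on {..<m} \<Longrightarrow> mat_act m A p = mat_act m B p" for A B :: "'r mat"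
    using that by (rule mat_eqI_act)
  note acts = mat_act_mult mat_act_block2 block_act_closed
  show ?thesis
  proof
    fix i assume "1 \<le> i" "i < m"
    then obtain j where j: "i = Suc j" "Suc j < m" by (cases i) auto
    then show "f (Sig i) \<in> carrier (GL m)" by (simp add: Sig GL)
    show "f (Tau i) \<in> carrier (GL m)" using j
      by (simp add: Tau) (rule block2_GL[where a'=0 and b'=1 and c'=1 and d'=0]; simp)
    show "f (Tau i) \<otimes>\<^bsub>GL m\<^esub> f (Tau i) = \<one>\<^bsub>GL m\<^esub>"
      using j by (simp add: GL_mult GL_one Tau block2_mult block2_one)
  next
    fix i k assume "1 \<le> i" "i + 2 \<le> k" "k < m"
    then obtain j l where jl: "i = Suc j" "k = Suc l" "Suc l < m" "j + 2 \<le> l"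
      by (cases i; cases k) auto
    have comm: "block2 m j a b c d * block2 m l a' b' c' d' =
        block2 m l a' b' c' d' * block2 m j a b c d" for a b c d a' b' c' d' :: 'r
      using jl by (intro eqI) (auto simp: acts mult_carrier_mat[of _ m m _ m], auto simp: block_act_def fun_eq_iff)
    show "f (Sig i) \<otimes>\<^bsub>GL m\<^esub> f (Sig k) = f (Sig k) \<otimes>\<^bsub>GL m\<^esub> f (Sig i) \<and>
      f (Tau i) \<otimes>\<^bsub>GL m\<^esub> f (Tau k) = f (Tau k) \<otimes>\<^bsub>GL m\<^esub> f (Tau i) \<and>
      f (Sig i) \<otimes>\<^bsub>GL m\<^esub> f (Tau k) = f (Tau k) \<otimes>\<^bsub>GL m\<^esub> f (Sig i) \<and>
      f (Sig k) \<otimes>\<^bsub>GL m\<^esub> f (Tau i) = f (Tau i) \<otimes>\<^bsub>GL m\<^esub> f (Sig k)"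
      using jl by (simp add: GL_mult Sig Tau comm)
  next
    fix i assume "1 \<le> i" "i + 2 \<le> m"
    then obtain j where j: "i = Suc j" "Suc (Suc j) < m" by (cases i) auto
    then have jj: "Suc j < m" "Suc (Suc j) < m" by simp_all
    have abcd': "a = 0 \<and> c = 1 \<and> d = 1 - b \<or> a = 1 - b \<and> c = 1 \<and> d = 0" using abcd by blast
    have S: "mat_act m (f (Sig (Suc j))) p = block_act j a b c d p"
      "mat_act m (f (Sig (Suc (Suc j)))) p = block_act (Suc j) a b c d p"
      "mat_act m (f (Tau (Suc j))) p = block_act j 0 1 1 0 p"
      "mat_act m (f (Tau (Suc (Suc j)))) p = block_act (Suc j) 0 1 1 0 p"
      if "p \<in> fun_on {..<m}" for p
      using that j by (simp_all add: Sig Tau mat_act_block2)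
    have C: "f (Sig (Suc j)) \<in> carrier_mat m m" "f (Sig (Suc (Suc j))) \<in> carrier_mat m m"
      "f (Tau (Suc j)) \<in> carrier_mat m m" "f (Tau (Suc (Suc j))) \<in> carrier_mat m m"
      using j by (simp_all add: Sig Tau)
    have eq3: "x * (y * z) = x' * (y' * z')"
      if "x \<in> carrier_mat m m" "y \<in> carrier_mat m m" "z \<in> carrier_mat m m"
        "x' \<in> carrier_mat m m" "y' \<in> carrier_mat m m" "z' \<in> carrier_mat m m"
        "\<And>p. p \<in> fun_on {..<m} \<Longrightarrow> mat_act m x (mat_act m y (mat_act m z p)) =
          mat_act m x' (mat_act m y' (mat_act m z' p))" for x y z x' y' z' :: "'r mat"
      using that by (intro eqI) (auto simp: mat_act_mult)
    show "f (Sig i) \<otimes>\<^bsub>GL m\<^esub> (f (Sig (i+1)) \<otimes>\<^bsub>GL m\<^esub> f (Sig i)) =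
        f (Sig (i+1)) \<otimes>\<^bsub>GL m\<^esub> (f (Sig i) \<otimes>\<^bsub>GL m\<^esub> f (Sig (i+1))) \<and>
      f (Tau i) \<otimes>\<^bsub>GL m\<^esub> (f (Tau (i+1)) \<otimes>\<^bsub>GL m\<^esub> f (Tau i)) =
        f (Tau (i+1)) \<otimes>\<^bsub>GL m\<^esub> (f (Tau i) \<otimes>\<^bsub>GL m\<^esub> f (Tau (i+1))) \<and>
      f (Tau i) \<otimes>\<^bsub>GL m\<^esub> (f (Sig (i+1)) \<otimes>\<^bsub>GL m\<^esub> f (Sig i)) =
        f (Sig (i+1)) \<otimes>\<^bsub>GL m\<^esub> (f (Sig i) \<otimes>\<^bsub>GL m\<^esub> f (Tau (i+1))) \<and>
      f (Sig i) \<otimes>\<^bsub>GL m\<^esub> (f (Tau (i+1)) \<otimes>\<^bsub>GL m\<^esub> f (Tau i)) =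
        f (Tau (i+1)) \<otimes>\<^bsub>GL m\<^esub> (f (Tau i) \<otimes>\<^bsub>GL m\<^esub> f (Sig (i+1)))"
      unfolding GL_mult j Suc_eq_plus1[symmetric] using abcd'
    proof (elim disjE conjE, goal_cases)
      case 1
      show ?case
        by (intro conjI eq3 C; simp only: S block_act_closed jj 1;
            auto simp: block_act_def fun_eq_iff algebra_simps)
    next
      case 2
      show ?case
        by (intro conjI eq3 C; simp only: S block_act_closed jj 2;
            auto simp: block_act_def fun_eq_iff algebra_simps)
    qed
  qed
qed

lemma Bur_welded:
  fixes u u' :: "'r::comm_ring_1"
  assumes "u * u' = 1"
  shows "welded_relations (GL m) m (burau_matrix m u)"
proof (rule block2_welded_relations)
  show "block2 m j 0 u 1 (1 - u) \<in> carrier (GL m)" if "Suc j < m" for j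
    using that assms by (intro block2_GL(1)[where a'="1 - u'" and b'=1 and c'=u' and d'=0])
      (simp_all add: algebra_simps)
qed (simp_all add: burau_matrix_Sig burau_matrix_Tau)

text \<open>The inverse of \<open>[[0, u], [1, 1 - u]]\<close> is
  \<open>[[1 - u', 1], [u', 0]]\<close>, and transposing it gives the second shape of
  \<open>block2_welded_relations\<close> with \<open>b = u'\<close>.\<close>

lemma Bur_dual_matrix:
  fixes u u' :: "'r::comm_ring_1"
  assumes "u * u' = 1" "Suc j < m"
  shows "transpose_mat (inv\<^bsub>GL m\<^esub> (burau_matrix m u (Sig (Suc j)))) = block2 m j (1 - u') u' 1 0"
    and "transpose_mat (inv\<^bsub>GL m\<^esub> (burau_matrix m u (Tau (Suc j)))) = block2 m j 0 1 1 0"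
proof -
  have "inv\<^bsub>GL m\<^esub> block2 m j 0 u 1 (1 - u) = block2 m j (1 - u') 1 u' 0"
    using assms by (intro block2_GL(2)) (simp_all add: algebra_simps)
  then show "transpose_mat (inv\<^bsub>GL m\<^esub> (burau_matrix m u (Sig (Suc j)))) = block2 m j (1 - u') u' 1 0"
    using assms by (simp add: burau_matrix_Sig block2_transpose)
  have "inv\<^bsub>GL m\<^esub> block2 m j 0 1 1 (0::'r) = block2 m j 0 1 1 0"
    using assms by (intro block2_GL(2)) simp_all
  then show "transpose_mat (inv\<^bsub>GL m\<^esub> (burau_matrix m u (Tau (Suc j)))) = block2 m j 0 1 1 0"
    using assms by (simp add: burau_matrix_Tau block2_transpose)
qed

lemma Bur_dual_welded:
  fixes u u' :: "'r::comm_ring_1"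
  assumes "u * u' = 1"
  shows "welded_relations (GL m) m (\<lambda>g. transpose_mat (inv\<^bsub>GL m\<^esub> (burau_matrix m u g)))"
proof (rule block2_welded_relations)
  show "block2 m j (1 - u') u' 1 0 \<in> carrier (GL m)" if "Suc j < m" for j
    using that assms by (intro block2_GL(1)[where a'=0 and b'=1 and c'=u and d'="1 - u"])
      (simp_all add: algebra_simps)
qed (simp_all add: Bur_dual_matrix[OF assms])


section \<open>Tensor products of representations\<close>

context coordinates
begin

definition basis :: "'i \<Rightarrow> 'i \<Rightarrow> 'r" where
  "basis j = (\<lambda>i. if i = j then 1 else 0)"

lemma basis_closed: "j \<in> J \<Longrightarrow> basis j \<in> fun_on J"
  by (auto simp: basis_def fun_on_def)

lemma expand:
  assumes "finite J" "x \<in> carrier V"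
  shows "x = (\<Oplus>\<^bsub>V\<^esub>j\<in>J. \<phi> x j \<odot>\<^bsub>V\<^esub> point (basis j))"
proof -
  interpret abelian_group V by (rule abelian_group)
  have c: "\<phi> x j \<odot>\<^bsub>V\<^esub> point (basis j) \<in> carrier V" if "j \<in> J" for j
    using that by (simp add: smult_closed point_closed basis_closed)
  have "\<phi> (\<Oplus>\<^bsub>V\<^esub>j\<in>J. \<phi> x j \<odot>\<^bsub>V\<^esub> point (basis j)) = (\<lambda>i. \<Sum>j\<in>J. \<phi> x j * basis j i)"
    using assms c by (simp add: coord_finsum Pi_def coord_smult point_closed basis_closed coord_point)
  also have "\<dots> = \<phi> x"
  proof
    fix i
    have "(\<Sum>j\<in>J. \<phi> x j * basis j i) = (\<Sum>j\<in>J. if i = j then \<phi> x j else 0)"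
      by (rule sum.cong) (auto simp: basis_def)
    then show "(\<Sum>j\<in>J. \<phi> x j * basis j i) = \<phi> x i"
      using assms coord_closed[of x] by (auto simp: fun_on_def)
  qed
  finally have "\<phi> (\<Oplus>\<^bsub>V\<^esub>j\<in>J. \<phi> x j \<odot>\<^bsub>V\<^esub> point (basis j)) = \<phi> x" .
  from coord_eqD[OF this _ assms(2)] c show ?thesis by (simp add: Pi_def)
qed

end

context rep_coordinates
begin

lemma K_zero: "g \<in> carrier G \<Longrightarrow> K g (\<lambda>_. 0) = (\<lambda>_. 0)"
  using K_smult[of g "\<lambda>_. 0" 0] by simp

lemma K_sum:
  assumes "g \<in> carrier G" "\<And>j. j \<in> I \<Longrightarrow> f j \<in> fun_on J"
  shows "K g (\<lambda>i. \<Sum>j\<in>I. f j i) = (\<lambda>i. \<Sum>j\<in>I. K g (f j) i)"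
  using assms(2)
proof (induction I rule: infinite_finite_induct)
  case (insert j I)
  have "(\<lambda>i. \<Sum>j\<in>I. f j i) \<in> fun_on J"
    using insert.prems by (auto simp: fun_on_def intro!: sum.neutral)
  with insert show ?case using K_add[OF assms(1), of "f j" "\<lambda>i. \<Sum>j\<in>I. f j i"] by simp
qed (simp_all add: K_zero assms(1))

lemma K_expand:
  assumes g: "g \<in> carrier G" and J: "finite J" and p: "p \<in> fun_on J"
  shows "K g p = (\<lambda>i. \<Sum>j\<in>J. p j * K g (basis j) i)"
proof -
  have "(\<lambda>i. \<Sum>j\<in>J. p j * basis j i) = p"
  proof
    fix i
    have "(\<Sum>j\<in>J. p j * basis j i) = (\<Sum>j\<in>J. if i = j then p j else 0)"
      by (rule sum.cong) (auto simp: basis_def)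
    then show "(\<Sum>j\<in>J. p j * basis j i) = p i" using J p by (auto simp: fun_on_def)
  qed
  then have "K g p = K g (\<lambda>i. \<Sum>j\<in>J. p j * basis j i)" by (simp only:)
  also have "\<dots> = (\<lambda>i. \<Sum>j\<in>J. p j * K g (basis j) i)"
    using g by (simp add: K_sum basis_closed K_smult)
  finally show ?thesis .
qed

lemma rep_coordinates_cong:
  assumes "\<And>g p. g \<in> carrier G \<Longrightarrow> p \<in> fun_on J \<Longrightarrow> L g p = K g p"
  shows "rep_coordinates G \<rho> J \<phi> L"
  by unfold_locales
    (simp_all add: assms act_extensional act_closed coord_act coord_closed K_closed K_add K_smult
      K_one K_mult)

end

text \<open>The coordinate of \<open>x \<otimes> y\<close> at \<open>(i, k)\<close> is a product of
  coordinates, and \<open>p\<close> is represented by the sum of the \<open>e j\<close> tensored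
  with the rows of \<open>p\<close>. The operator is a Kronecker product: the first factor enters
  through its matrix entries, the second acts on whole rows.\<close>

lemma tensor_rep_rep_coordinates:
  fixes G (structure) and \<phi> :: "'v \<Rightarrow> 'i \<Rightarrow> 'r::comm_ring_1" and \<phi>' :: "'w \<Rightarrow> 'j \<Rightarrow> 'r"
  assumes "rep_coordinates G \<rho> J \<phi> K" "rep_coordinates G \<rho>' J' \<phi>' K'" and fin: "finite J"
  shows "\<exists>\<psi>. rep_coordinates G (tensor_rep G \<rho> \<rho>') (J \<times> J') \<psi>
    (\<lambda>g p (i, k). \<Sum>j\<in>J. K g (\<lambda>i. if i = j then 1 else 0) i * K' g (\<lambda>l. p (j, l)) k)"
proof -
  interpret r: rep_coordinates G \<rho> J \<phi> K by fact
  interpret r': rep_coordinates G \<rho>' J' \<phi>' K' by fact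
  let ?V = "space \<rho>" and ?W = "space \<rho>'"
  let ?ra = "\<lambda>v r. r \<odot>\<^bsub>?V\<^esub> v" and ?la = "smult ?W"
  interpret V: abelian_group ?V by (rule r.abelian_group)
  interpret W: abelian_group ?W by (rule r'.abelian_group)
  define b where "b = (\<lambda>x y (i, k). \<phi> x i * \<phi>' y k)"
  define e where "e j = r.point (r.basis j)" for j
  define row where "row p j = (\<lambda>k. p (j, k))" for p :: "'i \<times> 'j \<Rightarrow> 'r" and j
  define s where "s p = (\<Sum>j\<in>J. frag_of (e j, r'.point (row p j)))" for p
  have row: "row p j \<in> fun_on J'" if "p \<in> fun_on (J \<times> J')" for p j
    using that by (simp add: row_def fun_on_def)
  have e: "e j \<in> carrier ?V" "\<phi> (e j) = r.basis j" if "j \<in> J" for j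
    using that by (simp_all add: e_def r.point_closed r.basis_closed r.coord_point)
  interpret ts: tensor_setting "UNIV :: 'r set" ?V ?ra ?W ?la
    by unfold_locales (simp_all add: r.add_closed r'.add_closed r.smult_closed r'.smult_closed)
  have b_closed: "b x y \<in> fun_on (J \<times> J')" if "x \<in> carrier ?V" "y \<in> carrier ?W" for x y
    using r.coord_closed[OF that(1)] r'.coord_closed[OF that(2)] by (auto simp: b_def fun_on_def)
  have row_b: "row (b x y) j = (\<lambda>k. \<phi> x j * \<phi>' y k)" for x y j
    by (simp add: row_def b_def)
  have s_add: "s (\<lambda>i. p i + q i) - s p - s q \<in> ts.\<N>"
    if pq: "p \<in> fun_on (J \<times> J')" "q \<in> fun_on (J \<times> J')" for p q
  proof -
    have "row (\<lambda>i. p i + q i) j = (\<lambda>k. row p j k + row q j k)" for j by (simp add: row_def)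
    then have "s (\<lambda>i. p i + q i) - s p - s q = (\<Sum>j\<in>J. frag_of (e j, r'.point (row p j) \<oplus>\<^bsub>?W\<^esub> r'.point (row q j))
        - frag_of (e j, r'.point (row p j)) - frag_of (e j, r'.point (row q j)))"
      by (simp add: s_def sum_subtractf r'.point_add row pq)
    also have "\<dots> \<in> ts.\<N>"
      by (intro ts.null_sum ts.rel_add_right) (simp_all add: e r'.point_closed row pq)
    finally show ?thesis .
  qed
  have sum_left: "(\<Sum>i\<in>I. frag_of (f i, y)) - frag_of (\<Oplus>\<^bsub>?V\<^esub>i\<in>I. f i, y) \<in> ts.\<N>"
    if "finite I" "I \<noteq> {}" "\<And>i. i \<in> I \<Longrightarrow> f i \<in> carrier ?V" and y: "y \<in> carrier ?W" for f :: "'i \<Rightarrow> 'v" and I y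
    using that(1-3)
  proof (induction I rule: finite_ne_induct)
    case (singleton i)
    then show ?case by (simp add: ts.null_zero)
  next
    case (insert i I)
    have c: "f i \<in> carrier ?V" "(\<Oplus>\<^bsub>?V\<^esub>i\<in>I. f i) \<in> carrier ?V"
      using insert by (auto simp: Pi_def)
    from ts.null_diff[OF insert.IH ts.rel_add_left[OF c y]] insert.prems
    show ?case using insert.hyps by (simp add: algebra_simps Pi_def)
  qed
  have s_b: "s (b x y) - frag_of (x, y) \<in> ts.\<N>" if xy: "x \<in> carrier ?V" "y \<in> carrier ?W" for x y
  proof -
    have pt: "r'.point (row (b x y) j) = \<phi> x j \<odot>\<^bsub>?W\<^esub> y" for j
      using r'.point_coord[of "\<phi> x j \<odot>\<^bsub>?W\<^esub> y"] xy
      by (simp add: row_b r'.smult_closed r'.coord_smult)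
    define f where "f j = \<phi> x j \<odot>\<^bsub>?V\<^esub> e j" for j
    have f: "f j \<in> carrier ?V" if "j \<in> J" for j using that by (simp add: f_def e r.smult_closed)
    have "(\<Sum>j\<in>J. frag_of (f j, y) - frag_of (e j, \<phi> x j \<odot>\<^bsub>?W\<^esub> y)) \<in> ts.\<N>"
      unfolding f_def by (intro ts.null_sum ts.rel_balanced) (simp_all add: e xy)
    then have 1: "(\<Sum>j\<in>J. frag_of (f j, y)) - s (b x y) \<in> ts.\<N>"
      by (simp add: s_def pt sum_subtractf)
    have x: "x = (\<Oplus>\<^bsub>?V\<^esub>j\<in>J. f j)"
      unfolding f_def e_def by (rule r.expand[OF fin xy(1)])
    have 2: "(\<Sum>j\<in>J. frag_of (f j, y)) - frag_of (x, y) \<in> ts.\<N>"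
    proof (cases "J = {}")
      \<comment> \<open>Over the empty index set \<open>x\<close> is zero, and
        \<open>0 \<otimes> y\<close> is null by the relation coming from
        \<open>0 + 0 = 0\<close>.\<close>
      case True
      have z: "\<zero>\<^bsub>?V\<^esub> \<in> carrier ?V" by simp
      have "frag_of (\<zero>\<^bsub>?V\<^esub>, y) - frag_of (\<zero>\<^bsub>?V\<^esub>, y) - frag_of (\<zero>\<^bsub>?V\<^esub>, y) \<in> ts.\<N>"
        using ts.rel_add_left[OF z z xy(2)] by simp
      then show ?thesis using True x by simp
    next
      case False
      have "(\<Sum>j\<in>J. frag_of (f j, y)) - frag_of (\<Oplus>\<^bsub>?V\<^esub>j\<in>J. f j, y) \<in> ts.\<N>"
        by (rule sum_left) (use fin False f xy(2) in auto)
      then show ?thesis by (simp only: x[symmetric])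
    qed
    show ?thesis using ts.null_diff[OF 2 1] by simp
  qed
  have tc: "tensor_coordinates (UNIV :: 'r set) ?V ?ra ?W ?la (J \<times> J') b s"
  proof unfold_locales
    fix p :: "'i \<times> 'j \<Rightarrow> 'r" assume p: "p \<in> fun_on (J \<times> J')"
    show "Poly_Mapping.keys (s p) \<subseteq> carrier ?V \<times> carrier ?W"
      unfolding s_def using keys_sum[of "\<lambda>j. frag_of (e j, r'.point (row p j))" J]
      by (auto simp: e r'.point_closed row p)
    show "(\<lambda>i. lin_ext (\<lambda>(x, y). b x y i) (s p)) = p"
    proof
      fix ik :: "'i \<times> 'j"
      obtain i k where ik: "ik = (i, k)" by fastforce
      have "lin_ext (\<lambda>(x, y). b x y (i, k)) (s p) = (\<Sum>j\<in>J. if i = j then p (j, k) else 0)"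
        unfolding s_def lin_ext_sum
        by (rule sum.cong) (auto simp: b_def e r.basis_def r'.coord_point row p, simp add: row_def)
      also have "\<dots> = p (i, k)" using fin p by (auto simp: fun_on_def)
      finally show "lin_ext (\<lambda>(x, y). b x y ik) (s p) = p ik" by (simp add: ik)
    qed
  next
    fix x x' y assume "x \<in> carrier ?V" "x' \<in> carrier ?V" "y \<in> carrier ?W"
    then show "b (x \<oplus>\<^bsub>?V\<^esub> x') y = (\<lambda>i. b x y i + b x' y i)"
      by (auto simp: b_def r.coord_add algebra_simps)
  next
    fix x y y' assume "x \<in> carrier ?V" "y \<in> carrier ?W" "y' \<in> carrier ?W"
    then show "b x (y \<oplus>\<^bsub>?W\<^esub> y') = (\<lambda>i. b x y i + b x y' i)"
      by (auto simp: b_def r'.coord_add algebra_simps)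
  next
    fix x y and a :: 'r assume "x \<in> carrier ?V" "y \<in> carrier ?W"
    then show "b (a \<odot>\<^bsub>?V\<^esub> x) y = b x (a \<odot>\<^bsub>?W\<^esub> y)"
      by (auto simp: b_def r.coord_smult r'.coord_smult algebra_simps)
    show "b x (a \<odot>\<^bsub>?W\<^esub> y) = (\<lambda>i. a * b x y i)"
      using \<open>y \<in> carrier ?W\<close> by (auto simp: b_def r'.coord_smult algebra_simps)
  qed (use b_closed s_add s_b in auto)
  have "rep_coordinates G (tensor_rep G \<rho> \<rho>') (J \<times> J') (tensor_coordinates.coord b)
    (\<lambda>g p (i, k). \<Sum>j\<in>J. K g (r.basis j) i * K' g (row p j) k)"
  proof (rule r.tensor_rep_coordinates[OF tc])
    show "space (tensor_rep G \<rho> \<rho>') = tensor_module UNIV ?V ?ra ?W ?la"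
      and "act (tensor_rep G \<rho> \<rho>') = (\<lambda>g\<in>carrier G. tensor_map UNIV ?V ?ra ?W ?la (act \<rho> g) (act \<rho>' g))"
      by (simp_all add: tensor_rep_def Let_def)
  next
    fix g and p :: "'i \<times> 'j \<Rightarrow> 'r" assume g: "g \<in> carrier G" and p: "p \<in> fun_on (J \<times> J')"
    show "(\<lambda>(i, k). \<Sum>j\<in>J. K g (r.basis j) i * K' g (row p j) k) \<in> fun_on (J \<times> J')"
      using r.K_closed[OF g r.basis_closed] r'.K_closed[OF g row[OF p]]
      by (auto simp: fun_on_def intro!: sum.neutral)
    fix q :: "'i \<times> 'j \<Rightarrow> 'r" assume q: "q \<in> fun_on (J \<times> J')"
    have "row (\<lambda>i. p i + q i) j = (\<lambda>k. row p j k + row q j k)" for j by (simp add: row_def)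
    then show "(\<lambda>(i, k). \<Sum>j\<in>J. K g (r.basis j) i * K' g (row (\<lambda>i. p i + q i) j) k) =
       (\<lambda>i. (case i of (i, k) \<Rightarrow> \<Sum>j\<in>J. K g (r.basis j) i * K' g (row p j) k) +
            (case i of (i, k) \<Rightarrow> \<Sum>j\<in>J. K g (r.basis j) i * K' g (row q j) k))"
      using g by (auto simp: r'.K_add row p q distrib_left sum.distrib)
  next
    fix g x y assume g: "g \<in> carrier G" and xy: "x \<in> carrier ?V" "y \<in> carrier ?W"
    show "b (act \<rho> g x) (act \<rho>' g y) =
        (\<lambda>(i, k). \<Sum>j\<in>J. K g (r.basis j) i * K' g (row (b x y) j) k)"
      unfolding row_b
      using g xy r.K_expand[OF g fin r.coord_closed[OF xy(1)]]
      by (auto simp: b_def r.coord_act r'.coord_act r'.K_smult r'.coord_closed sum_distrib_left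
          sum_distrib_right mult_ac fun_eq_iff)
  qed (simp_all add: r.act_closed r'.act_closed r.act_one r'.act_one r.act_mult r'.act_mult r'.act_smult)
  then show ?thesis unfolding r.basis_def row_def by blast
qed


section \<open>Scaling by one-dimensional representations\<close>

definition unit_char :: "nat \<Rightarrow> 'r::comm_ring_1 \<Rightarrow> wgen word set \<Rightarrow> 'r" where
  "unit_char m r = wB_hom m (units_of class_ring) (\<lambda>g. case g of Sig i \<Rightarrow> r | Tau i \<Rightarrow> 1)"

context
  fixes m :: nat and r r' :: "'r::comm_ring_1"
  assumes unit: "r * r' = 1"
begin

lemma unit_char_relations:
  "welded_relations (units_of class_ring) m (\<lambda>g. case g of Sig i \<Rightarrow> r | Tau i \<Rightarrow> 1)"
proof -
  have "Group.monoid (class_ring :: 'r ring)" by (rule monoidI) (auto simp: mult.assoc)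
  then interpret group "units_of (class_ring :: 'r ring)" by (rule monoid.units_group)
  have "r \<in> Units class_ring" using unit by (auto simp: Units_def mult.commute)
  moreover have "1 \<in> Units (class_ring :: 'r ring)" by (auto simp: Units_def)
  ultimately show ?thesis
    by unfold_locales (auto simp: units_of_def mult_ac)
qed

lemma unit_char_mult:
  assumes "v \<in> carrier (wB m)" "w \<in> carrier (wB m)"
  shows "unit_char m r (v \<otimes>\<^bsub>wB m\<^esub> w) = unit_char m r v * unit_char m r w"
  using hom_mult[OF welded_relations.wB_hom[OF unit_char_relations] assms]
  by (simp add: unit_char_def units_of_def)

lemma unit_char_gen:
  "1 \<le> i \<Longrightarrow> i < m \<Longrightarrow> unit_char m r (wB_class m [Sig i]) = r"
  "1 \<le> i \<Longrightarrow> i < m \<Longrightarrow> unit_char m r (wB_class m [Tau i]) = 1"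
  using welded_relations.wB_hom_gen[OF unit_char_relations, of "Sig i"]
    welded_relations.wB_hom_gen[OF unit_char_relations, of "Tau i"]
  by (simp_all add: unit_char_def Sig_in_gens Tau_in_gens)

lemma unit_char_one: "unit_char m r \<one>\<^bsub>wB m\<^esub> = 1"
proof -
  interpret welded_relations "units_of class_ring" m "\<lambda>g. case g of Sig i \<Rightarrow> r | Tau i \<Rightarrow> 1"
    by (rule unit_char_relations)
  show ?thesis using hom_one[OF wB_hom group_wB is_group] by (simp add: unit_char_def units_of_def)
qed

text \<open>Tensoring with the rank one module keeps the index set: \<open>x \<otimes> y\<close>
  gets the coordinates of the multiple of \<open>y\<close> by \<open>x\<close>, and \<open>p\<close>
  is represented by \<open>1 \<otimes> p\<close>.\<close>

lemma scale_rep_rep_coordinates: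
  fixes \<phi> :: "'v \<Rightarrow> 'i \<Rightarrow> 'r"
  assumes "rep_coordinates (wB m) \<rho> J \<phi> K"
  shows "\<exists>\<psi>. rep_coordinates (wB m) (scale_rep m r \<rho>) J \<psi> (\<lambda>w p i. unit_char m r w * K w p i)"
proof -
  interpret r: rep_coordinates "wB m" \<rho> J \<phi> K by fact
  let ?V = "regular_module :: ('r, 'r) module" and ?W = "space \<rho>"
  let ?ra = "\<lambda>v r. r \<odot>\<^bsub>?V\<^esub> v" and ?la = "smult ?W"
  define b where "b = (\<lambda>x y i. x * \<phi> y i)"
  define s where "s p = frag_of (1 :: 'r, r.point p)" for p
  interpret ts: tensor_setting "UNIV :: 'r set" ?V ?ra ?W ?la
    by unfold_locales (simp_all add: regular_module_def r.add_closed r.smult_closed)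
  have s_b: "s (b x y) - frag_of (x, y) \<in> ts.\<N>" if y: "y \<in> carrier ?W" for x y
  proof -
    have "r.point (b x y) = x \<odot>\<^bsub>?W\<^esub> y"
      using r.point_coord[of "x \<odot>\<^bsub>?W\<^esub> y"] y by (simp add: b_def r.smult_closed r.coord_smult)
    then show ?thesis
      using ts.null_minus[OF ts.rel_balanced[of 1 x y]] y by (simp add: s_def regular_module_def)
  qed
  have tc: "tensor_coordinates (UNIV :: 'r set) ?V ?ra ?W ?la J b s"
  proof unfold_locales
    fix p q :: "'i \<Rightarrow> 'r" assume p: "p \<in> fun_on J" "q \<in> fun_on J"
    then show "s (\<lambda>i. p i + q i) - s p - s q \<in> ts.\<N>"
      using ts.rel_add_right[of 1 "r.point p" "r.point q"]
      by (simp add: s_def r.point_add r.point_closed regular_module_def)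
  next
    fix x y assume "y \<in> carrier ?W"
    then show "s (b x y) - frag_of (x, y) \<in> ts.\<N>" by (rule s_b)
  qed (auto simp: s_def b_def r.coord_closed regular_module_def r.coord_add r.coord_smult r.point_closed
      r.coord_point algebra_simps)
  have "rep_coordinates (wB m) (scale_rep m r \<rho>) J (tensor_coordinates.coord b)
    (\<lambda>w p i. unit_char m r w * K w p i)"
  proof (rule r.tensor_rep_coordinates[OF tc])
    show "space (scale_rep m r \<rho>) = tensor_module UNIV ?V ?ra ?W ?la"
      and "act (scale_rep m r \<rho>) =
        (\<lambda>g\<in>carrier (wB m). tensor_map UNIV ?V ?ra ?W ?la (\<lambda>x. unit_char m r g * x) (act \<rho> g))"
      by (simp_all add: scale_rep_def tensor_rep_def one_dim_rep_def unit_char_def Let_def)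
  next
    fix g and p :: "'i \<Rightarrow> 'r" assume "g \<in> carrier (wB m)" "p \<in> fun_on J"
    then show "(\<lambda>i. unit_char m r g * K g p i) \<in> fun_on J" by (simp add: r.K_closed)
  qed (simp_all add: regular_module_def r.act_closed r.act_one r.act_mult r.act_smult unit_char_one
      unit_char_mult r.K_closed r.K_add b_def r.coord_act r.K_smult r.coord_closed algebra_simps)
  then show ?thesis by blast
qed

end

lemma welded_relationsI:
  fixes H (structure)
  assumes "group H"
    and "\<And>i. 1 \<le> i \<Longrightarrow> i < m \<Longrightarrow> S i \<in> carrier H" "\<And>i. 1 \<le> i \<Longrightarrow> i < m \<Longrightarrow> T i \<in> carrier H"
    and "\<And>i k. 1 \<le> i \<Longrightarrow> i + 2 \<le> k \<Longrightarrow> k < m \<Longrightarrow>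
      S i \<otimes> S k = S k \<otimes> S i \<and> T i \<otimes> T k = T k \<otimes> T i \<and> S i \<otimes> T k = T k \<otimes> S i \<and> S k \<otimes> T i = T i \<otimes> S k"
    and "\<And>i. 1 \<le> i \<Longrightarrow> i + 2 \<le> m \<Longrightarrow>
      S i \<otimes> (S (i+1) \<otimes> S i) = S (i+1) \<otimes> (S i \<otimes> S (i+1)) \<and>
      T i \<otimes> (T (i+1) \<otimes> T i) = T (i+1) \<otimes> (T i \<otimes> T (i+1)) \<and>
      T i \<otimes> (S (i+1) \<otimes> S i) = S (i+1) \<otimes> (S i \<otimes> T (i+1)) \<and>
      S i \<otimes> (T (i+1) \<otimes> T i) = T (i+1) \<otimes> (T i \<otimes> S (i+1))"
    and "\<And>i. 1 \<le> i \<Longrightarrow> i < m \<Longrightarrow> T i \<otimes> T i = \<one>"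
  shows "welded_relations H m (\<lambda>g. case g of Sig i \<Rightarrow> S i | Tau i \<Rightarrow> T i)"
  unfolding welded_relations_def welded_relations_axioms_def wgen.case using assms by blast


section \<open>The Artin action and the shift\<close>

lemma group_free_group: "group (free_group n)"
  by (simp add: free_group_def group_presented_group)

lemma free_gen_carrier: "i \<in> {1..n} \<Longrightarrow> free_gen n i \<in> carrier (free_group n)"
  unfolding free_gen_def free_group_def by (rule word_class_carrier) auto

lemma free_group_induct [consumes 1, case_names one gen inv_gen]:
  assumes "W \<in> carrier (free_group n)" "P \<one>\<^bsub>free_group n\<^esub>"
    and "\<And>i W. i \<in> {1..n} \<Longrightarrow> W \<in> carrier (free_group n) \<Longrightarrow> P W \<Longrightarrow>
      P (free_gen n i \<otimes>\<^bsub>free_group n\<^esub> W)"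
    and "\<And>i W. i \<in> {1..n} \<Longrightarrow> W \<in> carrier (free_group n) \<Longrightarrow> P W \<Longrightarrow>
      P (inv\<^bsub>free_group n\<^esub> free_gen n i \<otimes>\<^bsub>free_group n\<^esub> W)"
  shows "P W"
  using presented_group_induct[of W "{1..n}" "{}" P] assms
  by (simp add: free_group_def free_gen_def)

lemma (in group) free_hom_hom:
  "(\<And>i. i \<in> {1..n} \<Longrightarrow> f i \<in> carrier G) \<Longrightarrow> free_hom n G f \<in> hom (free_group n) G"
  unfolding free_hom_def free_group_def by (rule presented_hom_hom) auto

lemma (in group) free_hom_gen:
  "(\<And>i. i \<in> {1..n} \<Longrightarrow> f i \<in> carrier G) \<Longrightarrow> i \<in> {1..n} \<Longrightarrow>
   free_hom n G f (free_gen n i) = f i"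
  unfolding free_hom_def free_gen_def by (rule presented_hom_gen) auto

lemma free_hom_unique:
  assumes "group G" "h \<in> hom (free_group n) G" "h' \<in> hom (free_group n) G"
    and "\<And>i. i \<in> {1..n} \<Longrightarrow> h (free_gen n i) = h' (free_gen n i)" "W \<in> carrier (free_group n)"
  shows "h W = h' W"
  using presented_hom_unique[of G h "{1..n}" "{}" h' W] assms
  by (simp add: free_group_def free_gen_def)

definition sig_aut :: "nat \<Rightarrow> nat \<Rightarrow> nat word set \<Rightarrow> nat word set" where
  "sig_aut n i = free_hom n (free_group n)
     (\<lambda>j. if j = i then free_gen n (i+1)
          else if j = i+1 then
            inv\<^bsub>free_group n\<^esub> (free_gen n (i+1)) \<otimes>\<^bsub>free_group n\<^esub> free_gen n i
              \<otimes>\<^bsub>free_group n\<^esub> free_gen n (i+1)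
          else free_gen n j)"

definition tau_aut :: "nat \<Rightarrow> nat \<Rightarrow> nat word set \<Rightarrow> nat word set" where
  "tau_aut n i = free_hom n (free_group n)
     (\<lambda>j. if j = i then free_gen n (i+1) else if j = i+1 then free_gen n i else free_gen n j)"

context
  fixes n :: nat
begin

interpretation F: group "free_group n" by (rule group_free_group)

private abbreviation "F \<equiv> free_group n"
private abbreviation "x \<equiv> free_gen n"

lemma sig_aut_hom: "1 \<le> i \<Longrightarrow> i < n \<Longrightarrow> sig_aut n i \<in> hom F F"
  unfolding sig_aut_def by (rule F.free_hom_hom) (auto simp: free_gen_carrier)

lemma tau_aut_hom: "1 \<le> i \<Longrightarrow> i < n \<Longrightarrow> tau_aut n i \<in> hom F F"
  unfolding tau_aut_def by (rule F.free_hom_hom) (auto simp: free_gen_carrier)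

lemma sig_aut_gen:
  assumes "1 \<le> i" "i < n" "j \<in> {1..n}"
  shows "sig_aut n i (x j) = (if j = i then x (i+1)
    else if j = i+1 then inv\<^bsub>F\<^esub> x (i+1) \<otimes>\<^bsub>F\<^esub> x i \<otimes>\<^bsub>F\<^esub> x (i+1) else x j)"
  unfolding sig_aut_def by (subst F.free_hom_gen) (use assms in \<open>auto simp: free_gen_carrier\<close>)

lemma tau_aut_gen:
  assumes "1 \<le> i" "i < n" "j \<in> {1..n}"
  shows "tau_aut n i (x j) = (if j = i then x (i+1) else if j = i+1 then x i else x j)"
  unfolding tau_aut_def by (subst F.free_hom_gen) (use assms in \<open>auto simp: free_gen_carrier\<close>)

text \<open>A two-sided inverse among the endomorphisms suffices, and by freeness the two composites
  need only be compared with the identity on generators.\<close>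

lemma autoI:
  assumes h: "h \<in> hom F F" and k: "k \<in> hom F F" and ext: "h \<in> extensional (carrier F)"
    and hk: "\<And>j. j \<in> {1..n} \<Longrightarrow> h (k (x j)) = x j" and kh: "\<And>j. j \<in> {1..n} \<Longrightarrow> k (h (x j)) = x j"
  shows "h \<in> auto F"
proof -
  have id: "(\<lambda>W. W) \<in> hom F F" by (simp add: hom_def)
  have "(\<lambda>W. h (k W)) \<in> hom F F" "(\<lambda>W. k (h W)) \<in> hom F F"
    using h k by (auto simp: hom_def Pi_def)
  then have "h (k W) = W" "k (h W) = W" if "W \<in> carrier F" for W
    using free_hom_unique[OF group_free_group _ id _ that, of "\<lambda>W. h (k W)"]
      free_hom_unique[OF group_free_group _ id _ that, of "\<lambda>W. k (h W)"] hk kh by simp_all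
  then have "bij_betw h (carrier F) (carrier F)"
    using h k by (intro bij_betw_byWitness[where f' = k]) (auto simp: hom_def)
  then show ?thesis using h ext by (simp add: auto_def Bij_def)
qed

lemma auto_eqI:
  assumes "h \<in> auto F" "k \<in> auto F" "\<And>j. j \<in> {1..n} \<Longrightarrow> h (x j) = k (x j)"
  shows "h = k"
proof (rule extensionalityI)
  show "h \<in> extensional (carrier F)" "k \<in> extensional (carrier F)"
    using assms by (auto simp: auto_def Bij_def)
  show "h W = k W" if "W \<in> carrier F" for W
    using free_hom_unique[OF group_free_group, where h = h and h' = k and n = n and W = W] that assms by (auto simp: auto_def)
qed

lemma hom_eval:
  assumes "h \<in> hom F F"
  shows "a \<in> carrier F \<Longrightarrow> h a \<in> carrier F"
    and "a \<in> carrier F \<Longrightarrow> b \<in> carrier F \<Longrightarrow> h (a \<otimes>\<^bsub>F\<^esub> b) = h a \<otimes>\<^bsub>F\<^esub> h b"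
    and "a \<in> carrier F \<Longrightarrow> h (inv\<^bsub>F\<^esub> a) = inv\<^bsub>F\<^esub> (h a)"
proof -
  interpret h: group_hom F F h
    using assms group_free_group by (simp add: group_hom_def group_hom_axioms_def)
  show "a \<in> carrier F \<Longrightarrow> h a \<in> carrier F"
    and "a \<in> carrier F \<Longrightarrow> b \<in> carrier F \<Longrightarrow> h (a \<otimes>\<^bsub>F\<^esub> b) = h a \<otimes>\<^bsub>F\<^esub> h b"
    and "a \<in> carrier F \<Longrightarrow> h (inv\<^bsub>F\<^esub> a) = inv\<^bsub>F\<^esub> (h a)" by simp_all
qed

lemma cancel_inv:
  assumes "a \<in> carrier F" "b \<in> carrier F"
  shows "a \<otimes>\<^bsub>F\<^esub> (inv\<^bsub>F\<^esub> a \<otimes>\<^bsub>F\<^esub> b) = b" "inv\<^bsub>F\<^esub> a \<otimes>\<^bsub>F\<^esub> (a \<otimes>\<^bsub>F\<^esub> b) = b"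
  using assms by (simp_all flip: F.m_assoc)

lemma sig_aut_auto:
  assumes i: "1 \<le> i" "i < n" shows "sig_aut n i \<in> auto F"
proof -
  \<comment> \<open>The inverse must send \<open>x_(i+1)\<close> to \<open>x_i\<close>. Applied to
    \<open>x_(i+1)^-1 x_i x_(i+1)\<close> it must give \<open>x_(i+1)\<close>, which forces
    \<open>x_i \<mapsto> x_i x_(i+1) x_i^-1\<close>.\<close>
  define k where "k = free_hom n F (\<lambda>j. if j = i then x i \<otimes>\<^bsub>F\<^esub> x (i+1) \<otimes>\<^bsub>F\<^esub> inv\<^bsub>F\<^esub> x i
    else if j = i+1 then x i else x j)"
  have k: "k \<in> hom F F"
    unfolding k_def by (rule F.free_hom_hom) (use i in \<open>auto simp: free_gen_carrier\<close>)
  have k_gen: "k (x j) = (if j = i then x i \<otimes>\<^bsub>F\<^esub> x (i+1) \<otimes>\<^bsub>F\<^esub> inv\<^bsub>F\<^esub> x i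
    else if j = i+1 then x i else x j)" if "j \<in> {1..n}" for j
    unfolding k_def by (subst F.free_hom_gen) (use i that in \<open>auto simp: free_gen_carrier\<close>)
  note s = sig_aut_hom[OF i]
  have c: "x i \<in> carrier F" "x (Suc i) \<in> carrier F" using i by (auto simp: free_gen_carrier)
  show ?thesis
  proof (rule autoI[OF s k])
    show "sig_aut n i \<in> extensional (carrier F)"
      by (simp add: sig_aut_def free_hom_def presented_hom_def free_group_def)
    fix j assume j: "j \<in> {1..n}"
    show "sig_aut n i (k (x j)) = x j" "k (sig_aut n i (x j)) = x j"
      using i j c by (auto simp: k_gen sig_aut_gen hom_eval[OF s] hom_eval[OF k] F.m_assoc cancel_inv
          free_gen_carrier)
  qed
qed

lemma tau_aut_auto:
  assumes i: "1 \<le> i" "i < n" shows "tau_aut n i \<in> auto F"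
proof (rule autoI[OF tau_aut_hom[OF i] tau_aut_hom[OF i]])
  show "tau_aut n i \<in> extensional (carrier F)"
    by (simp add: tau_aut_def free_hom_def presented_hom_def free_group_def)
qed (use i in \<open>auto simp: tau_aut_gen\<close>)

lemma AutoGroup_mult:
  assumes "f \<in> auto F" "g \<in> auto F"
  shows "f \<otimes>\<^bsub>AutoGroup F\<^esub> g \<in> auto F"
    and "W \<in> carrier F \<Longrightarrow> (f \<otimes>\<^bsub>AutoGroup F\<^esub> g) W = f (g W)"
proof -
  interpret A: group "AutoGroup F" by (rule F.AutoGroup)
  show "f \<otimes>\<^bsub>AutoGroup F\<^esub> g \<in> auto F"
    using A.m_closed[of f g] assms by (simp add: AutoGroup_def)
  show "W \<in> carrier F \<Longrightarrow> (f \<otimes>\<^bsub>AutoGroup F\<^esub> g) W = f (g W)"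
    using assms by (simp add: AutoGroup_def BijGroup_def auto_def compose_eq)
qed

text \<open>By \<open>auto_eqI\<close> automorphisms are compared on generators, so each relation
  becomes an equality of short words, settled by \<open>cancel_inv\<close>. Products are composites,
  with the right factor applied first.\<close>

lemma artin_relations:
  "welded_relations (AutoGroup F) n (\<lambda>g. case g of Sig i \<Rightarrow> sig_aut n i | Tau i \<Rightarrow> tau_aut n i)"
proof -
  interpret A: group "AutoGroup F" by (rule F.AutoGroup)
  have carrier: "carrier (AutoGroup F) = auto F" by (simp add: AutoGroup_def)
  have hom: "h \<in> hom F F" if "h \<in> auto F" for h using that by (simp add: auto_def)
  note ev = AutoGroup_mult sig_aut_auto tau_aut_auto free_gen_carrier sig_aut_gen tau_aut_gen
    hom_eval[OF hom] F.m_assoc cancel_inv F.inv_mult_group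
  show ?thesis
  proof (rule welded_relationsI, goal_cases)
    case 1
    show ?case by (rule F.AutoGroup)
  next
    case (2 i)
    then show ?case by (simp add: carrier sig_aut_auto)
  next
    case (3 i)
    then show ?case by (simp add: carrier tau_aut_auto)
  next
    case ik: (4 i k)
    then have "1 \<le> i" "i < n" "1 \<le> k" "k < n" by auto
    note aut = sig_aut_auto[OF this(1,2)] sig_aut_auto[OF this(3,4)]
      tau_aut_auto[OF this(1,2)] tau_aut_auto[OF this(3,4)]
    have comm: "f \<otimes>\<^bsub>AutoGroup F\<^esub> g = g \<otimes>\<^bsub>AutoGroup F\<^esub> f"
      if "f \<in> auto F" "g \<in> auto F" "\<And>j. j \<in> {1..n} \<Longrightarrow> f (g (x j)) = g (f (x j))" for f g
      using that by (intro auto_eqI) (auto simp: AutoGroup_mult free_gen_carrier)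
    show ?case by (intro conjI comm aut; use ik in \<open>auto simp: ev\<close>)
  next
    case i: (5 i)
    then have "1 \<le> i" "i < n" "1 \<le> i + 1" "i + 1 < n" by auto
    note aut = sig_aut_auto[OF this(1,2)] sig_aut_auto[OF this(3,4)]
      tau_aut_auto[OF this(1,2)] tau_aut_auto[OF this(3,4)]
    have braid: "f \<otimes>\<^bsub>AutoGroup F\<^esub> (g \<otimes>\<^bsub>AutoGroup F\<^esub> h) = f' \<otimes>\<^bsub>AutoGroup F\<^esub> (g' \<otimes>\<^bsub>AutoGroup F\<^esub> h')"
      if "f \<in> auto F" "g \<in> auto F" "h \<in> auto F" "f' \<in> auto F" "g' \<in> auto F" "h' \<in> auto F"
        "\<And>j. j \<in> {1..n} \<Longrightarrow> f (g (h (x j))) = f' (g' (h' (x j)))" for f g h f' g' h'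
      using that by (intro auto_eqI) (auto simp: AutoGroup_mult free_gen_carrier hom_eval[OF hom])
    show ?case by (intro conjI braid aut; use i in \<open>auto simp: ev\<close>)
  next
    case i: (6 i)
    have one: "\<one>\<^bsub>AutoGroup F\<^esub> \<in> auto F" using A.one_closed by (simp add: carrier)
    have "\<one>\<^bsub>AutoGroup F\<^esub> W = W" if "W \<in> carrier F" for W
      using that by (simp add: AutoGroup_def BijGroup_def)
    then show ?case using i one by (intro auto_eqI) (auto simp: ev)
  qed
qed

lemma artin_eq:
  "artin n = wB_hom n (AutoGroup F) (\<lambda>g. case g of Sig i \<Rightarrow> sig_aut n i | Tau i \<Rightarrow> tau_aut n i)"
  unfolding artin_def sig_aut_def tau_aut_def ..

lemma artin_hom: "artin n \<in> hom (wB n) (AutoGroup F)"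
  unfolding artin_eq by (rule welded_relations.wB_hom[OF artin_relations])

lemma artin_Sig: "1 \<le> i \<Longrightarrow> i < n \<Longrightarrow> artin n (wB_class n [Sig i]) = sig_aut n i"
  and artin_Tau: "1 \<le> i \<Longrightarrow> i < n \<Longrightarrow> artin n (wB_class n [Tau i]) = tau_aut n i"
  unfolding artin_eq
  by (simp_all add: welded_relations.wB_hom_gen[OF artin_relations] Sig_in_gens Tau_in_gens)

lemma artin_auto: "w \<in> carrier (wB n) \<Longrightarrow> artin n w \<in> auto F"
  using hom_in_carrier[OF artin_hom] by (simp add: AutoGroup_def)

lemma artin_is_hom: "w \<in> carrier (wB n) \<Longrightarrow> artin n w \<in> hom F F"
  using artin_auto by (simp add: auto_def)

lemma artin_mult:
  "v \<in> carrier (wB n) \<Longrightarrow> w \<in> carrier (wB n) \<Longrightarrow> W \<in> carrier F \<Longrightarrow>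
   artin n (v \<otimes>\<^bsub>wB n\<^esub> w) W = artin n v (artin n w W)"
  by (simp add: hom_mult[OF artin_hom] AutoGroup_mult artin_auto)

lemma artin_one: "W \<in> carrier F \<Longrightarrow> artin n \<one>\<^bsub>wB n\<^esub> W = W"
  using hom_one[OF artin_hom group_wB F.AutoGroup] by (simp add: AutoGroup_def BijGroup_def)

text \<open>Raising all indices by one turns each relation of \<open>wB n\<close> into one of the
  relations of \<open>wB (n+1)\<close>.\<close>

lemma shift_relations:
  "welded_relations (wB (n+1)) n
    (\<lambda>g. case g of Sig i \<Rightarrow> wB_class (n+1) [Sig (i+1)] | Tau i \<Rightarrow> wB_class (n+1) [Tau (i+1)])"
proof -
  interpret group "wB (n+1)" by (rule group_wB)
  let ?c = "wB_class (n+1)" and ?G = "wB (n+1)"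
  have S: "?c [g] \<otimes>\<^bsub>?G\<^esub> ?c [h] = ?c [g, h]"
    if "g \<in> wB_gens (n+1)" "h \<in> wB_gens (n+1)" for g h
    using wB_class_Cons[of g "n+1" "[h]"] that by simp
  have S3: "?c [g] \<otimes>\<^bsub>?G\<^esub> ?c [h, k] = ?c [g, h, k]"
    if "g \<in> wB_gens (n+1)" "h \<in> wB_gens (n+1)" "k \<in> wB_gens (n+1)" for g h k
    using wB_class_Cons[of g "n+1" "[h, k]"] that by simp
  show ?thesis
  proof (rule welded_relationsI, goal_cases)
    case ik: (4 i k)
    have g: "Sig (i+1) \<in> wB_gens (n+1)" "Sig (k+1) \<in> wB_gens (n+1)"
      "Tau (i+1) \<in> wB_gens (n+1)" "Tau (k+1) \<in> wB_gens (n+1)"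
      using ik by (auto simp: wB_gens_def)
    have rel: "(pos_word [Sig a, Sig b], pos_word [Sig b, Sig a]) \<in> wB_rels (n+1)"
      "(pos_word [Tau a, Tau b], pos_word [Tau b, Tau a]) \<in> wB_rels (n+1)"
      "(pos_word [Sig a, Tau b], pos_word [Tau b, Sig a]) \<in> wB_rels (n+1)"
      if "a \<in> {1..<n+1}" "b \<in> {1..<n+1}" "\<bar>int a - int b\<bar> \<ge> 2" for a b
      unfolding wB_rels_def using that by blast+
    have ab: "i+1 \<in> {1..<n+1}" "k+1 \<in> {1..<n+1}" "\<bar>int (i+1) - int (k+1)\<bar> \<ge> 2"
      "\<bar>int (k+1) - int (i+1)\<bar> \<ge> 2" using ik by auto
    show ?case
      unfolding S[OF g(1) g(2)] S[OF g(2) g(1)] S[OF g(3) g(4)] S[OF g(4) g(3)]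
        S[OF g(1) g(4)] S[OF g(4) g(1)] S[OF g(2) g(3)] S[OF g(3) g(2)]
      by (intro conjI wB_class_rel rel[OF ab(1,2,3)] rel[OF ab(2,1,4)]) (use g in auto)
  next
    case i: (5 i)
    have g: "Sig (i+1) \<in> wB_gens (n+1)" "Sig (i+1+1) \<in> wB_gens (n+1)"
      "Tau (i+1) \<in> wB_gens (n+1)" "Tau (i+1+1) \<in> wB_gens (n+1)"
      using i by (auto simp: wB_gens_def)
    have mem: "i+1 \<in> {i. 1 \<le> i \<and> i + 2 \<le> n+1}" using i by simp
    have rel: "(pos_word [Sig a, Sig (a+1), Sig a], pos_word [Sig (a+1), Sig a, Sig (a+1)]) \<in> wB_rels (n+1)"
      "(pos_word [Tau a, Tau (a+1), Tau a], pos_word [Tau (a+1), Tau a, Tau (a+1)]) \<in> wB_rels (n+1)"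
      "(pos_word [Tau a, Sig (a+1), Sig a], pos_word [Sig (a+1), Sig a, Tau (a+1)]) \<in> wB_rels (n+1)"
      "(pos_word [Sig a, Tau (a+1), Tau a], pos_word [Tau (a+1), Tau a, Sig (a+1)]) \<in> wB_rels (n+1)"
      if "a \<in> {i. 1 \<le> i \<and> i + 2 \<le> n+1}" for a
      unfolding wB_rels_def using that by blast+
    show ?case
      by (simp only: S S3 g, intro conjI wB_class_rel rel[OF mem]) (use g in auto)
  next
    case i: (6 i)
    have g: "Tau (i+1) \<in> wB_gens (n+1)" using i by (auto simp: wB_gens_def)
    have "(pos_word [Tau (i+1), Tau (i+1)], pos_word []) \<in> wB_rels (n+1)"
      unfolding wB_rels_def using i by fastforce
    from wB_class_rel[OF this] show ?case
      using S[OF g g] g by (simp add: wB_class_Nil)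
  next
    case 1
    show ?case by (rule group_wB)
  qed (auto intro!: wB_class_carrier simp: wB_gens_def)
qed

lemma shift_hom: "wB_shift n \<in> hom (wB n) (wB (n+1))"
  unfolding wB_shift_def by (rule welded_relations.wB_hom[OF shift_relations])

lemma shift_Sig: "1 \<le> i \<Longrightarrow> i < n \<Longrightarrow> wB_shift n (wB_class n [Sig i]) = wB_class (n+1) [Sig (i+1)]"
  and shift_Tau: "1 \<le> i \<Longrightarrow> i < n \<Longrightarrow> wB_shift n (wB_class n [Tau i]) = wB_class (n+1) [Tau (i+1)]"
  unfolding wB_shift_def
  using welded_relations.wB_hom_gen[OF shift_relations, of "Sig i"]
    welded_relations.wB_hom_gen[OF shift_relations, of "Tau i"]
  by (simp_all add: Sig_in_gens Tau_in_gens)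

section \<open>The images of the free generators under \<open>xi\<close>\<close>

private abbreviation "Tword i \<equiv> wB_class (n+1) (map Tau (rev [1..<i]))"

lemma Tword_carrier: "i \<le> n + 1 \<Longrightarrow> Tword i \<in> carrier (wB (n+1))"
  by (rule wB_class_carrier) (auto simp: wB_gens_def)

lemma SigTau_carrier: "i \<in> {1..n} \<Longrightarrow> wB_class (n+1) [Sig i, Tau i] \<in> carrier (wB (n+1))"
  by (rule wB_class_carrier) (auto simp: wB_gens_def)

lemma xi_hom: "xi n \<in> hom F (wB (n+1))"
  and xi_gen: "i \<in> {1..n} \<Longrightarrow> xi n (x i) =
    inv\<^bsub>wB (n+1)\<^esub> Tword i \<otimes>\<^bsub>wB (n+1)\<^esub> wB_class (n+1) [Sig i, Tau i] \<otimes>\<^bsub>wB (n+1)\<^esub> Tword i"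
proof -
  interpret group "wB (n+1)" by (rule group_wB)
  let ?f = "\<lambda>i. let T = Tword i in
        inv\<^bsub>wB (n+1)\<^esub> T \<otimes>\<^bsub>wB (n+1)\<^esub> wB_class (n+1) [Sig i, Tau i] \<otimes>\<^bsub>wB (n+1)\<^esub> T"
  have c: "?f i \<in> carrier (wB (n+1))" if "i \<in> {1..n}" for i
    unfolding Let_def
    by (intro m_closed inv_closed Tword_carrier SigTau_carrier that) (use that in auto)
  show "xi n \<in> hom F (wB (n+1))"
    unfolding xi_def by (rule free_hom_hom[OF c])
  show "xi n (x i) =
    inv\<^bsub>wB (n+1)\<^esub> Tword i \<otimes>\<^bsub>wB (n+1)\<^esub> wB_class (n+1) [Sig i, Tau i] \<otimes>\<^bsub>wB (n+1)\<^esub> Tword i"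
    if "i \<in> {1..n}"
    unfolding xi_def by (subst free_hom_gen[OF c]) (use that in \<open>simp_all add: Let_def\<close>)
qed

end

text \<open>Keeps \<open>{1..n}\<close> and \<open>n + 1\<close> in the form in which the definitions are stated.\<close>

declare One_nat_def [simp del]

section \<open>The group ring and its augmentation ideal\<close>

lemma lin_ext_const: "lin_ext (\<lambda>_. c) a = of_int (augmentation a) * (c :: 'r::comm_ring_1)"
  by (simp add: lin_ext_def augmentation_def sum_distrib_right)

lemma augmentation_eq: "augmentation a = lin_ext (\<lambda>_. 1) a"
  by (simp add: lin_ext_const)

lemma group_ring_carrier: "a \<in> carrier (group_ring G) \<longleftrightarrow> Poly_Mapping.keys a \<subseteq> carrier G"
  by (simp add: group_ring_def)

lemma lin_ext_group_ring_mult: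
  "lin_ext f (a \<otimes>\<^bsub>group_ring G\<^esub> c) = lin_ext (\<lambda>g. lin_ext (\<lambda>h. f (g \<otimes>\<^bsub>G\<^esub> h)) c) a"
  by (simp add: group_ring_def lin_ext_frag_extend)

lemma keys_frag_extend_subset:
  "(\<And>x. x \<in> Poly_Mapping.keys c \<Longrightarrow> Poly_Mapping.keys (f x) \<subseteq> S) \<Longrightarrow>
   Poly_Mapping.keys (frag_extend f c) \<subseteq> S"
  using keys_frag_extend[of f c] by blast

lemma (in group) group_ring_mult_closed:
  assumes "a \<in> carrier (group_ring G)" "c \<in> carrier (group_ring G)"
  shows "a \<otimes>\<^bsub>group_ring G\<^esub> c \<in> carrier (group_ring G)"
proof -
  have "Poly_Mapping.keys (frag_extend (\<lambda>g. frag_extend (\<lambda>h. frag_of (g \<otimes> h)) c) a) \<subseteq> carrier G"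
    using assms unfolding group_ring_carrier
    by (intro keys_frag_extend_subset) (simp add: subset_iff)
  then show ?thesis unfolding group_ring_carrier by (simp add: group_ring_def)
qed

lemma (in group) augmentation_ideal_mult_closed:
  assumes "a \<in> augmentation_ideal G" "c \<in> carrier (group_ring G)"
  shows "a \<otimes>\<^bsub>group_ring G\<^esub> c \<in> augmentation_ideal G"
proof -
  have "augmentation (a \<otimes>\<^bsub>group_ring G\<^esub> c) = augmentation a * augmentation c"
    unfolding augmentation_eq[of "a \<otimes>\<^bsub>group_ring G\<^esub> c"]
    by (subst lin_ext_group_ring_mult) (simp add: lin_ext_const)
  then show ?thesis using assms group_ring_mult_closed by (simp add: augmentation_ideal_def)
qed

lemma augmentation_ideal_add_closed:
  "a \<in> augmentation_ideal G \<Longrightarrow> c \<in> augmentation_ideal G \<Longrightarrow> a + c \<in> augmentation_ideal G"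
  using keys_add[of a c]
  by (auto simp: augmentation_ideal_def group_ring_carrier augmentation_eq lin_ext_add)

lemma augmentation_ideal_diff_closed:
  "a \<in> augmentation_ideal G \<Longrightarrow> c \<in> augmentation_ideal G \<Longrightarrow> a - c \<in> augmentation_ideal G"
  using keys_diff[of a c]
  by (auto simp: augmentation_ideal_def group_ring_carrier augmentation_eq lin_ext_diff)

lemma (in group) augmentation_ideal_gen:
  "g \<in> carrier G \<Longrightarrow> frag_of g - frag_of \<one> \<in> augmentation_ideal G"
  using keys_diff[of "frag_of g" "frag_of \<one>"]
  by (auto simp: augmentation_ideal_def group_ring_carrier augmentation_eq lin_ext_diff)

text \<open>The ideal is generated as an additive group by the \<open>g - 1\<close>. The projection
  \<open>\<pi>\<close> of the group ring onto it sends \<open>g\<close> to \<open>g - 1\<close> and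
  fixes the ideal, so \<open>frag_induction\<close> can be run on \<open>\<pi> a\<close>.\<close>

lemma (in group) augmentation_ideal_induct [consumes 1, case_names gen diff]:
  assumes a: "a \<in> augmentation_ideal G"
    and gen: "\<And>g. g \<in> carrier G \<Longrightarrow> P (frag_of g - frag_of \<one>)"
    and diff: "\<And>a c. a \<in> augmentation_ideal G \<Longrightarrow> c \<in> augmentation_ideal G \<Longrightarrow> P a \<Longrightarrow> P c \<Longrightarrow> P (a - c)"
  shows "P a"
proof -
  define \<pi> where "\<pi> c = c - frag_cmul (augmentation c) (frag_of \<one>)" for c
  have "Poly_Mapping.keys a \<subseteq> carrier G" using a by (simp add: augmentation_ideal_def group_ring_carrier)
  then have "\<pi> a \<in> augmentation_ideal G \<and> P (\<pi> a)"
  proof (induction a rule: frag_induction)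
    case zero
    have "\<pi> 0 = frag_of \<one> - frag_of \<one>" by (simp add: \<pi>_def augmentation_def)
    then show ?case using gen[OF one_closed] augmentation_ideal_gen[OF one_closed] by simp
  next
    case (one g)
    then show ?case using gen augmentation_ideal_gen by (simp add: \<pi>_def augmentation_eq)
  next
    case (diff a c)
    have "\<pi> (a - c) = \<pi> a - \<pi> c"
      by (simp add: \<pi>_def augmentation_eq lin_ext_diff frag_cmul_diff_distrib)
    then show ?case
      using diff.IH assms(3)[of "\<pi> a" "\<pi> c"] augmentation_ideal_diff_closed[of "\<pi> a" G "\<pi> c"] by auto
  qed
  moreover have "\<pi> a = a" using a by (simp add: \<pi>_def augmentation_ideal_def)
  ultimately show ?thesis by simp
qed


section \<open>The Long-Moody construction in coordinates\<close>

text \<open>An equivalence as induction step also handles inverse letters: taken at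
  \<open>x_j^-1 W\<close> it relates \<open>W\<close> to \<open>x_j^-1 W\<close>.\<close>

lemma free_group_step_induct:
  assumes W: "W \<in> carrier (free_group n)" and one: "P \<one>\<^bsub>free_group n\<^esub>"
    and step: "\<And>j W. j \<in> {1..n} \<Longrightarrow> W \<in> carrier (free_group n) \<Longrightarrow>
      P (free_gen n j \<otimes>\<^bsub>free_group n\<^esub> W) \<longleftrightarrow> P W"
  shows "P W"
proof -
  interpret group "free_group n" by (rule group_free_group)
  show ?thesis using W
  proof (induction rule: free_group_induct)
    case (inv_gen j W)
    have "P (free_gen n j \<otimes>\<^bsub>free_group n\<^esub> (inv\<^bsub>free_group n\<^esub> free_gen n j \<otimes>\<^bsub>free_group n\<^esub> W))"
      using inv_gen free_gen_carrier[of j n] by (simp flip: m_assoc)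
    then show ?case using step inv_gen free_gen_carrier[of j n] by simp
  qed (use one step in auto)
qed

text \<open>The right module \<open>augmentation_ideal (free_group n)\<close> is free on the elements \<open>x\<^sub>j - 1\<close>. For a
  word \<open>w\<close> and a vector \<open>p\<close>, \<open>fox w p (j, -)\<close> is the coefficient of \<open>(w - 1) \<otimes> p\<close> at \<open>x\<^sub>j - 1\<close>; the
  recursion comes from \<open>x w - 1 = (x - 1) w + (w - 1)\<close> and
  \<open>x\<inverse> w - 1 = - (x - 1) x\<inverse> w + (w - 1)\<close>.\<close>

locale long_moody = rep_coordinates "wB (n + 1)" \<rho> J \<phi> K
  for n and \<rho> :: "(wgen word set, 'r::comm_ring_1, 'v) rep" and J :: "'i set" and \<phi> K +
  assumes compatible: "\<And>w W p. w \<in> carrier (wB n) \<Longrightarrow> W \<in> carrier (free_group n) \<Longrightarrow> p \<in> fun_on J \<Longrightarrow>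
    K (wB_shift n w) (K (xi n W) p) = K (xi n (artin n w W)) (K (wB_shift n w) p)"
begin

abbreviation "F \<equiv> free_group n"
abbreviation "x \<equiv> free_gen n"
abbreviation "cl \<equiv> word_class {1..n} {}"
abbreviation "words \<equiv> lists ({1..n} \<times> (UNIV :: bool set))"

sublocale F: group F by (rule group_free_group)

definition L :: "nat word set \<Rightarrow> ('i \<Rightarrow> 'r) \<Rightarrow> 'i \<Rightarrow> 'r" where "L W = K (xi n W)"

lemma xi_closed: "W \<in> carrier F \<Longrightarrow> xi n W \<in> carrier (wB (n+1))"
  using hom_in_carrier[OF xi_hom] .

lemma L_closed: "W \<in> carrier F \<Longrightarrow> p \<in> fun_on J \<Longrightarrow> L W p \<in> fun_on J"
  using K_closed xi_closed by (simp add: L_def)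

lemma L_add: "W \<in> carrier F \<Longrightarrow> p \<in> fun_on J \<Longrightarrow> q \<in> fun_on J \<Longrightarrow>
    L W (\<lambda>i. p i + q i) = (\<lambda>i. L W p i + L W q i)"
  using K_add xi_closed by (simp add: L_def)

lemma L_smult: "W \<in> carrier F \<Longrightarrow> p \<in> fun_on J \<Longrightarrow> L W (\<lambda>i. r * p i) = (\<lambda>i. r * L W p i)"
  using K_smult xi_closed by (simp add: L_def)

lemma L_one: "p \<in> fun_on J \<Longrightarrow> L \<one>\<^bsub>F\<^esub> p = p"
  using K_one by (simp add: L_def hom_one[OF xi_hom group_free_group group_wB, simplified])

lemma L_mult: "U \<in> carrier F \<Longrightarrow> W \<in> carrier F \<Longrightarrow> p \<in> fun_on J \<Longrightarrow> L (U \<otimes>\<^bsub>F\<^esub> W) p = L U (L W p)"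
  using K_mult xi_closed by (simp add: L_def hom_mult[OF xi_hom, simplified])

lemma cl_closed: "w \<in> words \<Longrightarrow> cl w \<in> carrier F"
  unfolding free_group_def by (rule word_class_carrier)

lemma cl_append: "u \<in> words \<Longrightarrow> v \<in> words \<Longrightarrow> cl (u @ v) = cl u \<otimes>\<^bsub>F\<^esub> cl v"
  unfolding free_group_def by (rule presented_group_mult[symmetric])

section \<open>Fox derivatives of words and of group elements\<close>

primrec fox :: "nat word \<Rightarrow> ('i \<Rightarrow> 'r) \<Rightarrow> nat \<times> 'i \<Rightarrow> 'r" where
  "fox [] p = (\<lambda>_. 0)"
| "fox (a # w) p = (\<lambda>(i, k).
     (if i = fst a then if snd a then L (cl w) p k else - L (cl (a # w)) p k else 0) + fox w p (i, k))"

text \<open>The product rule, from \<open>u v - 1 = (u - 1) v + (v - 1)\<close>; since the tensor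
  product is balanced, the factor \<open>v\<close> moves over to \<open>p\<close>.\<close>

lemma fox_append:
  assumes "u \<in> words" "v \<in> words" "p \<in> fun_on J"
  shows "fox (u @ v) p = (\<lambda>ik. fox u (L (cl v) p) ik + fox v p ik)"
  using assms(1)
proof (induction u)
  case (Cons a u)
  have u: "u \<in> words" "a # u \<in> words" using Cons by auto
  have "L (cl (u @ v)) p = L (cl u) (L (cl v) p)" "L (cl (a # u @ v)) p = L (cl (a # u)) (L (cl v) p)"
    using cl_append[OF u(1) assms(2)] cl_append[OF u(2) assms(2)] assms
    by (simp_all add: L_mult cl_closed[OF u(1)] cl_closed[OF u(2)] cl_closed[OF assms(2)])
  then show ?case using Cons.IH by (auto simp: fun_eq_iff)
qed simp

lemma fox_word_eq:
  assumes "word_eq {1..n} {} u v" "p \<in> fun_on J" shows "fox u p = fox v p"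
  using assms
proof (induction arbitrary: p)
  case (cong u u' v v')
  note w = cong.hyps[THEN word_eq_in_lists(1)] cong.hyps[THEN word_eq_in_lists(2)]
  have "cl v = cl v'" using cong.hyps(2) by (rule word_class_eqI)
  then show ?case
    using cong.IH(2)[OF cong.prems] cong.IH(1)[OF L_closed[OF cl_closed[OF w(2)] cong.prems]]
    by (simp add: fox_append[OF w(1,2) cong.prems] fox_append[OF w(3,4) cong.prems])
next
  \<comment> \<open>The two letters contribute opposite terms at index \<open>j\<close>. For
    \<open>b\<close> false the negative one involves the whole word, hence the equality of its class
    with that of the empty word.\<close>
  case (cancel j b)
  have "cl [(j, b), (j, \<not> b)] = cl []"
    using cancel(1) by (intro word_class_eqI word_eq.cancel)
  then show ?case by (cases b) (auto simp: fun_eq_iff)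
qed auto

text \<open>The Fox coordinates of \<open>(W - 1) \<otimes> p\<close> for a group element
  \<open>W\<close>; \<open>fox_word_eq\<close> makes the choice of the word irrelevant.\<close>

definition delta :: "nat word set \<Rightarrow> ('i \<Rightarrow> 'r) \<Rightarrow> nat \<times> 'i \<Rightarrow> 'r" where
  "delta W p = fox (SOME w. w \<in> W) p"

lemma delta_class:
  assumes "w \<in> words" "p \<in> fun_on J" shows "delta (cl w) p = fox w p"
proof -
  have "w \<in> cl w" using assms by (simp add: word_class_def word_eq.refl)
  then have "(SOME v. v \<in> cl w) \<in> cl w" by (rule someI)
  then have "word_eq {1..n} {} w (SOME v. v \<in> cl w)" by (simp add: word_class_def)
  from fox_word_eq[OF this assms(2)] show ?thesis by (simp add: delta_def)
qed

lemma F_carrierE: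
  assumes "W \<in> carrier F" obtains w where "w \<in> words" "W = cl w"
  using assms unfolding free_group_def by (rule presented_group_carrierE)

lemma delta_mult:
  assumes "U \<in> carrier F" "W \<in> carrier F" "p \<in> fun_on J"
  shows "delta (U \<otimes>\<^bsub>F\<^esub> W) p = (\<lambda>ik. delta U (L W p) ik + delta W p ik)"
proof -
  obtain u w where uw: "u \<in> words" "U = cl u" "w \<in> words" "W = cl w"
    using assms by (metis F_carrierE)
  have "u @ w \<in> words" using uw by simp
  from delta_class[OF this assms(3)] show ?thesis
    using uw assms fox_append[OF uw(1,3) assms(3)]
    by (simp add: cl_append delta_class L_closed cl_closed)
qed

lemma delta_one: "p \<in> fun_on J \<Longrightarrow> delta \<one>\<^bsub>F\<^esub> p = (\<lambda>_. 0)"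
  using delta_class[of "[]" p] by (simp add: free_group_def presented_group_one)

lemma delta_gen:
  assumes "j \<in> {1..n}" "p \<in> fun_on J"
  shows "delta (x j) p = (\<lambda>(i, k). if i = j then p k else 0)"
  using delta_class[of "[(j, True)]" p] assms L_one[OF assms(2)]
  by (simp add: free_gen_def free_group_def presented_group_one fun_eq_iff)

lemma fox_closed:
  "w \<in> words \<Longrightarrow> p \<in> fun_on J \<Longrightarrow> fox w p \<in> fun_on ({1..n} \<times> J)"
proof (induction w)
  case (Cons a w)
  then have w: "w \<in> words" "a # w \<in> words" "fst a \<in> {1..n}" by auto
  show ?case
    using Cons.IH[OF w(1) Cons.prems(2)] L_closed[OF cl_closed[OF w(1)] Cons.prems(2)]
      L_closed[OF cl_closed[OF w(2)] Cons.prems(2)] w(3)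
    by (auto simp: fun_on_def)
qed simp

lemma fox_add:
  "w \<in> words \<Longrightarrow> p \<in> fun_on J \<Longrightarrow> q \<in> fun_on J \<Longrightarrow>
   fox w (\<lambda>i. p i + q i) = (\<lambda>ik. fox w p ik + fox w q ik)"
proof (induction w)
  case (Cons a w)
  then have w: "w \<in> words" "a # w \<in> words" by auto
  show ?case
    using Cons.IH[OF w(1) Cons.prems(2,3)] L_add[OF cl_closed[OF w(1)] Cons.prems(2,3)]
      L_add[OF cl_closed[OF w(2)] Cons.prems(2,3)]
    by (auto simp: fun_eq_iff)
qed simp

lemma fox_smult:
  "w \<in> words \<Longrightarrow> p \<in> fun_on J \<Longrightarrow> fox w (\<lambda>i. r * p i) = (\<lambda>ik. r * fox w p ik)"
proof (induction w)
  case (Cons a w)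
  then have w: "w \<in> words" "a # w \<in> words" by auto
  show ?case
    using Cons.IH[OF w(1) Cons.prems(2)] L_smult[OF cl_closed[OF w(1)] Cons.prems(2)]
      L_smult[OF cl_closed[OF w(2)] Cons.prems(2)]
    by (auto simp: fun_eq_iff algebra_simps)
qed simp

lemma delta_closed: "W \<in> carrier F \<Longrightarrow> p \<in> fun_on J \<Longrightarrow> delta W p \<in> fun_on ({1..n} \<times> J)"
  by (erule F_carrierE) (simp add: delta_class fox_closed)

lemma delta_add: "W \<in> carrier F \<Longrightarrow> p \<in> fun_on J \<Longrightarrow> q \<in> fun_on J \<Longrightarrow>
    delta W (\<lambda>i. p i + q i) = (\<lambda>ik. delta W p ik + delta W q ik)"
  by (erule F_carrierE) (simp add: delta_class fox_add)

lemma delta_smult: "W \<in> carrier F \<Longrightarrow> p \<in> fun_on J \<Longrightarrow>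
    delta W (\<lambda>i. r * p i) = (\<lambda>ik. r * delta W p ik)"
  by (erule F_carrierE) (simp add: delta_class fox_smult)

lemma delta_zero: "W \<in> carrier F \<Longrightarrow> delta W (\<lambda>_. 0) = (\<lambda>_. 0)"
  using delta_smult[of W "\<lambda>_. 0" 0] by simp

text \<open>Prepares balancedness: a group ring element \<open>c\<close> acts on a vector by such a
  combination, and this lets it cross the tensor sign.\<close>

lemma delta_lin_ext:
  assumes W: "W \<in> carrier F" and q: "\<And>h. h \<in> Poly_Mapping.keys c \<Longrightarrow> q h \<in> fun_on J"
  shows "delta W (\<lambda>k. lin_ext (\<lambda>h. q h k) c) ik = lin_ext (\<lambda>h. delta W (q h) ik) c"
proof -
  have "delta W (\<lambda>k. \<Sum>h\<in>H. r h * q h k) ik = (\<Sum>h\<in>H. r h * delta W (q h) ik)"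
    if "finite H" "\<And>h. h \<in> H \<Longrightarrow> q h \<in> fun_on J" for H r
    using that
  proof (induction H)
    case (insert h H)
    have "(\<lambda>k. \<Sum>h\<in>H. r h * q h k) \<in> fun_on J"
      using insert.prems by (auto simp: fun_on_def intro!: sum.neutral)
    with insert show ?case
      using delta_add[OF W, of "\<lambda>k. r h * q h k" "\<lambda>k. \<Sum>h\<in>H. r h * q h k"] delta_smult[OF W, of "q h" "r h"]
      by simp
  qed (simp add: delta_zero W)
  from this[of "Poly_Mapping.keys c"] q show ?thesis by (simp add: lin_ext_def)
qed

section \<open>Coordinates on the tensor product over the group ring\<close>

abbreviation "ZF \<equiv> group_ring F"
abbreviation "aug \<equiv> ZF\<lparr>carrier := augmentation_ideal F\<rparr>"
abbreviation "V \<equiv> space \<rho>"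
abbreviation "la \<equiv> group_ring_act V (\<lambda>W. act \<rho> (xi n W))"

sublocale V: abelian_group V by (rule abelian_group)

lemma coord_la:
  assumes c: "c \<in> carrier ZF" and v: "v \<in> carrier V"
  shows "la c v \<in> carrier V" and "\<phi> (la c v) = (\<lambda>k. lin_ext (\<lambda>W. L W (\<phi> v) k) c)"
proof -
  have W: "act \<rho> (xi n W) v \<in> carrier V" "\<phi> (act \<rho> (xi n W) v) = L W (\<phi> v)"
    if "W \<in> Poly_Mapping.keys c" for W
  proof -
    have "W \<in> carrier F" using c that by (auto simp: group_ring_carrier)
    then show "act \<rho> (xi n W) v \<in> carrier V" "\<phi> (act \<rho> (xi n W) v) = L W (\<phi> v)"
      using v xi_closed by (simp_all add: act_closed coord_act L_def)
  qed
  show "la c v \<in> carrier V" unfolding group_ring_act_def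
    by (rule V.finsum_closed) (simp add: W V.add.int_pow_closed Pi_def)
  show "\<phi> (la c v) = (\<lambda>k. lin_ext (\<lambda>W. L W (\<phi> v) k) c)"
    unfolding group_ring_act_def lin_ext_def
    by (subst coord_finsum) (simp_all add: W V.add.int_pow_closed Pi_def coord_add_pow)
qed

text \<open>Each \<open>W\<close> stands for \<open>W - 1\<close>: \<open>delta\<close> vanishes at
  the unit, and an element of augmentation zero is unchanged when every \<open>W\<close> in it is
  replaced by \<open>W - 1\<close>.\<close>

definition b :: "(nat word set \<Rightarrow>\<^sub>0 int) \<Rightarrow> 'v \<Rightarrow> nat \<times> 'i \<Rightarrow> 'r" where
  "b a v = (\<lambda>ik. lin_ext (\<lambda>W. delta W (\<phi> v) ik) a)"

definition s :: "(nat \<times> 'i \<Rightarrow> 'r) \<Rightarrow> ((nat word set \<Rightarrow>\<^sub>0 int) \<times> 'v) \<Rightarrow>\<^sub>0 int" where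
  "s u = (\<Sum>j\<in>{1..n}. frag_of (frag_of (x j) - frag_of \<one>\<^bsub>F\<^esub>, point (\<lambda>k. u (j, k))))"

lemma aug_keys: "a \<in> augmentation_ideal F \<Longrightarrow> W \<in> Poly_Mapping.keys a \<Longrightarrow> W \<in> carrier F"
  by (auto simp: augmentation_ideal_def group_ring_carrier)

lemma b_gen:
  "W \<in> carrier F \<Longrightarrow> v \<in> carrier V \<Longrightarrow> b (frag_of W - frag_of \<one>\<^bsub>F\<^esub>) v = delta W (\<phi> v)"
  by (simp add: b_def lin_ext_diff delta_one coord_closed)

lemma b_closed: 
  assumes "a \<in> augmentation_ideal F" "v \<in> carrier V" shows "b a v \<in> fun_on ({1..n} \<times> J)"
  unfolding fun_on_def
proof (intro CollectI allI impI)
  fix ik assume ik: "ik \<notin> {1..n} \<times> J"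
  have "delta W (\<phi> v) ik = 0" if "W \<in> Poly_Mapping.keys a" for W
    using delta_closed[OF aug_keys[OF assms(1) that] coord_closed[OF assms(2)]] ik
    unfolding fun_on_def by blast
  then have "b a v ik = lin_ext (\<lambda>_. 0) a" unfolding b_def by (intro lin_ext_cong)
  then show "b a v ik = 0" by (simp add: lin_ext_const)
qed

sublocale ts: tensor_setting "carrier ZF" aug "monoid.mult ZF" V la
proof unfold_locales
  fix a c assume "a \<in> carrier aug" "c \<in> carrier aug"
  then show "a \<oplus>\<^bsub>aug\<^esub> c \<in> carrier aug"
    by (simp add: augmentation_ideal_add_closed group_ring_def)
qed (simp_all add: F.augmentation_ideal_mult_closed coord_la smult_closed)

lemma plus_aug: "a \<oplus>\<^bsub>ZF\<^esub> c = a + c"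
  by (simp add: group_ring_def)

lemma row_closed: "u \<in> fun_on ({1..n} \<times> J) \<Longrightarrow> (\<lambda>k. u (j, k)) \<in> fun_on J"
  by (simp add: fun_on_def)

lemma s_add:
  assumes "u \<in> fun_on ({1..n} \<times> J)" "u' \<in> fun_on ({1..n} \<times> J)"
  shows "s (\<lambda>i. u i + u' i) - s u - s u' \<in> ts.\<N>"
proof -
  have "s (\<lambda>i. u i + u' i) - s u - s u' = (\<Sum>j\<in>{1..n}.
      frag_of (frag_of (x j) - frag_of \<one>\<^bsub>F\<^esub>, point (\<lambda>k. u (j, k)) \<oplus>\<^bsub>V\<^esub> point (\<lambda>k. u' (j, k)))
      - frag_of (frag_of (x j) - frag_of \<one>\<^bsub>F\<^esub>, point (\<lambda>k. u (j, k)))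
      - frag_of (frag_of (x j) - frag_of \<one>\<^bsub>F\<^esub>, point (\<lambda>k. u' (j, k))))"
    by (simp add: s_def sum_subtractf point_add row_closed assms)
  also have "\<dots> \<in> ts.\<N>"
    by (intro ts.null_sum ts.rel_add_right)
      (simp_all add: F.augmentation_ideal_gen free_gen_carrier point_closed row_closed assms)
  finally show ?thesis .
qed

lemma null_right_zero:
  assumes "a \<in> augmentation_ideal F" shows "frag_of (a, \<zero>\<^bsub>V\<^esub>) \<in> ts.\<N>"
  using ts.null_minus[OF ts.rel_add_right[of a "\<zero>\<^bsub>V\<^esub>" "\<zero>\<^bsub>V\<^esub>"]] assms by simp

lemma null_left_zero:
  assumes "v \<in> carrier V" shows "frag_of (0, v) \<in> ts.\<N>"
proof -
  have "(0 :: nat word set \<Rightarrow>\<^sub>0 int) \<in> carrier aug"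
    by (simp add: augmentation_ideal_def group_ring_carrier augmentation_def)
  from ts.null_minus[OF ts.rel_add_left[OF this this assms]] show ?thesis
    by (simp add: plus_aug)
qed

lemma s_single:
  assumes j: "j \<in> {1..n}" and p: "p \<in> fun_on J"
  shows "s (\<lambda>(i, k). if i = j then p k else 0) - frag_of (frag_of (x j) - frag_of \<one>\<^bsub>F\<^esub>, point p) \<in> ts.\<N>"
proof -
  have z: "point (\<lambda>_. 0) = \<zero>\<^bsub>V\<^esub>" using point_coord[of "\<zero>\<^bsub>V\<^esub>"] by (simp add: coord_zero)
  have "s (\<lambda>(i, k). if i = j then p k else 0) =
      frag_of (frag_of (x j) - frag_of \<one>\<^bsub>F\<^esub>, point p) +
      (\<Sum>i\<in>{1..n} - {j}. frag_of (frag_of (x i) - frag_of \<one>\<^bsub>F\<^esub>, \<zero>\<^bsub>V\<^esub>))"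
    using j unfolding s_def by (simp add: sum.remove[of "{1..n}" j] z)
  moreover have "(\<Sum>i\<in>{1..n} - {j}. frag_of (frag_of (x i) - frag_of \<one>\<^bsub>F\<^esub>, \<zero>\<^bsub>V\<^esub>)) \<in> ts.\<N>"
    by (intro ts.null_sum null_right_zero F.augmentation_ideal_gen free_gen_carrier) simp
  ultimately show ?thesis by simp
qed

text \<open>The identity \<open>x_j W - 1 = (x_j - 1) W + (W - 1)\<close> read inside the tensor
  product: the null elements 1 and 2 express it for \<open>s\<close>, 3 moves \<open>W\<close>
  across the tensor sign, and 4 splits the left factor.\<close>

lemma s_delta_step:
  assumes j: "j \<in> {1..n}" and W: "W \<in> carrier F" and v: "v \<in> carrier V"
  defines "Q \<equiv> \<lambda>W. s (delta W (\<phi> v)) - frag_of (frag_of W - frag_of \<one>\<^bsub>F\<^esub>, v)"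
  shows "Q (x j \<otimes>\<^bsub>F\<^esub> W) - Q W \<in> ts.\<N>"
proof -
  have xj: "x j \<in> carrier F" using j by (rule free_gen_carrier)
  have p: "\<phi> v \<in> fun_on J" "L W (\<phi> v) \<in> fun_on J" using v W by (simp_all add: coord_closed L_closed)
  let ?\<iota> = "\<lambda>(i, k). if i = j then L W (\<phi> v) k else 0"
  let ?e = "\<lambda>W. frag_of W - frag_of \<one>\<^bsub>F\<^esub>"
  have \<iota>: "delta (x j) (L W (\<phi> v)) = ?\<iota>" using j p(2) by (rule delta_gen)
  have W': "frag_of W \<in> carrier ZF" using W by (simp add: group_ring_carrier)
  have "\<phi> (la (frag_of W) v) = L W (\<phi> v)" using coord_la(2)[OF W' v] by simp
  then have pt: "point (L W (\<phi> v)) = la (frag_of W) v"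
    using point_coord[OF coord_la(1)[OF W' v]] by simp
  have e: "?e W \<in> carrier aug" "?e (x j) \<in> carrier aug" "?e (x j) \<otimes>\<^bsub>ZF\<^esub> frag_of W \<in> carrier aug"
    using W xj W' by (simp_all add: F.augmentation_ideal_gen F.augmentation_ideal_mult_closed)
  have mult: "?e (x j) \<otimes>\<^bsub>ZF\<^esub> frag_of W = frag_of (x j \<otimes>\<^bsub>F\<^esub> W) - frag_of W"
    using W by (simp add: group_ring_def frag_extend_diff)
  have 1: "s (delta (x j \<otimes>\<^bsub>F\<^esub> W) (\<phi> v)) - s ?\<iota> - s (delta W (\<phi> v)) \<in> ts.\<N>"
    using s_add[OF delta_closed[OF xj p(2)] delta_closed[OF W p(1)]] delta_mult[OF xj W p(1)] by (simp add: \<iota>)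
  have 2: "s ?\<iota> - frag_of (?e (x j), la (frag_of W) v) \<in> ts.\<N>"
    using s_single[OF j p(2)] by (simp add: pt)
  have 3: "frag_of (?e (x j) \<otimes>\<^bsub>ZF\<^esub> frag_of W, v) - frag_of (?e (x j), la (frag_of W) v) \<in> ts.\<N>"
    using ts.rel_balanced[OF e(2) W' v] .
  have 4: "frag_of (?e (x j \<otimes>\<^bsub>F\<^esub> W), v) - frag_of (?e (x j) \<otimes>\<^bsub>ZF\<^esub> frag_of W, v) - frag_of (?e W, v) \<in> ts.\<N>"
    using ts.rel_add_left[OF e(3) e(1) v] by (simp add: plus_aug mult)
  show ?thesis
    using ts.null_diff[OF ts.null_diff[OF ts.null_add[OF 1 2] 3] 4] by (simp add: Q_def algebra_simps)
qed

text \<open>The basis tensors span. Elements \<open>W - 1\<close> suffice, and for them the defect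
  \<open>?Q W\<close> does not change modulo \<open>\<N>\<close> when a generator is put in front of
  \<open>W\<close>; at the unit it is null.\<close>

lemma s_b:
  assumes a: "a \<in> augmentation_ideal F" and v: "v \<in> carrier V"
  shows "s (b a v) - frag_of (a, v) \<in> ts.\<N>"
  using a
proof (induction rule: F.augmentation_ideal_induct)
  case (gen W)
  let ?Q = "\<lambda>W. s (delta W (\<phi> v)) - frag_of (frag_of W - frag_of \<one>\<^bsub>F\<^esub>, v)"
  have "?Q W \<in> ts.\<N>" using gen
  proof (rule free_group_step_induct)
    have "s (\<lambda>_. 0) \<in> ts.\<N>" using ts.null_minus[OF s_add[of "\<lambda>_. 0" "\<lambda>_. 0"]] by simp
    then show "?Q \<one>\<^bsub>F\<^esub> \<in> ts.\<N>"
      using v by (simp add: delta_one coord_closed ts.null_diff null_left_zero)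
  next
    fix j W assume "j \<in> {1..n}" "W \<in> carrier F"
    from s_delta_step[OF this v] have *: "?Q (x j \<otimes>\<^bsub>F\<^esub> W) - ?Q W \<in> ts.\<N>" .
    show "?Q (x j \<otimes>\<^bsub>F\<^esub> W) \<in> ts.\<N> \<longleftrightarrow> ?Q W \<in> ts.\<N>"
      using ts.null_add[OF *, of "?Q W"] ts.null_diff[OF _ *, of "?Q (x j \<otimes>\<^bsub>F\<^esub> W)"] by auto
  qed
  then show ?case by (simp add: b_gen gen v)
next
  case (diff a c)
  have ac: "a - c \<in> augmentation_ideal F" using diff augmentation_ideal_diff_closed by blast
  have "b a v = (\<lambda>ik. b (a - c) v ik + b c v ik)" by (simp add: b_def lin_ext_diff)
  then have 1: "s (b a v) - s (b (a - c) v) - s (b c v) \<in> ts.\<N>"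
    using s_add[OF b_closed[OF ac v] b_closed[OF diff(2) v]] by simp
  have 2: "frag_of (a, v) - frag_of (a - c, v) - frag_of (c, v) \<in> ts.\<N>"
    using ts.rel_add_left[of "a - c" c v] ac diff v by (simp add: plus_aug)
  show ?case
    using ts.null_diff[OF ts.null_add[OF ts.null_diff[OF diff.IH] 2] 1] by (simp add: algebra_simps)
qed

lemma tensor_coordinates_LM: "tensor_coordinates (carrier ZF) aug (monoid.mult ZF) V la ({1..n} \<times> J) b s"
proof unfold_locales
  fix u :: "nat \<times> 'i \<Rightarrow> 'r" assume u: "u \<in> fun_on ({1..n} \<times> J)"
  show "Poly_Mapping.keys (s u) \<subseteq> carrier aug \<times> carrier V"
    unfolding s_def
    using keys_sum[of "\<lambda>j. frag_of (frag_of (x j) - frag_of \<one>\<^bsub>F\<^esub>, point (\<lambda>k. u (j, k)))" "{1..n}"]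
      F.augmentation_ideal_gen free_gen_carrier
    by (auto simp: point_closed row_closed u)
  show "(\<lambda>ik. lin_ext (\<lambda>(a, v). b a v ik) (s u)) = u"
  proof
    fix ik :: "nat \<times> 'i"
    obtain i k where ik: "ik = (i, k)" by fastforce
    have "lin_ext (\<lambda>(a, v). b a v (i, k)) (s u) = (\<Sum>j\<in>{1..n}. if i = j then u (j, k) else 0)"
      unfolding s_def lin_ext_sum
      by (rule sum.cong)
        (simp_all add: b_gen free_gen_carrier point_closed coord_point row_closed u delta_gen)
    also have "\<dots> = u (i, k)" using u by (auto simp: fun_on_def)
    finally show "lin_ext (\<lambda>(a, v). b a v ik) (s u) = u ik" by (simp add: ik)
  qed
next
  fix a c v assume a: "a \<in> carrier aug" and c: "c \<in> carrier ZF" and v: "v \<in> carrier V"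
  have p: "\<phi> v \<in> fun_on J" using v by (rule coord_closed)
  have ck: "h \<in> carrier F" if "h \<in> Poly_Mapping.keys c" for h using c that by (auto simp: group_ring_carrier)
  have ak: "g \<in> carrier F" if "g \<in> Poly_Mapping.keys a" for g using a that aug_keys by simp
  have "b (a \<otimes>\<^bsub>ZF\<^esub> c) v ik = b a (la c v) ik" for ik
  proof -
    have "b (a \<otimes>\<^bsub>ZF\<^esub> c) v ik = lin_ext (\<lambda>g. lin_ext (\<lambda>h. delta (g \<otimes>\<^bsub>F\<^esub> h) (\<phi> v) ik) c) a"
      by (simp add: b_def lin_ext_group_ring_mult)
    also have "\<dots> = lin_ext (\<lambda>g. lin_ext (\<lambda>h. delta g (L h (\<phi> v)) ik + delta h (\<phi> v) ik) c) a"
      by (intro lin_ext_cong) (simp add: delta_mult ak ck p)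
    \<comment> \<open>The dropped term does not depend on \<open>g\<close>, so it is multiplied by
      the augmentation of \<open>a\<close>, which is zero.\<close>
    also have "\<dots> = lin_ext (\<lambda>g. lin_ext (\<lambda>h. delta g (L h (\<phi> v)) ik) c) a"
      using a by (simp add: lin_ext_plus lin_ext_const augmentation_ideal_def)
    also have "\<dots> = lin_ext (\<lambda>g. delta g (\<lambda>k. lin_ext (\<lambda>h. L h (\<phi> v) k) c) ik) a"
      by (rule lin_ext_cong) (simp add: delta_lin_ext ak L_closed ck p)
    also have "\<dots> = b a (la c v) ik" by (simp add: b_def coord_la(2)[OF c v])
    finally show ?thesis .
  qed
  then show "b (a \<otimes>\<^bsub>ZF\<^esub> c) v = b a (la c v)" by blast
next
  fix a v v' assume "a \<in> carrier aug" "v \<in> carrier V" "v' \<in> carrier V"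
  then show "b a (v \<oplus>\<^bsub>V\<^esub> v') = (\<lambda>i. b a v i + b a v' i)"
    unfolding b_def lin_ext_plus[symmetric]
    by (intro ext lin_ext_cong) (simp add: coord_add delta_add coord_closed aug_keys)
next
  fix a v r assume "a \<in> carrier aug" "v \<in> carrier V"
  then show "b a (r \<odot>\<^bsub>V\<^esub> v) = (\<lambda>i. r * b a v i)"
    unfolding b_def lin_ext_scale[symmetric]
    by (intro ext lin_ext_cong) (simp add: coord_smult delta_smult coord_closed aug_keys)
qed (simp_all add: b_closed s_add s_b, simp_all add: group_ring_def b_def lin_ext_add)

text \<open>The tensor \<open>(x_j - 1) \<otimes> u_j\<close> goes to
  \<open>(w(x_j) - 1) \<otimes> w(u_j)\<close>, where \<open>w\<close> acts through
  \<open>artin\<close> on the left and through \<open>wB_shift\<close> on the right;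
  \<open>delta\<close> expands the result in the basis again.\<close>

definition K_LM :: "wgen word set \<Rightarrow> (nat \<times> 'i \<Rightarrow> 'r) \<Rightarrow> nat \<times> 'i \<Rightarrow> 'r" where
  "K_LM w u = (\<lambda>ik. \<Sum>j\<in>{1..n}. delta (artin n w (x j)) (K (wB_shift n w) (\<lambda>k. u (j, k))) ik)"

lemma shift_closed: "w \<in> carrier (wB n) \<Longrightarrow> wB_shift n w \<in> carrier (wB (n+1))"
  using hom_in_carrier[OF shift_hom] .

lemma artin_closed: "w \<in> carrier (wB n) \<Longrightarrow> W \<in> carrier F \<Longrightarrow> artin n w W \<in> carrier F"
  using hom_in_carrier[OF artin_is_hom] .

lemma K_LM_closed:
  assumes "w \<in> carrier (wB n)" "u \<in> fun_on ({1..n} \<times> J)"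
  shows "K_LM w u \<in> fun_on ({1..n} \<times> J)"
proof -
  have "delta (artin n w (x j)) (K (wB_shift n w) (\<lambda>k. u (j, k))) \<in> fun_on ({1..n} \<times> J)"
    if "j \<in> {1..n}" for j
    using assms that
    by (intro delta_closed artin_closed free_gen_carrier K_closed shift_closed[simplified] row_closed) simp_all
  then show ?thesis unfolding K_LM_def fun_on_def by (auto intro!: sum.neutral)
qed

lemma K_LM_add:
  assumes "w \<in> carrier (wB n)" "u \<in> fun_on ({1..n} \<times> J)" "u' \<in> fun_on ({1..n} \<times> J)"
  shows "K_LM w (\<lambda>i. u i + u' i) = (\<lambda>i. K_LM w u i + K_LM w u' i)"
  unfolding K_LM_def sum.distrib[symmetric]
  by (intro ext sum.cong)
    (simp_all add: K_add delta_add K_closed shift_closed[simplified] row_closed assms artin_closed free_gen_carrier)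

lemma K_LM_smult:
  assumes "w \<in> carrier (wB n)" "u \<in> fun_on ({1..n} \<times> J)"
  shows "K_LM w (\<lambda>i. r * u i) = (\<lambda>i. r * K_LM w u i)"
  unfolding K_LM_def sum_distrib_left
  by (intro ext sum.cong)
    (simp_all add: K_smult delta_smult K_closed shift_closed[simplified] row_closed assms artin_closed free_gen_carrier)

lemma K_LM_zero: "w \<in> carrier (wB n) \<Longrightarrow> K_LM w (\<lambda>_. 0) = (\<lambda>_. 0)"
  using K_LM_smult[of w "\<lambda>_. 0" 0] by simp

lemma K_LM_lin_ext:
  assumes w: "w \<in> carrier (wB n)" and q: "\<And>h. h \<in> Poly_Mapping.keys c \<Longrightarrow> q h \<in> fun_on ({1..n} \<times> J)"
  shows "K_LM w (\<lambda>k. lin_ext (\<lambda>h. q h k) c) ik = lin_ext (\<lambda>h. K_LM w (q h) ik) c"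
proof -
  have "K_LM w (\<lambda>k. \<Sum>h\<in>H. r h * q h k) ik = (\<Sum>h\<in>H. r h * K_LM w (q h) ik)"
    if "finite H" "\<And>h. h \<in> H \<Longrightarrow> q h \<in> fun_on ({1..n} \<times> J)" for H r
    using that
  proof (induction H)
    case (insert h H)
    have "(\<lambda>k. \<Sum>h\<in>H. r h * q h k) \<in> fun_on ({1..n} \<times> J)"
      using insert.prems unfolding fun_on_def by (auto intro!: sum.neutral)
    with insert show ?case
      using K_LM_add[OF w, of "\<lambda>k. r h * q h k" "\<lambda>k. \<Sum>h\<in>H. r h * q h k"] K_LM_smult[OF w, of "q h" "r h"]
      by simp
  qed (simp add: K_LM_zero w)
  from this[of "Poly_Mapping.keys c"] q show ?thesis by (simp add: lin_ext_def)
qed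

text \<open>The chain rule of Fox calculus: the formula that defines \<open>K_LM\<close> on basis
  tensors is valid on every \<open>(W - 1) \<otimes> p\<close>. Putting \<open>x_j\<close> in front
  of \<open>W\<close> changes both sides by the same term.\<close>

lemma delta_artin:
  assumes w: "w \<in> carrier (wB n)" and W: "W \<in> carrier F" and p: "p \<in> fun_on J"
  shows "delta (artin n w W) (K (wB_shift n w) p) = K_LM w (delta W p)"
  using W
proof (rule free_group_step_induct)
  have Kp: "K (wB_shift n w) p \<in> fun_on J" by (simp add: K_closed shift_closed[simplified] w p)
  have "artin n w \<one>\<^bsub>F\<^esub> = \<one>\<^bsub>F\<^esub>"
    using hom_one[OF artin_is_hom[OF w] group_free_group group_free_group] .
  then show "delta (artin n w \<one>\<^bsub>F\<^esub>) (K (wB_shift n w) p) = K_LM w (delta \<one>\<^bsub>F\<^esub> p)"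
    by (simp add: delta_one p Kp K_LM_zero w)
  fix j W assume j: "j \<in> {1..n}" and W: "W \<in> carrier F"
  have xj: "x j \<in> carrier F" using j by (rule free_gen_carrier)
  have LW: "L W p \<in> fun_on J" using W p by (rule L_closed)
  have KL: "K (wB_shift n w) (L W p) \<in> fun_on J" by (simp add: K_closed shift_closed[simplified] w LW)
  have "delta (artin n w (x j \<otimes>\<^bsub>F\<^esub> W)) (K (wB_shift n w) p) =
      (\<lambda>ik. delta (artin n w (x j)) (L (artin n w W) (K (wB_shift n w) p)) ik +
        delta (artin n w W) (K (wB_shift n w) p) ik)"
    using hom_mult[OF artin_is_hom[OF w] xj W] by (simp add: delta_mult artin_closed w xj W Kp)
  \<comment> \<open>The commutation of \<open>xi\<close> with the Artin action enters here:
    \<open>w\<close> is carried past the action of \<open>W\<close>.\<close>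
  also have "L (artin n w W) (K (wB_shift n w) p) = K (wB_shift n w) (L W p)"
    using compatible[OF w W p] by (simp add: L_def)
  finally have 1: "delta (artin n w (x j \<otimes>\<^bsub>F\<^esub> W)) (K (wB_shift n w) p) =
      (\<lambda>ik. delta (artin n w (x j)) (K (wB_shift n w) (L W p)) ik +
        delta (artin n w W) (K (wB_shift n w) p) ik)" .
  have "K_LM w (delta (x j) (L W p)) = delta (artin n w (x j)) (K (wB_shift n w) (L W p))"
  proof
    fix ik
    have "K_LM w (delta (x j) (L W p)) ik =
        (\<Sum>i\<in>{1..n}. if i = j then delta (artin n w (x j)) (K (wB_shift n w) (L W p)) ik else 0)"
      unfolding K_LM_def
      by (rule sum.cong) (auto simp: delta_gen[OF j LW] K_zero shift_closed[simplified] w delta_zero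
          artin_closed free_gen_carrier)
    then show "K_LM w (delta (x j) (L W p)) ik = delta (artin n w (x j)) (K (wB_shift n w) (L W p)) ik"
      using j by simp
  qed
  then have 2: "K_LM w (delta (x j \<otimes>\<^bsub>F\<^esub> W) p) =
      (\<lambda>ik. delta (artin n w (x j)) (K (wB_shift n w) (L W p)) ik + K_LM w (delta W p) ik)"
    by (simp add: delta_mult xj W p K_LM_add w delta_closed LW)
  show "delta (artin n w (x j \<otimes>\<^bsub>F\<^esub> W)) (K (wB_shift n w) p) = K_LM w (delta (x j \<otimes>\<^bsub>F\<^esub> W) p) \<longleftrightarrow>
      delta (artin n w W) (K (wB_shift n w) p) = K_LM w (delta W p)"
    unfolding 1 2 by (simp add: fun_eq_iff)
qed

lemma rep_coordinates_LM:
  "rep_coordinates (wB n) (LM1 n \<rho>) ({1..n} \<times> J) (tensor_coordinates.coord b) K_LM"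
proof -
  let ?h = "\<lambda>w. frag_extend (\<lambda>W. frag_of (artin n w W))"
  have keys_h: "Poly_Mapping.keys (?h w a) \<subseteq> carrier F"
    if "w \<in> carrier (wB n)" "a \<in> augmentation_ideal F" for w a
    by (rule keys_frag_extend_subset) (simp add: artin_closed that aug_keys[OF that(2)])
  have one: "wB_shift n \<one>\<^bsub>wB n\<^esub> = \<one>\<^bsub>wB (n+1)\<^esub>"
    using hom_one[OF shift_hom group_wB group_wB] by simp
  have mult: "wB_shift n (v \<otimes>\<^bsub>wB n\<^esub> w) = wB_shift n v \<otimes>\<^bsub>wB (n+1)\<^esub> wB_shift n w"
    if "v \<in> carrier (wB n)" "w \<in> carrier (wB n)" for v w
    using hom_mult[OF shift_hom that] by simp
  show ?thesis
  proof (rule group.tensor_rep_coordinates[OF group_wB tensor_coordinates_LM])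
    show "space (LM1 n \<rho>) = tensor_module (carrier ZF) aug (monoid.mult ZF) V la"
      and "act (LM1 n \<rho>) = (\<lambda>w\<in>carrier (wB n). tensor_map (carrier ZF) aug (monoid.mult ZF) V la
        (?h w) (act \<rho> (wB_shift n w)))"
      by (simp_all add: LM1_def Let_def)
  next
    fix w a assume w: "w \<in> carrier (wB n)" and a: "a \<in> carrier aug"
    have "augmentation (?h w a) = augmentation a"
      by (simp add: augmentation_eq lin_ext_frag_extend)
    then show "?h w a \<in> carrier aug"
      using keys_h[OF w] a by (simp add: augmentation_ideal_def group_ring_carrier)
  next
    fix a assume a: "a \<in> carrier aug"
    have "?h \<one>\<^bsub>wB n\<^esub> a = frag_extend frag_of a"
      by (rule frag_extend_eq) (use a aug_keys artin_one in simp)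
    then show "?h \<one>\<^bsub>wB n\<^esub> a = a" by (simp flip: frag_expansion)
  next
    fix v w a assume vw: "v \<in> carrier (wB n)" "w \<in> carrier (wB n)" and a: "a \<in> carrier aug"
    have "?h (v \<otimes>\<^bsub>wB n\<^esub> w) a = frag_extend (\<lambda>W. frag_of (artin n v (artin n w W))) a"
      by (rule frag_extend_eq) (use a aug_keys artin_mult[OF vw] in simp)
    also have "\<dots> = ?h v (?h w a)"
      using frag_extend_compose[of "\<lambda>W. frag_of (artin n v W)" "artin n w" a] by (simp add: o_def)
    finally show "?h (v \<otimes>\<^bsub>wB n\<^esub> w) a = ?h v (?h w a)" .
  next
    fix w a v assume w: "w \<in> carrier (wB n)" and a: "a \<in> carrier aug" and v: "v \<in> carrier V"
    show "b (?h w a) (act \<rho> (wB_shift n w) v) = K_LM w (b a v)"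
    proof
      fix ik
      have "b (?h w a) (act \<rho> (wB_shift n w) v) ik =
          lin_ext (\<lambda>W. delta (artin n w W) (K (wB_shift n w) (\<phi> v)) ik) a"
        using w v by (simp add: b_def lin_ext_frag_extend coord_act shift_closed[simplified])
      also have "\<dots> = lin_ext (\<lambda>W. K_LM w (delta W (\<phi> v)) ik) a"
        by (rule lin_ext_cong) (use a in \<open>simp add: delta_artin w aug_keys coord_closed v\<close>)
      also have "\<dots> = K_LM w (b a v) ik"
        unfolding b_def
        by (subst K_LM_lin_ext[OF w]) (use a in \<open>simp_all add: delta_closed aug_keys coord_closed v\<close>)
      finally show "b (?h w a) (act \<rho> (wB_shift n w) v) ik = K_LM w (b a v) ik" .
    qed
  qed (simp_all add: K_LM_closed K_LM_add act_closed act_one[simplified] act_mult[simplified] act_smult[simplified]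
      shift_closed[simplified] one mult)
qed

end


section \<open>Burau representations in coordinates\<close>

definition Bur_K :: "nat \<Rightarrow> 'r::comm_ring_1 \<Rightarrow> wgen word set \<Rightarrow> (nat \<Rightarrow> 'r) \<Rightarrow> nat \<Rightarrow> 'r" where
  "Bur_K m u w = mat_act m (wB_hom m (GL m) (burau_matrix m u) w)"

definition Bur_dual_K :: "nat \<Rightarrow> 'r::comm_ring_1 \<Rightarrow> wgen word set \<Rightarrow> (nat \<Rightarrow> 'r) \<Rightarrow> nat \<Rightarrow> 'r" where
  "Bur_dual_K m u w =
     mat_act m (wB_hom m (GL m) (\<lambda>g. transpose_mat (inv\<^bsub>GL m\<^esub> (burau_matrix m u g))) w)"

context
  fixes m :: nat and u u' :: "'r::comm_ring_1"
  assumes unit: "u * u' = 1"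
begin

lemma rep_coordinates_Bur: "rep_coordinates (wB m) (Bur m u) {..<m} (vec_coord m) (Bur_K m u)"
  unfolding Bur_def Bur_K_def
  by (rule rep_coordinates_matrix_rep[OF group_wB welded_relations.wB_hom[OF Bur_welded[OF unit]]])

lemma rep_coordinates_Bur_dual:
  "rep_coordinates (wB m) (Bur_dual m u) {..<m} (vec_coord m) (Bur_dual_K m u)"
  unfolding Bur_dual_def Bur_dual_K_def
  by (rule rep_coordinates_matrix_rep[OF group_wB welded_relations.wB_hom[OF Bur_dual_welded[OF unit]]])

lemma Bur_K_gen:
  assumes "Suc j < m" "p \<in> fun_on {..<m}"
  shows "Bur_K m u (wB_class m [Sig (Suc j)]) p = block_act j 0 u 1 (1 - u) p"
    and "Bur_K m u (wB_class m [Tau (Suc j)]) p = block_act j 0 1 1 0 p"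
  using assms
  by (simp_all add: Bur_K_def welded_relations.wB_hom_gen[OF Bur_welded[OF unit]] wB_gens_def
      burau_matrix_Sig burau_matrix_Tau mat_act_block2)

lemma Bur_dual_K_gen:
  assumes "Suc j < m" "p \<in> fun_on {..<m}"
  shows "Bur_dual_K m u (wB_class m [Sig (Suc j)]) p = block_act j (1 - u') u' 1 0 p"
    and "Bur_dual_K m u (wB_class m [Tau (Suc j)]) p = block_act j 0 1 1 0 p"
  using assms
  by (simp_all add: Bur_dual_K_def welded_relations.wB_hom_gen[OF Bur_dual_welded[OF unit]] wB_gens_def
      Bur_dual_matrix[OF unit] mat_act_block2)

end


section \<open>The free group action on the twisted dual Burau representation\<close>

text \<open>The parameter \<open>s\<close> will be the inverse of \<open>t\<close>. The formulas on
  generators are all that is kept of the twisted dual. Coordinate 0 is the extra one; shifted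
  generators act on the coordinates 1 to \<open>n\<close>.\<close>

locale twisted_dual = rep_coordinates "wB (n + 1)" \<rho> "{..<n + 1}" \<phi> K
  for n and \<rho> :: "(wgen word set, 'r::comm_ring_1, 'v) rep" and \<phi> K +
  fixes q s :: 'r
  assumes K_Sig: "\<And>j p. Suc j < n + 1 \<Longrightarrow> p \<in> fun_on {..<n + 1} \<Longrightarrow>
      K (wB_class (n + 1) [Sig (Suc j)]) p = (\<lambda>r. q * block_act j (1 - s) s 1 0 p r)"
    and K_Tau: "\<And>j p. Suc j < n + 1 \<Longrightarrow> p \<in> fun_on {..<n + 1} \<Longrightarrow>
      K (wB_class (n + 1) [Tau (Suc j)]) p = block_act j 0 1 1 0 p"
begin

abbreviation "W \<equiv> wB (n + 1)"
abbreviation "X \<equiv> fun_on {..<n + 1} :: (nat \<Rightarrow> 'r) set"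

text \<open>Used in place of computing with inverse elements: an equation is established after
  applying some \<open>K g\<close>, which is then cancelled.\<close>

lemma K_inj:
  assumes g: "g \<in> carrier W" and "p \<in> X" "p' \<in> X" and eq: "K g p = K g p'"
  shows "p = p'"
proof -
  have "p = K (inv\<^bsub>W\<^esub> g) (K g p)" if "p \<in> X" for p
    using that g K_mult[of "inv\<^bsub>W\<^esub> g" g p] K_one[of p] by simp
  from this[of p] this[of p'] assms show ?thesis by simp
qed

text \<open>Coordinate form of the action of \<open>x_i\<close>. The overall factor \<open>q\<close>
  stems from the single \<open>\<sigma>_i\<close> in \<open>xi\<close> of \<open>x_i\<close>, as the
  \<open>\<tau>\<close> letters carry no scalar.\<close>

definition xi_act :: "nat \<Rightarrow> (nat \<Rightarrow> 'r) \<Rightarrow> nat \<Rightarrow> 'r" where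
  "xi_act i p = (\<lambda>r. if r = 0 then q * (s * p 0 + (1 - s) * p i) else q * p r)"

lemma xi_act_closed: "p \<in> X \<Longrightarrow> xi_act i p \<in> X"
  by (auto simp: xi_act_def fun_on_def)

text \<open>The product \<open>\<tau>_(i-1) ... \<tau>_1\<close> acts as a cycle: entry 0 is carried
  to position \<open>i - 1\<close>, and the entries 1 to \<open>i - 1\<close> move down by one. The
  induction adds \<open>\<tau>_i\<close> on the left, where it acts last.\<close>

lemma K_Tau_word:
  assumes "1 \<le> i" "i \<le> n" "p \<in> X"
  shows "K (wB_class (n + 1) (map Tau (rev [1..<i]))) p =
    (\<lambda>r. if Suc r = i then p 0 else if Suc r < i then p (Suc r) else p r)"
  using assms(1,2)
proof (induction i rule: nat_induct_at_least)
  case base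
  have "K (wB_class (n + 1) (map Tau (rev [1..<1]))) p = p"
    using K_one[OF assms(3)] by (simp add: wB_class_Nil)
  also have "p = (\<lambda>r. if Suc r = 1 then p 0 else if Suc r < 1 then p (Suc r) else p r)"
    by (simp add: fun_eq_iff One_nat_def)
  finally show ?case .
next
  case (Suc i)
  then obtain l where l: "i = Suc l" by (cases i) auto
  let ?T = "wB_class (n + 1) (map Tau (rev [1..<i]))"
  have gens: "Tau i \<in> wB_gens (n + 1)" "set (map Tau (rev [1..<i])) \<subseteq> wB_gens (n + 1)"
    using Suc.hyps Suc.prems by (auto simp: wB_gens_def)
  have T: "?T \<in> carrier W" using gens by (intro wB_class_carrier)
  have c: "wB_class (n + 1) [Tau i] \<in> carrier W" using gens by (intro wB_class_carrier) simp
  have "wB_class (n + 1) (map Tau (rev [1..<Suc i])) = wB_class (n + 1) [Tau i] \<otimes>\<^bsub>W\<^esub> ?T"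
    using Suc.hyps wB_class_Cons[OF gens] by simp
  then have "K (wB_class (n + 1) (map Tau (rev [1..<Suc i]))) p = block_act l 0 1 1 0 (K ?T p)"
    using K_mult[OF c T assms(3)] K_Tau[of l "K ?T p"] K_closed[OF T assms(3)] Suc.prems l by simp
  also have "K ?T p = (\<lambda>r. if Suc r = i then p 0 else if Suc r < i then p (Suc r) else p r)"
    using Suc by simp
  finally show ?case by (auto simp: block_act_def fun_eq_iff l)
qed

text \<open>The conjugating element \<open>T\<close> is moved to the other side,
  \<open>T xi(x_i) = \<sigma>_i \<tau>_i T\<close>, so its inverse is never computed. After
  \<open>T\<close> the entries \<open>p 0\<close> and \<open>p i\<close> are neighbours, at
  positions \<open>i - 1\<close> and \<open>i\<close>, where \<open>\<sigma>_i \<tau>_i\<close>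
  mixes them.\<close>

lemma K_xi_gen:
  assumes i: "i \<in> {1..n}" and p: "p \<in> X"
  shows "K (xi n (free_gen n i)) p = xi_act i p"
proof -
  obtain l where l: "i = Suc l" "l < n" using i by (cases i) auto
  let ?T = "wB_class (n + 1) (map Tau (rev [1..<i]))" and ?C = "wB_class (n + 1) [Sig i, Tau i]"
  let ?y = "K (xi n (free_gen n i)) p"
  have T: "?T \<in> carrier W" and C: "?C \<in> carrier W"
    using i by (auto intro!: wB_class_carrier simp: wB_gens_def)
  have gens: "Sig i \<in> wB_gens (n + 1)" "Tau i \<in> wB_gens (n + 1)" using i by (auto simp: wB_gens_def)
  have c: "wB_class (n + 1) [Sig i] \<in> carrier W" "wB_class (n + 1) [Tau i] \<in> carrier W"
    using gens by (auto intro!: wB_class_carrier)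
  have KT: "K ?T r = (\<lambda>k. if Suc k = i then r 0 else if Suc k < i then r (Suc k) else r k)" if "r \<in> X" for r
    using K_Tau_word[OF _ _ that] i by simp
  have y: "?y \<in> X" using p i K_closed hom_in_carrier[OF xi_hom free_gen_carrier] by blast
  have "?T \<otimes>\<^bsub>W\<^esub> xi n (free_gen n i) = ?C \<otimes>\<^bsub>W\<^esub> ?T"
    using T C by (simp add: xi_gen[OF i] flip: m_assoc)
  then have "K ?T ?y = K ?C (K ?T p)"
    using K_mult[OF T hom_in_carrier[OF xi_hom free_gen_carrier[OF i]] p] K_mult[OF C T p] by simp
  also have "\<dots> = K (wB_class (n + 1) [Sig i]) (K (wB_class (n + 1) [Tau i]) (K ?T p))"
    using wB_class_Cons[OF gens(1), of "[Tau i]"] gens(2) K_mult[OF c K_closed[OF T p]] by simp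
  also have "\<dots> = (\<lambda>r. q * block_act l (1 - s) s 1 0 (block_act l 0 1 1 0 (K ?T p)) r)"
    using K_Tau[of l "K ?T p"] K_Sig[of l "block_act l 0 1 1 0 (K ?T p)"] K_closed[OF T p] l
      block_act_closed[of l "n + 1" "K ?T p"]
    by simp
  also have "\<dots> = K ?T (xi_act i p)"
    unfolding KT[OF p] KT[OF xi_act_closed[OF p]]
    by (auto simp: block_act_def xi_act_def l fun_eq_iff algebra_simps)
  finally show ?thesis by (rule K_inj[OF T y xi_act_closed[OF p]])
qed

section \<open>Commutation of \<open>xi\<close> with the Artin action\<close>

lemma artin_in: "w \<in> carrier (wB n) \<Longrightarrow> V \<in> carrier (free_group n) \<Longrightarrow> artin n w V \<in> carrier (free_group n)"
  using hom_in_carrier[OF artin_is_hom] .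

lemma shift_in: "w \<in> carrier (wB n) \<Longrightarrow> wB_shift n w \<in> carrier W"
  using hom_in_carrier[OF shift_hom] .

lemma xi_in: "V \<in> carrier (free_group n) \<Longrightarrow> xi n V \<in> carrier W"
  using hom_in_carrier[OF xi_hom] .

lemma K_xi_mult:
  assumes "U \<in> carrier (free_group n)" "V \<in> carrier (free_group n)" "p \<in> X"
  shows "K (xi n (U \<otimes>\<^bsub>free_group n\<^esub> V)) p = K (xi n U) (K (xi n V) p)"
  using hom_mult[OF xi_hom assms(1,2)] K_mult[OF xi_in[OF assms(1)] xi_in[OF assms(2)] assms(3)] by simp

text \<open>For fixed \<open>w\<close> the relation is multiplicative in \<open>V\<close>.
  Injectivity of the operators turns the step into an equivalence, which covers inverse generators
  as well.\<close>

lemma compatible_from_gens: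
  assumes w: "w \<in> carrier (wB n)"
    and gens: "\<And>j p. j \<in> {1..n} \<Longrightarrow> p \<in> X \<Longrightarrow>
      K (wB_shift n w) (K (xi n (free_gen n j)) p) = K (xi n (artin n w (free_gen n j))) (K (wB_shift n w) p)"
    and V: "V \<in> carrier (free_group n)" and p: "p \<in> X"
  shows "K (wB_shift n w) (K (xi n V) p) = K (xi n (artin n w V)) (K (wB_shift n w) p)"
  using V
proof (rule free_group_step_induct)
  have one: "artin n w \<one>\<^bsub>free_group n\<^esub> = \<one>\<^bsub>free_group n\<^esub>" "xi n \<one>\<^bsub>free_group n\<^esub> = \<one>\<^bsub>W\<^esub>"
    using hom_one[OF artin_is_hom[OF w] group_free_group group_free_group]
      hom_one[OF xi_hom group_free_group group_wB] by simp_all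
  show "K (wB_shift n w) (K (xi n \<one>\<^bsub>free_group n\<^esub>) p) =
      K (xi n (artin n w \<one>\<^bsub>free_group n\<^esub>)) (K (wB_shift n w) p)"
    using K_closed[OF shift_in[OF w] p] by (simp only: one K_one p)
next
  fix j V assume j: "j \<in> {1..n}" and V: "V \<in> carrier (free_group n)"
  note xj = free_gen_carrier[OF j]
  let ?S = "K (wB_shift n w)"
  have Sp: "?S p \<in> X" and Vp: "K (xi n V) p \<in> X" and aV: "artin n w V \<in> carrier (free_group n)"
    and axj: "artin n w (free_gen n j) \<in> carrier (free_group n)"
    using K_closed shift_in xi_in artin_in w V p xj by auto
  have "?S (K (xi n (free_gen n j \<otimes>\<^bsub>free_group n\<^esub> V)) p) =
      K (xi n (artin n w (free_gen n j))) (?S (K (xi n V) p))"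
    by (simp only: K_xi_mult[OF xj V p] gens[OF j Vp])
  moreover have "K (xi n (artin n w (free_gen n j \<otimes>\<^bsub>free_group n\<^esub> V))) (?S p) =
      K (xi n (artin n w (free_gen n j))) (K (xi n (artin n w V)) (?S p))"
    by (simp only: hom_mult[OF artin_is_hom[OF w] xj V] K_xi_mult[OF axj aV Sp])
  ultimately show "?S (K (xi n (free_gen n j \<otimes>\<^bsub>free_group n\<^esub> V)) p) =
      K (xi n (artin n w (free_gen n j \<otimes>\<^bsub>free_group n\<^esub> V))) (?S p) \<longleftrightarrow>
      ?S (K (xi n V) p) = K (xi n (artin n w V)) (?S p)"
    using K_inj[OF xi_in[OF axj] K_closed[OF shift_in[OF w] Vp] K_closed[OF xi_in[OF aV] Sp]] by auto
qed

lemma K_shift_Sig: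
  assumes "1 \<le> i" "i < n" "p \<in> X"
  shows "K (wB_shift n (wB_class n [Sig i])) p = (\<lambda>r. q * block_act i (1 - s) s 1 0 p r)"
  using K_Sig[of i p] assms by (simp add: shift_Sig Suc_eq_plus1)

lemma K_shift_Tau:
  assumes "1 \<le> i" "i < n" "p \<in> X"
  shows "K (wB_shift n (wB_class n [Tau i])) p = block_act i 0 1 1 0 p"
  using K_Tau[of i p] assms by (simp add: shift_Tau Suc_eq_plus1)

lemma compatible_Sig:
  assumes i: "1 \<le> i" "i < n" and j: "j \<in> {1..n}" and p: "p \<in> X"
  defines "w \<equiv> wB_class n [Sig i]"
  shows "K (wB_shift n w) (K (xi n (free_gen n j)) p) = K (xi n (artin n w (free_gen n j))) (K (wB_shift n w) p)"
proof -
  interpret F: group "free_group n" by (rule group_free_group)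
  have w: "w \<in> carrier (wB n)" unfolding w_def using i by (intro wB_class_carrier) (simp add: wB_gens_def)
  have ij: "i \<in> {1..n}" "i + 1 \<in> {1..n}" using i by auto
  let ?S = "K (wB_shift n w)"
  have S: "?S r = (\<lambda>k. q * block_act i (1 - s) s 1 0 r k)" if "r \<in> X" for r
    unfolding w_def by (rule K_shift_Sig[OF i that])
  have closed: "?S r \<in> X" if "r \<in> X" for r using K_closed[OF shift_in[OF w] that] .
  have a: "artin n w (free_gen n j) = (if j = i then free_gen n (i+1)
    else if j = i+1 then inv\<^bsub>free_group n\<^esub> free_gen n (i+1) \<otimes>\<^bsub>free_group n\<^esub> free_gen n i
      \<otimes>\<^bsub>free_group n\<^esub> free_gen n (i+1) else free_gen n j)"
    unfolding w_def using i j by (simp only: artin_Sig sig_aut_gen)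
  have calc: "?S (xi_act j r) = xi_act (if j = i then i + 1 else j) (?S r)" if "r \<in> X" "j \<noteq> i + 1" for r
    using that i j by (auto simp: S xi_act_closed) (auto simp: block_act_def xi_act_def fun_eq_iff algebra_simps Suc_eq_plus1)
  show ?thesis
  proof (cases "j = i + 1")
    case False
    then have "artin n w (free_gen n j) = free_gen n (if j = i then i + 1 else j)" using a by simp
    then show ?thesis
      using calc[OF p False] K_xi_gen[OF j p] K_xi_gen[of "if j = i then i + 1 else j" "?S p"] ij j closed[OF p]
      by simp
  next
    case True
    let ?x = "free_gen n" and ?F = "free_group n"
    note c = free_gen_carrier[OF ij(1)] free_gen_carrier[OF ij(2)]
    let ?y = "inv\<^bsub>?F\<^esub> ?x (i+1) \<otimes>\<^bsub>?F\<^esub> ?x i \<otimes>\<^bsub>?F\<^esub> ?x (i+1)"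
    have y: "?y \<in> carrier ?F" using c by simp
    \<comment> \<open>The image \<open>?y\<close> of \<open>x_(i+1)\<close> is a conjugate.
      Multiplied by \<open>x_(i+1)\<close> it leaves an equation between generators only, and
      \<open>K_inj\<close> removes the factor at the end.\<close>
    have "?x (i+1) \<otimes>\<^bsub>?F\<^esub> ?y = ?x i \<otimes>\<^bsub>?F\<^esub> ?x (i+1)"
      using c by (simp flip: F.m_assoc)
    then have "K (xi n (?x (i+1))) (K (xi n ?y) (?S p)) = K (xi n (?x i)) (K (xi n (?x (i+1))) (?S p))"
      using K_xi_mult[OF c(2) y closed[OF p]] K_xi_mult[OF c closed[OF p]] by simp
    also have "\<dots> = xi_act i (xi_act (i+1) (?S p))"
      using closed[OF p] xi_act_closed by (simp only: K_xi_gen[OF ij(1)] K_xi_gen[OF ij(2)])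
    also have "\<dots> = xi_act (i+1) (?S (xi_act (i+1) p))"
      using p i by (auto simp: S xi_act_closed) (auto simp: block_act_def xi_act_def fun_eq_iff algebra_simps Suc_eq_plus1)
    also have "\<dots> = K (xi n (?x (i+1))) (?S (K (xi n (?x (i+1))) p))"
      using closed xi_act_closed p by (simp only: K_xi_gen[OF ij(2)])
    finally have "K (xi n ?y) (?S p) = ?S (K (xi n (?x (i+1))) p)"
      by (rule K_inj[OF xi_in[OF c(2)] K_closed[OF xi_in[OF y] closed[OF p]] closed[OF K_closed[OF xi_in[OF c(2)] p]]])
    then show ?thesis using a True by simp
  qed
qed

lemma compatible_Tau:
  assumes i: "1 \<le> i" "i < n" and j: "j \<in> {1..n}" and p: "p \<in> X"
  defines "w \<equiv> wB_class n [Tau i]"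
  shows "K (wB_shift n w) (K (xi n (free_gen n j)) p) = K (xi n (artin n w (free_gen n j))) (K (wB_shift n w) p)"
proof -
  have w: "w \<in> carrier (wB n)" unfolding w_def using i by (intro wB_class_carrier) (simp add: wB_gens_def)
  let ?S = "K (wB_shift n w)" and ?j = "if j = i then i + 1 else if j = i + 1 then i else j"
  have S: "?S r = block_act i 0 1 1 0 r" if "r \<in> X" for r
    unfolding w_def by (rule K_shift_Tau[OF i that])
  have closed: "?S p \<in> X" using K_closed[OF shift_in[OF w] p] .
  have a: "artin n w (free_gen n j) = free_gen n ?j"
    unfolding w_def using i j by (simp add: artin_Tau tau_aut_gen)
  have "?S (xi_act j p) = xi_act ?j (?S p)"
    using p i j by (auto simp: S xi_act_closed) (auto simp: block_act_def xi_act_def fun_eq_iff algebra_simps Suc_eq_plus1)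
  moreover have "?j \<in> {1..n}" using i j by auto
  ultimately show ?thesis
    unfolding a using K_xi_gen[OF j p] K_xi_gen[of ?j "?S p"] closed by simp
qed

text \<open>The set of \<open>w\<close> for which the relation holds for all \<open>V\<close> and
  \<open>p\<close> is closed under products and inverses, so the generators decide.\<close>

lemma compatible:
  assumes "w \<in> carrier (wB n)" "V \<in> carrier (free_group n)" "p \<in> X"
  shows "K (wB_shift n w) (K (xi n V) p) = K (xi n (artin n w V)) (K (wB_shift n w) p)"
proof -
  let ?C = "\<lambda>w. \<forall>V\<in>carrier (free_group n). \<forall>p\<in>X.
    K (wB_shift n w) (K (xi n V) p) = K (xi n (artin n w V)) (K (wB_shift n w) p)"
  have mult: "?C (v \<otimes>\<^bsub>wB n\<^esub> w)" if v: "v \<in> carrier (wB n)" "?C v" and w: "w \<in> carrier (wB n)" "?C w" for v w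
  proof (intro ballI)
    fix V p assume V: "V \<in> carrier (free_group n)" and p: "p \<in> X"
    have s: "wB_shift n (v \<otimes>\<^bsub>wB n\<^esub> w) = wB_shift n v \<otimes>\<^bsub>W\<^esub> wB_shift n w"
      by (rule hom_mult[OF shift_hom v(1) w(1)])
    have "K (wB_shift n (v \<otimes>\<^bsub>wB n\<^esub> w)) r = K (wB_shift n v) (K (wB_shift n w) r)" if "r \<in> X" for r
      unfolding s by (rule K_mult[OF shift_in[OF v(1)] shift_in[OF w(1)] that])
    then show "K (wB_shift n (v \<otimes>\<^bsub>wB n\<^esub> w)) (K (xi n V) p) =
        K (xi n (artin n (v \<otimes>\<^bsub>wB n\<^esub> w) V)) (K (wB_shift n (v \<otimes>\<^bsub>wB n\<^esub> w)) p)"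
      using v w V p artin_in K_closed shift_in xi_in by (simp only: artin_mult)
  qed
  have gen': "?C (wB_class n [g])" "wB_class n [g] \<in> carrier (wB n)" if "g \<in> wB_gens n" for g
  proof -
    show c: "wB_class n [g] \<in> carrier (wB n)" using that by (intro wB_class_carrier) simp
    from that consider i where "1 \<le> i" "i < n" "g = Sig i" | i where "1 \<le> i" "i < n" "g = Tau i"
      by (auto simp: wB_gens_def)
    then show "?C (wB_class n [g])"
    proof cases
      case 1
      show ?thesis unfolding 1(3)
        using compatible_from_gens[OF c[unfolded 1(3)] compatible_Sig[OF 1(1,2)]] by blast
    next
      case 2
      show ?thesis unfolding 2(3)
        using compatible_from_gens[OF c[unfolded 2(3)] compatible_Tau[OF 2(1,2)]] by blast
    qed
  qed
  have inv: "?C (inv\<^bsub>wB n\<^esub> w)" if w: "w \<in> carrier (wB n)" "?C w" for w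
  proof (intro ballI)
    interpret B: group "wB n" by (rule group_wB)
    fix V p assume V: "V \<in> carrier (free_group n)" and p: "p \<in> X"
    let ?i = "inv\<^bsub>wB n\<^esub> w"
    have i: "?i \<in> carrier (wB n)" using w by simp
    have one: "wB_shift n \<one>\<^bsub>wB n\<^esub> = \<one>\<^bsub>W\<^esub>" using hom_one[OF shift_hom group_wB group_wB] .
    have K1: "K (wB_shift n w) (K (wB_shift n ?i) r) = r" if "r \<in> X" for r
      using K_mult[OF shift_in[OF w(1)] shift_in[OF i] that] hom_mult[OF shift_hom w(1) i] w one K_one[OF that]
      by simp
    have a1: "artin n w (artin n ?i V) = V"
      using artin_mult[OF w(1) i V] w artin_one[OF V] by simp
    have ip: "K (wB_shift n ?i) p \<in> X" and iV: "artin n ?i V \<in> carrier (free_group n)"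
      using K_closed[OF shift_in[OF i] p] artin_in[OF i V] .
    have Vp: "K (xi n V) p \<in> X" using K_closed[OF xi_in[OF V] p] .
    \<comment> \<open>The relation for \<open>w\<close> is taken at the images of \<open>V\<close>
      and \<open>p\<close> under the inverse of \<open>w\<close>; cancelling the shifted
      \<open>w\<close> then gives the relation for the inverse.\<close>
    have "K (wB_shift n w) (K (xi n (artin n ?i V)) (K (wB_shift n ?i) p)) = K (xi n V) p"
      using w(2)[rule_format, OF iV ip] by (simp only: a1 K1[OF p])
    also have "\<dots> = K (wB_shift n w) (K (wB_shift n ?i) (K (xi n V) p))"
      by (simp only: K1[OF Vp])
    finally show "K (wB_shift n ?i) (K (xi n V) p) = K (xi n (artin n ?i V)) (K (wB_shift n ?i) p)"
      by (rule K_inj[OF shift_in[OF w(1)] K_closed[OF xi_in[OF iV] ip] K_closed[OF shift_in[OF i] Vp], symmetric])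
  qed
  have "?C w" using assms(1)
  proof (induction rule: wB_induct)
    case one
    have s: "wB_shift n \<one>\<^bsub>wB n\<^esub> = \<one>\<^bsub>W\<^esub>" using hom_one[OF shift_hom group_wB group_wB] .
    show ?case using K_closed xi_in by (auto simp only: s K_one artin_one)
  next
    case (gen g w)
    show ?case by (rule mult[OF gen'(2)[OF gen(1)] gen'(1)[OF gen(1)] gen(2,3)])
  next
    case (inv_gen g w)
    note g = gen'[OF inv_gen(1)]
    show ?case by (rule mult[OF group.inv_closed[OF group_wB g(2)] inv[OF g(2,1)] inv_gen(2,3)])
  qed
  then show ?thesis using assms by blast
qed

end

section \<open>The generators on the Long-Moody module\<close>

context twisted_dual
begin

sublocale lm: long_moody n \<rho> "{..<n + 1}" \<phi> K
  by unfold_locales (rule compatible)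

text \<open>The Fox derivatives of \<open>y = x_(i+1)^-1 x_i x_(i+1)\<close> are read off from
  \<open>x_(i+1) y = x_i x_(i+1)\<close> by the product rule on both sides: component
  \<open>i\<close> is \<open>x_(i+1)\<close>, component \<open>i + 1\<close> is
  \<open>1 - y\<close>. The action of \<open>y\<close> on the transformed slot is known from
  \<open>compatible_Sig\<close>.\<close>

lemma K_LM_Sig:
  assumes i: "1 \<le> i" "i < n" and u: "u \<in> fun_on ({1..n} \<times> {..<n + 1})"
  defines "S \<equiv> \<lambda>r k. q * block_act i (1 - s) s 1 0 r k" and "slot \<equiv> \<lambda>j k. u (j, k)"
  shows "lm.K_LM (wB_class n [Sig i]) u (j, k) =
    (if j = i + 1 then S (slot i) k + S (slot (i + 1)) k - S (xi_act (i + 1) (slot (i + 1))) k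
     else if j = i then xi_act (i + 1) (S (slot (i + 1))) k else S (slot j) k)"
proof -
  let ?x = "free_gen n" and ?F = "free_group n" and ?w = "wB_class n [Sig i]"
  have w: "?w \<in> carrier (wB n)" using i by (intro wB_class_carrier) (simp add: wB_gens_def)
  have slot_eq: "(\<lambda>k. u (l, k)) = slot l" for l by (simp add: slot_def)
  have zero: "slot l = (\<lambda>_. 0)" if "l \<notin> {1..n}" for l
    using u that by (auto simp: slot_def fun_on_def)
  have slot: "slot j \<in> X" for j using u by (simp add: slot_def fun_on_def)
  have S: "K (wB_shift n ?w) r = S r" if "r \<in> X" for r
    unfolding S_def by (rule K_shift_Sig[OF i that])
  have S_closed: "S r \<in> X" if "r \<in> X" for r using K_closed[OF shift_in[OF w] that] S[OF that] by simp
  have ij: "i \<in> {1..n}" "i + 1 \<in> {1..n}" using i by auto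
  have a: "artin n ?w (?x l) = (if l = i then ?x (i+1)
    else if l = i+1 then inv\<^bsub>?F\<^esub> ?x (i+1) \<otimes>\<^bsub>?F\<^esub> ?x i \<otimes>\<^bsub>?F\<^esub> ?x (i+1) else ?x l)" if "l \<in> {1..n}" for l
    using i that by (simp only: artin_Sig sig_aut_gen)
  note c = free_gen_carrier[OF ij(1)] free_gen_carrier[OF ij(2)]
  let ?y = "inv\<^bsub>?F\<^esub> ?x (i+1) \<otimes>\<^bsub>?F\<^esub> ?x i \<otimes>\<^bsub>?F\<^esub> ?x (i+1)"
  have y: "?y \<in> carrier ?F" using c by simp
  have "?x (i+1) \<otimes>\<^bsub>?F\<^esub> ?y = ?x i \<otimes>\<^bsub>?F\<^esub> ?x (i+1)"
    using c by (simp flip: lm.F.m_assoc)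
  moreover define v where "v = S (slot (i + 1))"
  have v: "v \<in> X" unfolding v_def by (intro S_closed slot)
  ultimately have eq: "lm.delta (?x (i+1)) (lm.L ?y v) jk + lm.delta ?y v jk =
      lm.delta (?x i) (lm.L (?x (i+1)) v) jk + lm.delta (?x (i+1)) v jk" for jk
    using fun_cong[OF lm.delta_mult[OF c(2) y v], of jk] fun_cong[OF lm.delta_mult[OF c v], of jk] by simp
  have "artin n ?w (?x (i+1)) = ?y" using a[OF ij(2)] by simp
  then have Ly: "lm.L ?y v = S (xi_act (i + 1) (slot (i + 1)))"
    using compatible_Sig[OF i ij(2) slot[of "i+1"]] K_xi_gen[OF ij(2) slot[of "i+1"]]
    by (simp add: lm.L_def v_def S slot xi_act_closed)
  have Lx: "lm.L (?x (i+1)) v = xi_act (i+1) v" unfolding lm.L_def by (rule K_xi_gen[OF ij(2) v])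
  have y_delta: "lm.delta ?y v (j, k) = (if j = i then xi_act (i+1) v k
     else if j = i+1 then v k - S (xi_act (i + 1) (slot (i + 1))) k else 0)"
    using eq[of "(j, k)"] unfolding Ly Lx
    using lm.delta_gen[OF ij(1) xi_act_closed[OF v]] lm.delta_gen[OF ij(2) v]
      lm.delta_gen[OF ij(2) S_closed[OF xi_act_closed[OF slot]]]
    by (auto simp: algebra_simps)
  have "lm.delta (artin n ?w (?x l)) (K (wB_shift n ?w) (slot l)) (j, k) =
      ((if l = i then if j = i + 1 then S (slot i) k else 0 else 0) +
       (if l = i + 1 then lm.delta ?y v (j, k) else 0)) +
       (if l = j then if j = i \<or> j = i + 1 then 0 else S (slot j) k else 0)"
    if l: "l \<in> {1..n}" for l
    unfolding S[OF slot] a[OF l]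
    using lm.delta_gen[OF l S_closed[OF slot[of l]]] lm.delta_gen[OF ij(2) S_closed[OF slot[of i]]]
    by (auto simp: v_def)
  then have "lm.K_LM ?w u (j, k) = (\<Sum>l\<in>{1..n}. ((if l = i then if j = i + 1 then S (slot i) k else 0 else 0) +
       (if l = i + 1 then lm.delta ?y v (j, k) else 0)) +
       (if l = j then if j = i \<or> j = i + 1 then 0 else S (slot j) k else 0))"
    unfolding lm.K_LM_def slot_eq by (rule sum.cong[OF HOL.refl])
  also have "\<dots> = (if j = i + 1 then S (slot i) k else 0) + lm.delta ?y v (j, k) +
      (if j \<in> {1..n} then if j = i \<or> j = i + 1 then 0 else S (slot j) k else 0)"
    using ij by (simp only: sum.distrib sum.delta finite_atLeastAtMost if_True)
  \<comment> \<open>Off \<open>{1..n}\<close> the slot is zero, so the bound on \<open>j\<close> may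
    be dropped from the formula.\<close>
  also have "(if j \<in> {1..n} then if j = i \<or> j = i + 1 then 0 else S (slot j) k else 0) =
      (if j = i \<or> j = i + 1 then 0 else S (slot j) k)"
  proof (cases "j \<in> {1..n}")
    case False
    from zero[OF this] False show ?thesis by (simp add: S_def block_act_def)
  qed simp
  finally show ?thesis unfolding y_delta by (auto simp: v_def)
qed

text \<open>Permuting the generators permutes the basis elements \<open>x_j - 1\<close>, so slots
  are exchanged while \<open>\<tau>_(i+1)\<close> acts inside each of them.\<close>

lemma K_LM_Tau:
  assumes i: "1 \<le> i" "i < n" and u: "u \<in> fun_on ({1..n} \<times> {..<n + 1})"
  shows "lm.K_LM (wB_class n [Tau i]) u (j, k) = block_act i 0 1 1 0
    (\<lambda>k. u (if j = i then i + 1 else if j = i + 1 then i else j, k)) k"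
proof -
  let ?w = "wB_class n [Tau i]" and ?j = "\<lambda>j. if j = i then i + 1 else if j = i + 1 then i else j"
  define S :: "(nat \<Rightarrow> 'r) \<Rightarrow> nat \<Rightarrow> 'r" where "S = block_act i 0 1 1 0"
  define slot where "slot j = (\<lambda>k. u (j, k))" for j
  have w: "?w \<in> carrier (wB n)" using i by (intro wB_class_carrier) (simp add: wB_gens_def)
  have slot_eq: "(\<lambda>k. u (l, k)) = slot l" for l by (simp add: slot_def)
  have zero: "slot l = (\<lambda>_. 0)" if "l \<notin> {1..n}" for l
    using u that by (auto simp: slot_def fun_on_def)
  have slot: "slot j \<in> X" for j using u by (simp add: slot_def fun_on_def)
  have S: "K (wB_shift n ?w) r = S r" if "r \<in> X" for r
    unfolding S_def by (rule K_shift_Tau[OF i that])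
  have S_closed: "S r \<in> X" if "r \<in> X" for r using K_closed[OF shift_in[OF w] that] S[OF that] by simp
  have "lm.delta (artin n ?w (free_gen n l)) (K (wB_shift n ?w) (slot l)) (j, k) =
      (if l = ?j j then S (slot (?j j)) k else 0)" if l: "l \<in> {1..n}" for l
  proof -
    have "artin n ?w (free_gen n l) = free_gen n (?j l)" using i l by (simp add: artin_Tau tau_aut_gen)
    moreover have "?j l \<in> {1..n}" using i l by auto
    ultimately show ?thesis
      using lm.delta_gen[of "?j l" "S (slot l)"] S_closed[OF slot[of l]] by (auto simp: S slot)
  qed
  then have "lm.K_LM ?w u (j, k) = (\<Sum>l\<in>{1..n}. if l = ?j j then S (slot (?j j)) k else 0)"
    unfolding lm.K_LM_def slot_eq by (rule sum.cong[OF HOL.refl])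
  also have "\<dots> = (if ?j j \<in> {1..n} then S (slot (?j j)) k else 0)"
    by (simp only: sum.delta finite_atLeastAtMost)
  also have "\<dots> = S (slot (?j j)) k"
  proof (cases "?j j \<in> {1..n}")
    case False
    from zero[OF this] have "S (slot (?j j)) k = 0" by (simp only:) (simp add: S_def block_act_def)
    with False show ?thesis by (simp only: if_False)
  qed simp
  finally show ?thesis by (simp only: S_def slot_def)
qed

end


section \<open>Exact sequences in coordinates\<close>

text \<open>For an inverse generator the identity, as \<open>K2\<close> of the inverse after
  \<open>K2\<close> of the generator, is inserted in front of \<open>T\<close>, and the generator is
  pulled inside.\<close>

lemma equivariant_from_gens:
  assumes r1: "rep_coordinates (wB n) \<rho>1 J1 \<phi>1 K1" and r2: "rep_coordinates (wB n) \<rho>2 J2 \<phi>2 K2"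
    and T: "\<And>p. p \<in> fun_on J1 \<Longrightarrow> T p \<in> fun_on J2"
    and gens: "\<And>g p. g \<in> wB_gens n \<Longrightarrow> p \<in> fun_on J1 \<Longrightarrow> T (K1 (wB_class n [g]) p) = K2 (wB_class n [g]) (T p)"
    and w: "w \<in> carrier (wB n)" and p: "p \<in> fun_on J1"
  shows "T (K1 w p) = K2 w (T p)"
proof -
  interpret r1: rep_coordinates "wB n" \<rho>1 J1 \<phi>1 K1 by fact
  interpret r2: rep_coordinates "wB n" \<rho>2 J2 \<phi>2 K2 by fact
  have c: "wB_class n [g] \<in> carrier (wB n)" if "g \<in> wB_gens n" for g
    using that by (intro wB_class_carrier) simp
  show ?thesis using w p
  proof (induction arbitrary: p rule: wB_induct)
    case one
    then show ?case by (simp add: r1.K_one r2.K_one T)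
  next
    case (gen g w)
    then show ?case by (simp add: r1.K_mult r2.K_mult T c r1.K_closed gens)
  next
    case (inv_gen g w)
    let ?g = "wB_class n [g]" and ?i = "inv\<^bsub>wB n\<^esub> wB_class n [g]"
    have g: "?g \<in> carrier (wB n)" "?i \<in> carrier (wB n)" using c inv_gen by simp_all
    have r: "K1 w p \<in> fun_on J1" using inv_gen by (simp add: r1.K_closed)
    have "T (K1 ?i (K1 w p)) = K2 ?i (K2 ?g (T (K1 ?i (K1 w p))))"
      using g r by (simp add: T r1.K_closed r2.K_one flip: r2.K_mult)
    also have "K2 ?g (T (K1 ?i (K1 w p))) = T (K1 ?g (K1 ?i (K1 w p)))"
      using gens[OF inv_gen(1) r1.K_closed[OF g(2) r]] by simp
    also have "K1 ?g (K1 ?i (K1 w p)) = K1 w p"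
      using g r by (simp add: r1.K_one flip: r1.K_mult)
    finally show ?case using inv_gen g by (simp add: r1.K_mult r2.K_mult T)
  qed
qed

lemma rep_hom_from_coordinates:
  assumes r1: "rep_coordinates (wB n) \<rho>1 J1 \<phi>1 K1" and r2: "rep_coordinates (wB n) \<rho>2 J2 \<phi>2 K2"
    and T: "\<And>p. p \<in> fun_on J1 \<Longrightarrow> T p \<in> fun_on J2"
    and T_add: "\<And>p p'. T (\<lambda>i. p i + p' i) = (\<lambda>i. T p i + T p' i)"
    and T_smult: "\<And>r p. T (\<lambda>i. r * p i) = (\<lambda>i. \<alpha> r * T p i)"
    and gens: "\<And>g p. g \<in> wB_gens n \<Longrightarrow> p \<in> fun_on J1 \<Longrightarrow> T (K1 (wB_class n [g]) p) = K2 (wB_class n [g]) (T p)"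
  shows "(\<lambda>v. coordinates.point (space \<rho>2) \<phi>2 (T (\<phi>1 v))) \<in> rep_hom (wB n) \<alpha> \<rho>1 \<rho>2"
proof -
  interpret r1: rep_coordinates "wB n" \<rho>1 J1 \<phi>1 K1 by fact
  interpret r2: rep_coordinates "wB n" \<rho>2 J2 \<phi>2 K2 by fact
  let ?f = "\<lambda>v. r2.point (T (\<phi>1 v))"
  have closed: "?f v \<in> carrier (space \<rho>2)" and coord: "\<phi>2 (?f v) = T (\<phi>1 v)" if "v \<in> carrier (space \<rho>1)" for v
    using that by (simp_all add: r2.point_closed r2.coord_point T r1.coord_closed)
  show ?thesis
    unfolding rep_hom_def
  proof (intro CollectI conjI allI ballI)
    show "?f \<in> hom (add_monoid (space \<rho>1)) (add_monoid (space \<rho>2))"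
    proof (rule homI)
      fix v v' assume "v \<in> carrier (add_monoid (space \<rho>1))" "v' \<in> carrier (add_monoid (space \<rho>1))"
      then show "?f (v \<otimes>\<^bsub>add_monoid (space \<rho>1)\<^esub> v') = ?f v \<otimes>\<^bsub>add_monoid (space \<rho>2)\<^esub> ?f v'"
        by (auto intro!: r2.coord_eqD simp: coord closed r1.add_closed r2.add_closed r1.coord_add r2.coord_add T_add
              r2.point_closed r2.coord_point T r1.coord_closed)
    qed (simp add: closed)
  next
    fix r v assume "v \<in> carrier (space \<rho>1)"
    then show "?f (r \<odot>\<^bsub>space \<rho>1\<^esub> v) = \<alpha> r \<odot>\<^bsub>space \<rho>2\<^esub> ?f v"
      by (auto intro!: r2.coord_eqD simp: coord closed r1.smult_closed r2.smult_closed r1.coord_smult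
          r2.coord_smult T_smult r2.point_closed r2.coord_point T r1.coord_closed)
  next
    fix w v assume "w \<in> carrier (wB n)" "v \<in> carrier (space \<rho>1)"
    then show "?f (act \<rho>1 w v) = act \<rho>2 w (?f v)"
      using equivariant_from_gens[where T = T, OF r1 r2 T gens, of w "\<phi>1 v"]
      by (auto intro!: r2.coord_eqD simp: coord closed r1.act_closed r2.act_closed r1.coord_act r2.coord_act
          r1.coord_closed r2.point_closed r2.coord_point T r2.K_closed)
  qed
qed

text \<open>Exactness becomes a statement about the maps \<open>T\<close> and \<open>U\<close>
  between function spaces, with equivariance tested on generators; \<open>\<alpha>\<close> and
  \<open>\<beta>\<close> record how the two maps move scalars.\<close>

lemma short_exact_sequence_from_coordinates:
  assumes r1: "rep_coordinates (wB n) \<rho>1 J1 \<phi>1 K1" and r2: "rep_coordinates (wB n) \<rho>2 J2 \<phi>2 K2"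
    and r3: "rep_coordinates (wB n) \<rho>3 J3 \<phi>3 K3"
    and iso: "\<alpha> \<in> ring_iso class_ring class_ring" "\<beta> \<in> ring_iso class_ring class_ring"
    and T: "\<And>p. p \<in> fun_on J1 \<Longrightarrow> T p \<in> fun_on J2"
      "\<And>p p'. T (\<lambda>i. p i + p' i) = (\<lambda>i. T p i + T p' i)"
      "\<And>r p. T (\<lambda>i. r * p i) = (\<lambda>i. \<alpha> r * T p i)"
      "\<And>g p. g \<in> wB_gens n \<Longrightarrow> p \<in> fun_on J1 \<Longrightarrow> T (K1 (wB_class n [g]) p) = K2 (wB_class n [g]) (T p)"
    and U: "\<And>p. p \<in> fun_on J2 \<Longrightarrow> U p \<in> fun_on J3"
      "\<And>p p'. U (\<lambda>i. p i + p' i) = (\<lambda>i. U p i + U p' i)"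
      "\<And>r p. U (\<lambda>i. r * p i) = (\<lambda>i. \<beta> r * U p i)"
      "\<And>g p. g \<in> wB_gens n \<Longrightarrow> p \<in> fun_on J2 \<Longrightarrow> U (K2 (wB_class n [g]) p) = K3 (wB_class n [g]) (U p)"
    and inj: "\<And>p p'. p \<in> fun_on J1 \<Longrightarrow> p' \<in> fun_on J1 \<Longrightarrow> T p = T p' \<Longrightarrow> p = p'"
    and exact: "\<And>p. p \<in> fun_on J1 \<Longrightarrow> U (T p) = (\<lambda>_. 0)"
      "\<And>p. p \<in> fun_on J2 \<Longrightarrow> U p = (\<lambda>_. 0) \<Longrightarrow> \<exists>p'\<in>fun_on J1. p = T p'"
    and onto: "\<And>p. p \<in> fun_on J3 \<Longrightarrow> \<exists>p'\<in>fun_on J2. p = U p'"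
  shows "short_exact_sequence (wB n) \<alpha> \<beta> \<rho>1 \<rho>2 \<rho>3"
proof -
  interpret r1: rep_coordinates "wB n" \<rho>1 J1 \<phi>1 K1 by fact
  interpret r2: rep_coordinates "wB n" \<rho>2 J2 \<phi>2 K2 by fact
  interpret r3: rep_coordinates "wB n" \<rho>3 J3 \<phi>3 K3 by fact
  define f where "f = (\<lambda>v. r2.point (T (\<phi>1 v)))"
  define g where "g = (\<lambda>v. r3.point (U (\<phi>2 v)))"
  have f: "f v \<in> carrier (space \<rho>2)" "\<phi>2 (f v) = T (\<phi>1 v)" if "v \<in> carrier (space \<rho>1)" for v
    using that by (simp_all add: f_def r2.point_closed r2.coord_point T r1.coord_closed)
  have g: "g v \<in> carrier (space \<rho>3)" "\<phi>3 (g v) = U (\<phi>2 v)" if "v \<in> carrier (space \<rho>2)" for v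
    using that by (simp_all add: g_def r3.point_closed r3.coord_point U r2.coord_closed)
  have "inj_on f (carrier (space \<rho>1))"
  proof (rule inj_onI)
    fix v v' assume v: "v \<in> carrier (space \<rho>1)" "v' \<in> carrier (space \<rho>1)" and "f v = f v'"
    then have "T (\<phi>1 v) = T (\<phi>1 v')" using f(2)[OF v(1)] f(2)[OF v(2)] by simp
    then have "\<phi>1 v = \<phi>1 v'" by (rule inj[OF r1.coord_closed[OF v(1)] r1.coord_closed[OF v(2)]])
    then show "v = v'" using v by (rule r1.coord_eqD)
  qed
  moreover have "f ` carrier (space \<rho>1) = a_kernel (space \<rho>2) (space \<rho>3) g"
  proof (intro equalityI subsetI)
    fix y assume "y \<in> f ` carrier (space \<rho>1)"
    then obtain v where v: "v \<in> carrier (space \<rho>1)" "y = f v" by blast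
    have "\<phi>3 (g y) = (\<lambda>_. 0)" using v by (simp add: g f exact r1.coord_closed)
    then have "g y = \<zero>\<^bsub>space \<rho>3\<^esub>"
      using v by (intro r3.coord_eqD) (simp_all add: g f r3.coord_zero r3.zero_closed)
    then show "y \<in> a_kernel (space \<rho>2) (space \<rho>3) g" using v by (simp add: a_kernel_def' f)
  next
    fix y assume "y \<in> a_kernel (space \<rho>2) (space \<rho>3) g"
    then have y: "y \<in> carrier (space \<rho>2)" "g y = \<zero>\<^bsub>space \<rho>3\<^esub>" by (simp_all add: a_kernel_def')
    then have "U (\<phi>2 y) = (\<lambda>_. 0)" using g(2)[OF y(1)] by (simp add: r3.coord_zero)
    then obtain p where p: "p \<in> fun_on J1" "\<phi>2 y = T p" using exact(2) r2.coord_closed y by blast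
    have "y = f (r1.point p)"
      using p y by (intro r2.coord_eqD) (simp_all add: f r1.point_closed r1.coord_point)
    then show "y \<in> f ` carrier (space \<rho>1)" using p r1.point_closed by blast
  qed
  moreover have "g ` carrier (space \<rho>2) = carrier (space \<rho>3)"
  proof (intro equalityI subsetI)
    fix z assume z: "z \<in> carrier (space \<rho>3)"
    then obtain p where p: "p \<in> fun_on J2" "\<phi>3 z = U p" using onto r3.coord_closed by blast
    have "z = g (r2.point p)"
      using p z by (intro r3.coord_eqD) (simp_all add: g r2.point_closed r2.coord_point)
    then show "z \<in> g ` carrier (space \<rho>2)" using p r2.point_closed by blast
  qed (auto simp: g)
  moreover have "f \<in> rep_hom (wB n) \<alpha> \<rho>1 \<rho>2"
    unfolding f_def by (rule rep_hom_from_coordinates[where T = T and \<alpha> = \<alpha>, OF r1 r2 T])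
  moreover have "g \<in> rep_hom (wB n) \<beta> \<rho>2 \<rho>3"
    unfolding g_def by (rule rep_hom_from_coordinates[where T = U and \<alpha> = \<beta>, OF r2 r3 U])
  ultimately show ?thesis
    unfolding short_exact_sequence_def
    using r1.representation r2.representation r3.representation iso by blast
qed


section \<open>The exact sequence over a general ring\<close>

lemma wB_gens_cases:
  assumes "g \<in> wB_gens n"
  obtains l where "Suc l < n" "g = Sig (Suc l)" | l where "Suc l < n" "g = Tau (Suc l)"
proof -
  from assms consider i where "1 \<le> i" "i < n" "g = Sig i" | i where "1 \<le> i" "i < n" "g = Tau i"
    by (auto simp: wB_gens_def)
  then show thesis
  proof cases
    case 1
    then show thesis using that(1)[of "i - 1"] by simp
  next
    case 2
    then show thesis using that(2)[of "i - 1"] by simp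
  qed
qed

lemma ring_iso_class_ringI:
  assumes "\<And>x y. h (x + y) = h x + h y" "\<And>x y. h (x * y) = h x * h y" "h 1 = 1" "bij h"
  shows "h \<in> ring_iso class_ring class_ring"
  unfolding ring_iso_def
  using assms by (auto intro!: ring_hom_memI)

text \<open>The Kronecker sum is folded back into operators, the dual action along rows and the
  Burau action along columns, so that the \<open>block_act\<close> formulas can be substituted on
  generators.\<close>

lemma tensor_rep_Bur_coordinates:
  fixes t t' q q' :: "'r::comm_ring_1"
  assumes t: "t * t' = 1" and q: "q * q' = 1"
  shows "\<exists>\<phi>. rep_coordinates (wB n) (tensor_rep (wB n) (Bur n t) (Bur_dual n q)) ({..<n} \<times> {..<n}) \<phi>
    (\<lambda>w p (i, k). Bur_K n t w (\<lambda>j. Bur_dual_K n q w (\<lambda>l. p (j, l)) k) i)"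
proof -
  interpret r: rep_coordinates "wB n" "Bur n t" "{..<n}" "vec_coord n" "Bur_K n t"
    by (rule rep_coordinates_Bur[OF t])
  interpret r': rep_coordinates "wB n" "Bur_dual n q" "{..<n}" "vec_coord n" "Bur_dual_K n q"
    by (rule rep_coordinates_Bur_dual[OF q])
  obtain \<phi> where \<phi>: "rep_coordinates (wB n) (tensor_rep (wB n) (Bur n t) (Bur_dual n q)) ({..<n} \<times> {..<n}) \<phi>
      (\<lambda>w p (i, k). \<Sum>j\<in>{..<n}. Bur_K n t w (\<lambda>i. if i = j then 1 else 0) i * Bur_dual_K n q w (\<lambda>l. p (j, l)) k)"
    using tensor_rep_rep_coordinates[OF r.rep_coordinates_axioms r'.rep_coordinates_axioms] by auto
  have "rep_coordinates (wB n) (tensor_rep (wB n) (Bur n t) (Bur_dual n q)) ({..<n} \<times> {..<n}) \<phi>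
    (\<lambda>w p (i, k). Bur_K n t w (\<lambda>j. Bur_dual_K n q w (\<lambda>l. p (j, l)) k) i)"
  proof (rule rep_coordinates.rep_coordinates_cong[OF \<phi>], rule ext)
    fix w and p :: "nat \<times> nat \<Rightarrow> 'r" and ik :: "nat \<times> nat"
    assume w: "w \<in> carrier (wB n)" and p: "p \<in> fun_on ({..<n} \<times> {..<n})"
    obtain i k where ik: "ik = (i, k)" by fastforce
    have "Bur_dual_K n q w (\<lambda>l. p (j, l)) k = 0" if "j \<notin> {..<n}" for j
    proof -
      have "(\<lambda>l. p (j, l)) = (\<lambda>_. 0)" using p that by (auto simp: fun_on_def)
      then show ?thesis using r'.K_zero[OF w] by simp
    qed
    then have "(\<lambda>j. Bur_dual_K n q w (\<lambda>l. p (j, l)) k) \<in> fun_on {..<n}" by (simp add: fun_on_def)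
    from r.K_expand[OF w _ this] show
      "(case ik of (i, k) \<Rightarrow> Bur_K n t w (\<lambda>j. Bur_dual_K n q w (\<lambda>l. p (j, l)) k) i) =
       (case ik of (i, k) \<Rightarrow> \<Sum>j\<in>{..<n}. Bur_K n t w (\<lambda>i. if i = j then 1 else 0) i * Bur_dual_K n q w (\<lambda>l. p (j, l)) k)"
      by (simp add: ik r.basis_def mult.commute)
  qed
  then show ?thesis by blast
qed

text \<open>On the multiples of \<open>e_0\<close> the computed Burau parameter is
  \<open>q * t'\<close>, so \<open>\<alpha>\<close> must carry \<open>q * t\<close> there. On the
  quotient it is \<open>q\<close> along the index of \<open>x_j - 1\<close>, with dual entry
  \<open>t'\<close> along the vector index, so \<open>\<beta>\<close> must carry \<open>q\<close> to
  \<open>t\<close> and \<open>t'\<close> to \<open>q'\<close>.\<close>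

theorem long_moody_Burau_sequence:
  fixes t t' q q' :: "'r::comm_ring_1" and \<alpha> \<beta> :: "'r \<Rightarrow> 'r"
  assumes t: "t * t' = 1" and q: "q * q' = 1"
    and \<alpha>: "\<And>x y. \<alpha> (x + y) = \<alpha> x + \<alpha> y" "\<And>x y. \<alpha> (x * y) = \<alpha> x * \<alpha> y" "\<alpha> 1 = 1" "bij \<alpha>"
      "\<alpha> q = q" "\<alpha> t = t'"
    and \<beta>: "\<And>x y. \<beta> (x + y) = \<beta> x + \<beta> y" "\<And>x y. \<beta> (x * y) = \<beta> x * \<beta> y" "\<beta> 1 = 1" "bij \<beta>"
      "\<beta> q = t" "\<beta> t' = q'"
  shows "short_exact_sequence (wB n) \<alpha> \<beta> (Bur n (q * t))
    (scale_rep n q' (LM1 n (scale_rep (n + 1) q (Bur_dual (n + 1) t))))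
    (tensor_rep (wB n) (Bur n t) (Bur_dual n q))"
proof -
  have q'q: "q' * q = 1" and tt: "t' * t = 1" using q t by (simp_all add: mult.commute)
  have cancel: "q' * (q * x) = x" "q * (q' * x) = x" for x using q q'q by (simp_all flip: mult.assoc)
  have cancel_t: "t' * (t * x) = x" "t * (t' * x) = x" for x using t tt by (simp_all flip: mult.assoc)
  have "\<beta> q' * t = 1" using \<beta>(2)[of q' q] \<beta>(3,5) q'q by simp
  then have \<beta>q': "\<beta> q' = t'" using t by (metis mult.assoc mult.commute mult_1)
  have qt: "(q * t) * (q' * t') = 1" using t q by (simp add: mult.left_commute[of t] cancel mult.assoc)
  have \<alpha>0: "\<alpha> 0 = 0" using \<alpha>(1)[of 0 0] by simp
  have \<beta>0: "\<beta> 0 = 0" using \<beta>(1)[of 0 0] by simp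
  have \<alpha>_diff: "\<alpha> (x - y) = \<alpha> x - \<alpha> y" for x y using \<alpha>(1)[of "x - y" y] by simp
  have \<beta>_diff: "\<beta> (x - y) = \<beta> x - \<beta> y" for x y using \<beta>(1)[of "x - y" y] by simp
  have \<alpha>_eq0: "\<alpha> x = 0 \<longleftrightarrow> x = 0" for x using \<alpha>(4) \<alpha>0 by (metis bij_def injD)
  have \<beta>_eq0: "\<beta> x = 0 \<longleftrightarrow> x = 0" for x using \<beta>(4) \<beta>0 by (metis bij_def injD)

  obtain \<phi>1 where \<phi>1: "rep_coordinates (wB (n + 1)) (scale_rep (n + 1) q (Bur_dual (n + 1) t)) {..<n + 1} \<phi>1
      (\<lambda>w p i. unit_char (n + 1) q w * Bur_dual_K (n + 1) t w p i)" (is "rep_coordinates _ ?\<rho>1 _ _ ?K1")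
    using scale_rep_rep_coordinates[OF q rep_coordinates_Bur_dual[OF t]] by blast
  interpret r1: rep_coordinates "wB (n + 1)" ?\<rho>1 "{..<n + 1}" \<phi>1 ?K1 by (rule \<phi>1)
  interpret td: twisted_dual n ?\<rho>1 \<phi>1 ?K1 q t'
    by unfold_locales (simp_all add: unit_char_gen[OF q] Bur_dual_K_gen[OF t])
  obtain \<phi>2 where \<phi>2: "rep_coordinates (wB n) (scale_rep n q' (LM1 n ?\<rho>1)) ({1..n} \<times> {..<n + 1}) \<phi>2
      (\<lambda>w p i. unit_char n q' w * td.lm.K_LM w p i)"
    using scale_rep_rep_coordinates[OF q'q td.lm.rep_coordinates_LM] by blast
  obtain \<phi>3 where \<phi>3: "rep_coordinates (wB n) (tensor_rep (wB n) (Bur n t) (Bur_dual n q)) ({..<n} \<times> {..<n}) \<phi>3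
      (\<lambda>w p (i, k). Bur_K n t w (\<lambda>j. Bur_dual_K n q w (\<lambda>l. p (j, l)) k) i)"
    using tensor_rep_Bur_coordinates[OF t q] by blast
  note char = unit_char_gen[OF q'q]

  \<comment> \<open>Slots of the middle term count from 1 and entries of \<open>Bur\<close> from 0,
    whence \<open>Suc l\<close>; \<open>k = 0\<close> is the coordinate of
    \<open>e_0\<close>.\<close>
  define T :: "(nat \<Rightarrow> 'r) \<Rightarrow> nat \<times> nat \<Rightarrow> 'r" where
    "T p = (\<lambda>(j, k). case j of 0 \<Rightarrow> 0 | Suc l \<Rightarrow> if k = 0 then \<alpha> (p l) else 0)" for p
  \<comment> \<open>Dropping coordinate 0 passes to the quotient by \<open>e_0\<close>; both
    remaining indices are lowered by one.\<close>
  define U :: "(nat \<times> nat \<Rightarrow> 'r) \<Rightarrow> nat \<times> nat \<Rightarrow> 'r" where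
    "U u = (\<lambda>(i, k). \<beta> (u (Suc i, Suc k)))" for u
  have T_closed: "T p \<in> fun_on ({1..n} \<times> {..<n + 1})" if "p \<in> fun_on {..<n}" for p
    using that by (auto simp: T_def fun_on_def \<alpha>0 split: nat.splits)
  have U_closed: "U u \<in> fun_on ({..<n} \<times> {..<n})" if "u \<in> fun_on ({1..n} \<times> {..<n + 1})" for u
    using that by (auto simp: U_def fun_on_def \<beta>0)
  show ?thesis
  proof (rule short_exact_sequence_from_coordinates[where T = T and U = U,
        OF rep_coordinates_Bur[OF qt] \<phi>2 \<phi>3])
    show "\<alpha> \<in> ring_iso class_ring class_ring" "\<beta> \<in> ring_iso class_ring class_ring"
      using \<alpha> \<beta> by (auto intro: ring_iso_class_ringI)
  next
    fix p p' :: "nat \<Rightarrow> 'r" and r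
    show "T (\<lambda>i. p i + p' i) = (\<lambda>i. T p i + T p' i)"
      by (auto simp: T_def \<alpha> fun_eq_iff split: nat.splits)
    show "T (\<lambda>i. r * p i) = (\<lambda>i. \<alpha> r * T p i)"
      by (auto simp: T_def \<alpha> fun_eq_iff split: nat.splits)
  next
    fix p p' :: "nat \<times> nat \<Rightarrow> 'r" and r
    show "U (\<lambda>i. p i + p' i) = (\<lambda>i. U p i + U p' i)" by (auto simp: U_def \<beta>)
    show "U (\<lambda>i. r * p i) = (\<lambda>i. \<beta> r * U p i)" by (auto simp: U_def \<beta>)
  next
    fix p p' :: "nat \<Rightarrow> 'r" assume "T p = T p'"
    then have "T p (Suc l, 0) = T p' (Suc l, 0)" for l by simp
    then show "p = p'" using \<alpha>(4) by (auto simp: T_def bij_def inj_eq)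
  next
    fix p :: "nat \<Rightarrow> 'r" show "U (T p) = (\<lambda>_. 0)" by (auto simp: U_def T_def \<beta>0)
  next
    fix u :: "nat \<times> nat \<Rightarrow> 'r" assume u: "u \<in> fun_on ({1..n} \<times> {..<n + 1})" and "U u = (\<lambda>_. 0)"
    then have "U u (j, k) = 0" for j k by simp
    then have 0: "u (Suc j, Suc k) = 0" for j k by (simp add: U_def \<beta>_eq0)
    have u0: "u (0, k) = 0" for k using u by (simp add: fun_on_def)
    define p where "p l = inv_into UNIV \<alpha> (u (Suc l, 0))" for l
    have \<alpha>p: "\<alpha> (p l) = u (Suc l, 0)" for l
      unfolding p_def using \<alpha>(4) by (simp add: bij_is_surj surj_f_inv_f)
    have "p \<in> fun_on {..<n}"
      unfolding fun_on_def
    proof (intro CollectI allI impI)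
      fix l assume "l \<notin> {..<n}"
      then have "\<alpha> (p l) = 0" using u by (simp add: \<alpha>p fun_on_def)
      then show "p l = 0" by (simp add: \<alpha>_eq0)
    qed
    moreover have "u = T p"
    proof
      fix jk show "u jk = T p jk"
        by (cases jk; cases "fst jk"; cases "snd jk") (auto simp: T_def \<alpha>p 0 u0)
    qed
    ultimately show "\<exists>p\<in>fun_on {..<n}. u = T p" by blast
  next
    fix p :: "nat \<times> nat \<Rightarrow> 'r" assume p: "p \<in> fun_on ({..<n} \<times> {..<n})"
    \<comment> \<open>The preimage without component along \<open>e_0\<close>.\<close>
    define u where "u = (\<lambda>(j, k). case j of 0 \<Rightarrow> 0 | Suc a \<Rightarrow>
      (case k of 0 \<Rightarrow> 0 | Suc b \<Rightarrow> inv_into UNIV \<beta> (p (a, b))))"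
    have \<beta>i: "\<beta> (inv_into UNIV \<beta> x) = x" for x using \<beta>(4) by (simp add: bij_is_surj surj_f_inv_f)
    have inv0: "inv_into UNIV \<beta> 0 = 0" using \<beta>i[of 0] \<beta>_eq0 by blast
    have "u \<in> fun_on ({1..n} \<times> {..<n + 1})"
      using p by (auto simp: u_def fun_on_def inv0 split: nat.splits)
    moreover have "p = U u" by (auto simp: U_def u_def \<beta>i fun_eq_iff)
    ultimately show "\<exists>u\<in>fun_on ({1..n} \<times> {..<n + 1}). p = U u" by blast
  next
    fix g and p :: "nat \<Rightarrow> 'r" assume g: "g \<in> wB_gens n" and p: "p \<in> fun_on {..<n}"
    note Tp = T_closed[OF p]
    show "T (Bur_K n (q * t) (wB_class n [g]) p) =
        (\<lambda>i. unit_char n q' (wB_class n [g]) * td.lm.K_LM (wB_class n [g]) (T p) i)"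
      using g
    proof (cases rule: wB_gens_cases)
      case (1 l)
      have l: "1 \<le> Suc l" "Suc l < n" using 1 by auto
      show ?thesis
      proof (rule ext, clarify)
        fix j k
        show "T (Bur_K n (q * t) (wB_class n [g]) p) (j, k) =
            unit_char n q' (wB_class n [g]) * td.lm.K_LM (wB_class n [g]) (T p) (j, k)"
          \<comment> \<open>On multiples of \<open>e_0\<close> the operator \<open>xi_act\<close> is
            multiplication by \<open>q * t'\<close>, and the outer \<open>q'\<close> cancels the
            \<open>q\<close> of the generator; the block left over has the entries
            \<open>0, q t', 1, 1 - q t'\<close>.\<close>
          unfolding 1(2) Bur_K_gen(1)[OF qt l(2) p] char(1)[OF l] td.K_LM_Sig[OF l Tp] td.xi_act_def
          by (cases j; cases k)
            (auto simp: T_def block_act_def \<alpha> \<alpha>0 \<alpha>_diff cancel algebra_simps,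
             simp_all add: Suc_eq_plus1 add.commute)
      qed
    next
      case (2 l)
      have l: "1 \<le> Suc l" "Suc l < n" using 2 by auto
      show ?thesis
      proof (rule ext, clarify)
        fix j k
        show "T (Bur_K n (q * t) (wB_class n [g]) p) (j, k) =
            unit_char n q' (wB_class n [g]) * td.lm.K_LM (wB_class n [g]) (T p) (j, k)"
          unfolding 2(2) Bur_K_gen(2)[OF qt l(2) p] char(2)[OF l] td.K_LM_Tau[OF l Tp]
          by (cases j; cases k) (auto simp: T_def block_act_def \<alpha> \<alpha>0, simp_all add: Suc_eq_plus1)
      qed
    qed
  next
    fix g and u :: "nat \<times> nat \<Rightarrow> 'r" assume g: "g \<in> wB_gens n" and u: "u \<in> fun_on ({1..n} \<times> {..<n + 1})"
    have slot: "(\<lambda>l. U u (j, l)) \<in> fun_on {..<n}" for j using U_closed[OF u] by (simp add: fun_on_def)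
    have zero: "U u (j, l) = 0" if "n \<le> j" for j l using U_closed[OF u] that by (simp add: fun_on_def)
    show "U (\<lambda>i. unit_char n q' (wB_class n [g]) * td.lm.K_LM (wB_class n [g]) u i) =
        (\<lambda>(i, k). Bur_K n t (wB_class n [g]) (\<lambda>j. Bur_dual_K n q (wB_class n [g]) (\<lambda>l. U u (j, l)) k) i)"
      using g
    proof (cases rule: wB_gens_cases)
      case (1 l)
      have l: "1 \<le> Suc l" "Suc l < n" using 1 by auto
      show ?thesis
      proof (rule ext, clarify)
        fix i k
        have c: "(\<lambda>j. block_act l (1 - q') q' 1 0 (\<lambda>l. U u (j, l)) k) \<in> fun_on {..<n}"
          by (auto simp: fun_on_def block_act_def zero)
        show "U (\<lambda>i. unit_char n q' (wB_class n [g]) * td.lm.K_LM (wB_class n [g]) u i) (i, k) =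
          Bur_K n t (wB_class n [g]) (\<lambda>j. Bur_dual_K n q (wB_class n [g]) (\<lambda>l. U u (j, l)) k) i"
          unfolding 1(2) Bur_dual_K_gen(1)[OF q l(2) slot] Bur_K_gen(1)[OF t l(2) c]
          \<comment> \<open>Away from entry 0 \<open>xi_act\<close> is multiplication by
            \<open>q\<close>, so the two affected slots combine by the Burau block with parameter
            \<open>q\<close>, which \<open>\<beta>\<close> turns into \<open>t\<close>.\<close>
          unfolding U_def prod.case char(1)[OF l] td.K_LM_Sig[OF l u] td.xi_act_def
          by (auto simp: block_act_def \<beta> \<beta>0 \<beta>_diff \<beta>q' cancel cancel_t algebra_simps,
              simp_all add: Suc_eq_plus1 add.commute)
      qed
    next
      case (2 l)
      have l: "1 \<le> Suc l" "Suc l < n" using 2 by auto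
      show ?thesis
      proof (rule ext, clarify)
        fix i k
        have c: "(\<lambda>j. block_act l 0 1 1 0 (\<lambda>l. U u (j, l)) k) \<in> fun_on {..<n}"
          by (auto simp: fun_on_def block_act_def zero)
        show "U (\<lambda>i. unit_char n q' (wB_class n [g]) * td.lm.K_LM (wB_class n [g]) u i) (i, k) =
          Bur_K n t (wB_class n [g]) (\<lambda>j. Bur_dual_K n q (wB_class n [g]) (\<lambda>l. U u (j, l)) k) i"
          unfolding 2(2) Bur_dual_K_gen(2)[OF q l(2) slot] Bur_K_gen(2)[OF t l(2) c]
          unfolding U_def prod.case char(2)[OF l] td.K_LM_Tau[OF l u]
          by (auto simp: block_act_def \<beta> \<beta>0, simp_all add: Suc_eq_plus1)
      qed
    qed
  qed (use T_closed U_closed in auto)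
qed


section \<open>Automorphisms of the Laurent polynomial ring\<close>

lemma frag_of_mult: "frag_of a * frag_of b = (frag_of (a + b) :: laurent)"
  by (simp add: mult_single)

lemma frag_of_zero: "frag_of 0 = (1 :: laurent)"
  by (rule single_one)

text \<open>An additive map of exponents induces a ring homomorphism of group rings: both sides are
  additive in each argument and agree on monomials.\<close>

lemma frag_extend_additive_mult:
  fixes h :: "int \<times> int \<Rightarrow> int \<times> int"
  assumes h: "\<And>a b. h (a + b) = h a + h b"
  defines "\<theta> \<equiv> frag_extend (\<lambda>x. frag_of (h x))"
  shows "\<theta> (c * d) = \<theta> c * \<theta> d"
proof -
  have one: "\<theta> (frag_of a * d) = \<theta> (frag_of a) * \<theta> d" for a
  proof -
    have "Poly_Mapping.keys d \<subseteq> UNIV" by simp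
    then show ?thesis
      by (induction d rule: frag_induction)
        (simp_all add: \<theta>_def frag_of_mult h frag_extend_diff right_diff_distrib)
  qed
  have "Poly_Mapping.keys c \<subseteq> UNIV" by simp
  then show ?thesis
  proof (induction c rule: frag_induction)
    case (one a)
    show ?case by (rule \<open>\<And>a. \<theta> (frag_of a * d) = \<theta> (frag_of a) * \<theta> d\<close>)
  qed (simp_all add: \<theta>_def frag_extend_diff left_diff_distrib)
qed

lemma frag_extend_involution:
  assumes "\<And>a. h (h a) = a"
  shows "bij (frag_extend (\<lambda>x. frag_of (h x)))"
proof (rule involuntory_imp_bij)
  fix c
  have "frag_extend (\<lambda>x. frag_of (h x)) (frag_extend (\<lambda>x. frag_of (h x)) c) = frag_extend frag_of c"
    using frag_extend_compose[of "\<lambda>x. frag_of (h x)" h c] by (simp add: o_def assms)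
  then show "frag_extend (\<lambda>x. frag_of (h x)) (frag_extend (\<lambda>x. frag_of (h x)) c) = c"
    by (simp flip: frag_expansion)
qed

lemma invert_t_eq: "invert_t = frag_extend (\<lambda>x. frag_of (- fst x, snd x))"
  unfolding invert_t_def by (rule arg_cong[of _ _ frag_extend]) auto

lemma swap_t_q_eq: "swap_t_q = frag_extend (\<lambda>x. frag_of (snd x, fst x))"
  unfolding swap_t_q_def by (rule arg_cong[of _ _ frag_extend]) auto

text \<open>The inverse in \<open>class_ring\<close> is given by a description; by uniqueness of
  inverses in a commutative monoid it is determined once one inverse monomial is exhibited.\<close>

lemma q_inv_eq: "q_inv = frag_of (0, - 1)"
proof -
  have "comm_monoid (class_ring :: laurent ring)"
    by (rule comm_monoidI) (auto simp: algebra_simps)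
  from comm_monoid.comm_inv_char[OF this, of q_var "frag_of (0, - 1)"]
  show ?thesis by (simp add: q_inv_def q_var_def frag_of_mult frag_of_zero[unfolded zero_prod_def])
qed

theorem theorem2p6:
  fixes n :: nat
  assumes "n \<ge> 3"
  shows "short_exact_sequence (wB n) invert_t swap_t_q
    (Bur n (q_var * t_var))
    (scale_rep n q_inv (LM1 n (scale_rep (n + 1) q_var (Bur_dual (n + 1) t_var))))
    (tensor_rep (wB n) (Bur n t_var) (Bur_dual n q_var))"
proof (rule long_moody_Burau_sequence)
  note one = frag_of_zero[unfolded zero_prod_def]
  \<comment> \<open>The monomial \<open>frag_of (- 1, 0)\<close> is the inverse of
    \<open>t_var\<close> and plays the role of \<open>t'\<close>.\<close>
  show "t_var * frag_of (- 1, 0) = 1" by (simp add: t_var_def frag_of_mult one)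
  show "q_var * q_inv = 1" by (simp add: q_var_def q_inv_eq frag_of_mult one)
  show "bij invert_t" unfolding invert_t_eq by (rule frag_extend_involution) simp
  show "bij swap_t_q" unfolding swap_t_q_eq by (rule frag_extend_involution) simp
  show "invert_t (x * y) = invert_t x * invert_t y" for x y
    unfolding invert_t_eq by (rule frag_extend_additive_mult) simp
  show "swap_t_q (x * y) = swap_t_q x * swap_t_q y" for x y
    unfolding swap_t_q_eq by (rule frag_extend_additive_mult) simp
next
  show "invert_t 1 = 1" "swap_t_q 1 = 1"
    by (simp_all add: invert_t_eq swap_t_q_eq zero_prod_def del: single_one flip: frag_of_zero)
qed (simp_all add: invert_t_eq swap_t_q_eq q_inv_eq frag_extend_add q_var_def t_var_def)

end
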